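(* Suppose a weighted homogeneous cubic equation $K_3dy^3+K_2dy^2dx+K_1dy\,dx^2+K_0dx^3=0$ (with $K_i$ holomorphic germs at $(\mathbb C^2,0)$, not all vanishing at the origin) has a flat web of solutions, and that one of its weights $w_x,w_y$ vanishes. Then, for some nonnegative integer $N$ and constants $L_0,L_1$, the equation is equivalent to one from the following list ($p=\frac{dy}{dx}$): 1) $p^3=x^{N}y^3$; 2) $p^3+x^Ny^2p=\frac{2}{\sqrt{27}}x^{\frac{3}{2}N}y^3\tan\left(L_0x^{1+\frac{N}{2}}+L_1\right)$; 3) $p^3+x^{N+1}y^2p+\dfrac{2x^{\frac{3}{2}(N+1)}y^3}{\sqrt{27}\tan\left(L_0x^{1+\frac{N+1}{2}}\right)}=0$; 4) $p(x^2y^Np^2+1)=0$. For the form 2), $L_1\ne\frac{\pi}{2}$, $L_1=0$ for odd $N$, and with $L_1\ne0$ one can choose $0\le\arg(L_1)<\pi$.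
   Context: All objects are holomorphic germs at the origin of $\mathbb C^2$. A binary cubic equation $K_3dy^3+K_2dy^2dx+K_1dy\,dx^2+K_0dx^3=0$, with holomorphic germs $K_i(x,y)$, at least one not vanishing at $(0,0)$, and with discriminant not identically zero, defines a 3-web: outside the discriminant curve $\Delta$ (the set where at least two of the three directions coincide) its solutions form three pairwise transverse foliations. With $p=dy/dx$ it is written as an implicit cubic ODE. Two equations are equivalent if some biholomorphism germ of $(\mathbb C^2,0)$ fixing the origin maps one web to the other. The web of solutions is flat (hexagonal) if near each point outside $\Delta$ there is a local biholomorphism mapping the solutions to three families of parallel lines. The equation is weighted homogeneous if its web of solutions is invariant under the flow of a nontrivial Euler vector field $E=w_xx\partial_x+w_yy\partial_y$ with constants $w_x,w_y$ (not both zero), called the weights. The displayed equations are understood with those constants for which the coefficients are holomorphic germs (e.g. $L_0\neq0$ in 3)). *)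

theory Defs
  imports "HOL-Complex_Analysis.Complex_Analysis"
begin

text \<open>
  A germ at the origin is represented by a total function; every notion below depends only on its
  values in arbitrarily small neighbourhoods of the origin.
\<close>

type_synonym point = "complex \<times> complex"

text \<open>Complex differentiability in two variables: the (real) Frechet derivative is complex linear.\<close>

definition holo2_on :: "(point \<Rightarrow> complex) \<Rightarrow> point set \<Rightarrow> bool" where
  "holo2_on f U \<longleftrightarrow> open U \<and>
     (\<forall>z\<in>U. \<exists>a b. (f has_derivative (\<lambda>(u, v). a * u + b * v)) (at z))"

definition holo_map_on :: "(point \<Rightarrow> point) \<Rightarrow> point set \<Rightarrow> bool" where
  "holo_map_on \<phi> U \<longleftrightarrow> holo2_on (\<lambda>z. fst (\<phi> z)) U \<and> holo2_on (\<lambda>z. snd (\<phi> z)) U"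

definition biholo_on :: "(point \<Rightarrow> point) \<Rightarrow> point set \<Rightarrow> bool" where
  "biholo_on \<phi> U \<longleftrightarrow> holo_map_on \<phi> U \<and> inj_on \<phi> U \<and> holo_map_on (inv_into U \<phi>) (\<phi> ` U)"

text \<open>
  \<open>Cubic K3 K2 K1 K0\<close> stands for \<open>K3 dy^3 + K2 dy^2 dx + K1 dy dx^2 + K0 dx^3 = 0\<close>.
  In terms of \<open>p = dy/dx\<close> this is \<open>K3 p^3 + K2 p^2 + K1 p + K0 = 0\<close>, where a vertical direction
  counts as \<open>p = \<infinity>\<close>.
\<close>

datatype cubic = Cubic (cf3: "point \<Rightarrow> complex") (cf2: "point \<Rightarrow> complex")
                       (cf1: "point \<Rightarrow> complex") (cf0: "point \<Rightarrow> complex")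

definition cubic_form :: "cubic \<Rightarrow> point \<Rightarrow> complex \<Rightarrow> complex \<Rightarrow> complex" where
  "cubic_form K z dx dy =
     cf3 K z * dy^3 + cf2 K z * dy^2 * dx + cf1 K z * dy * dx^2 + cf0 K z * dx^3"

definition discr :: "cubic \<Rightarrow> point \<Rightarrow> complex" where
  "discr K z = (let a = cf3 K z; b = cf2 K z; c = cf1 K z; d = cf0 K z in
     b^2 * c^2 - 4 * a * c^3 - 4 * b^3 * d - 27 * a^2 * d^2 + 18 * a * b * c * d)"

definition discr_curve :: "cubic \<Rightarrow> point set" where
  "discr_curve K = {z. discr K z = 0}"

definition cubic_equation :: "cubic \<Rightarrow> bool" where
  "cubic_equation K \<longleftrightarrow>
     (\<exists>U. (0, 0) \<in> U \<and> holo2_on (cf3 K) U \<and> holo2_on (cf2 K) U \<and>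
          holo2_on (cf1 K) U \<and> holo2_on (cf0 K) U) \<and>
     (cf3 K (0, 0) \<noteq> 0 \<or> cf2 K (0, 0) \<noteq> 0 \<or> cf1 K (0, 0) \<noteq> 0 \<or> cf0 K (0, 0) \<noteq> 0) \<and>
     \<not> (\<forall>\<^sub>F z in nhds (0, 0). discr K z = 0)"

text \<open>
  The solutions of \<open>K\<close> inside \<open>S\<close>, as unparametrised curves: images of holomorphic immersions of
  plane domains all of whose tangent vectors annihilate the cubic form.  Since all connected pieces
  of leaves are included, restricting to a smaller region just selects the curves contained in it.
\<close>

definition solutions :: "cubic \<Rightarrow> point set \<Rightarrow> point set set" where
  "solutions K S = {(\<lambda>t. (x t, y t)) ` D | x y D.
     open D \<and> connected D \<and> D \<noteq> {} \<and> x holomorphic_on D \<and> y holomorphic_on D \<and>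
     (\<forall>t\<in>D. (x t, y t) \<in> S \<and> (deriv x t, deriv y t) \<noteq> (0, 0) \<and>
            cubic_form K (x t, y t) (deriv x t) (deriv y t) = 0)}"

text \<open>The biholomorphism germ \<open>\<phi>\<close> fixes the origin and maps the web of \<open>K\<close> to the web of \<open>K'\<close>.\<close>

definition maps_web :: "(point \<Rightarrow> point) \<Rightarrow> cubic \<Rightarrow> cubic \<Rightarrow> bool" where
  "maps_web \<phi> K K' \<longleftrightarrow> \<phi> (0, 0) = (0, 0) \<and>
     (\<exists>U. (0, 0) \<in> U \<and> biholo_on \<phi> U \<and>
          (\<lambda>C. \<phi> ` C) ` solutions K (U - discr_curve K) =
            solutions K' (\<phi> ` U - discr_curve K'))"

definition equivalent_cubics :: "cubic \<Rightarrow> cubic \<Rightarrow> bool" where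
  "equivalent_cubics K K' \<longleftrightarrow> (\<exists>\<phi>. maps_web \<phi> K K')"

text \<open>Connected pieces, contained in \<open>W\<close>, of the lines with direction vector \<open>d\<close>.\<close>

definition line_pieces :: "point \<Rightarrow> point set \<Rightarrow> point set set" where
  "line_pieces d W = {(\<lambda>t. (fst q + t * fst d, snd q + t * snd d)) ` D | q D.
     open D \<and> connected D \<and> D \<noteq> {} \<and>
     (\<forall>t\<in>D. (fst q + t * fst d, snd q + t * snd d) \<in> W)}"

definition independent2 :: "point \<Rightarrow> point \<Rightarrow> bool" where
  "independent2 d e \<longleftrightarrow> fst d * snd e - snd d * fst e \<noteq> 0"

definition flat_web :: "cubic \<Rightarrow> bool" where
  "flat_web K \<longleftrightarrow> (\<exists>U. open U \<and> (0, 0) \<in> U \<and>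
     (\<forall>z\<in>U - discr_curve K. \<exists>V \<phi> d1 d2 d3.
        z \<in> V \<and> V \<subseteq> U - discr_curve K \<and> biholo_on \<phi> V \<and>
        independent2 d1 d2 \<and> independent2 d1 d3 \<and> independent2 d2 d3 \<and>
        (\<lambda>C. \<phi> ` C) ` solutions K V =
          line_pieces d1 (\<phi> ` V) \<union> line_pieces d2 (\<phi> ` V) \<union> line_pieces d3 (\<phi> ` V)))"

text \<open>The time-\<open>t\<close> flow of the Euler field \<open>w\<^sub>x x \<partial>\<^sub>x + w\<^sub>y y \<partial>\<^sub>y\<close>.\<close>

definition euler_flow :: "complex \<Rightarrow> complex \<Rightarrow> complex \<Rightarrow> point \<Rightarrow> point" where
  "euler_flow wx wy t = (\<lambda>(x, y). (exp (wx * t) * x, exp (wy * t) * y))"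

definition weighted_homogeneous :: "cubic \<Rightarrow> complex \<Rightarrow> complex \<Rightarrow> bool" where
  "weighted_homogeneous K wx wy \<longleftrightarrow>
     (wx \<noteq> 0 \<or> wy \<noteq> 0) \<and> (\<forall>t. maps_web (euler_flow wx wy t) K K)"

definition normal_form_1 :: "nat \<Rightarrow> cubic \<Rightarrow> bool" where
  "normal_form_1 N K \<longleftrightarrow> K = Cubic (\<lambda>_. 1) (\<lambda>_. 0) (\<lambda>_. 0) (\<lambda>(x, y). - (x^N * y^3))"

text \<open>
  Half-integer powers of \<open>x\<close> are written as integer powers of a square root \<open>s\<close> of \<open>x\<close>, so that
  \<open>x^(3N/2) = s^(3N)\<close> and \<open>x^(1+N/2) = s^(N+2)\<close>.  The holomorphic coefficient \<open>k\<close> has to reproduce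
  the formula for both square roots of \<open>x\<close>; \<open>s = 0\<close> is left out because the formula may have a
  removable singularity there.
\<close>

definition normal_form_2 :: "nat \<Rightarrow> complex \<Rightarrow> complex \<Rightarrow> cubic \<Rightarrow> bool" where
  "normal_form_2 N L0 L1 K \<longleftrightarrow> (\<exists>k. k analytic_on {0} \<and>
     (\<forall>\<^sub>F s in at 0. k (s^2) =
        2 / complex_of_real (sqrt 27) * s^(3 * N) * tan (L0 * s^(N + 2) + L1)) \<and>
     K = Cubic (\<lambda>_. 1) (\<lambda>_. 0) (\<lambda>(x, y). x^N * y^2) (\<lambda>(x, y). - (k x * y^3)))"

definition normal_form_3 :: "nat \<Rightarrow> complex \<Rightarrow> cubic \<Rightarrow> bool" where
  "normal_form_3 N L0 K \<longleftrightarrow> L0 \<noteq> 0 \<and> (\<exists>k. k analytic_on {0} \<and>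
     (\<forall>\<^sub>F s in at 0. k (s^2) =
        2 * s^(3 * (N + 1)) / (complex_of_real (sqrt 27) * tan (L0 * s^(N + 3)))) \<and>
     K = Cubic (\<lambda>_. 1) (\<lambda>_. 0) (\<lambda>(x, y). x^(N + 1) * y^2) (\<lambda>(x, y). k x * y^3))"

definition normal_form_4 :: "nat \<Rightarrow> cubic \<Rightarrow> bool" where
  "normal_form_4 N K \<longleftrightarrow> K = Cubic (\<lambda>(x, y). x^2 * y^N) (\<lambda>_. 0) (\<lambda>_. 1) (\<lambda>_. 0)"

text \<open>
  The constant \<open>L1\<close> in the second form matters only modulo the period \<open>\<pi>\<close> of the tangent, so
  \<open>L1 \<noteq> \<pi>/2\<close> is required modulo \<open>\<pi>\<close>, that is, \<open>cos L1 \<noteq> 0\<close>.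
\<close>

definition admissible_L1 :: "nat \<Rightarrow> complex \<Rightarrow> bool" where
  "admissible_L1 N L1 \<longleftrightarrow> cos L1 \<noteq> 0 \<and> (odd N \<longrightarrow> L1 = 0) \<and>
     (L1 \<noteq> 0 \<longrightarrow> 0 \<le> Arg L1 \<and> Arg L1 < pi)"

end

theory Submission
  imports Defs
begin

text \<open>
  Exchanging the coordinates if necessary, let \<open>w\<^sub>x = 0\<close>. Then the flow of
  \<open>y \<partial>\<^sub>y\<close> preserves the web. Through a point off the discriminant pass
  leaves in three directions, so the cubic form there is determined up to a factor by its leaves;
  hence the form and its pullback under \<open>(x, y) \<mapsto> (x, y/2)\<close> are proportional.
  If \<open>K\<^sub>j\<close> does not vanish at the origin, comparing Taylor coefficients in
  \<open>y\<close> gives \<open>K\<^sub>i = K\<^sub>j a\<^sub>i(x) y^(j-i)\<close>, which is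
  \<open>0\<close> for \<open>i > j\<close>; since the discriminant is not identically zero,
  \<open>j\<close> is \<open>2\<close> or \<open>3\<close>
  (\<open>homogeneous_coefficients\<close>). So with \<open>u = log y\<close> the web is \<open>du =
  r\<^sub>i(x) dx\<close>, where for \<open>j = 2\<close> one of the foliations is \<open>dx =
  0\<close>. Two kinds of coordinate changes remain: multiplying \<open>y\<close> by a unit
  \<open>h(x)\<close> adds \<open>h'/h\<close> to all slopes, and a new coordinate
  \<open>f(x)\<close> divides them by \<open>f'\<close>.

  For \<open>j = 2\<close> the first change makes the two finite slopes opposite and the second
  makes the product of these slopes a power of \<open>x\<close>
  (\<open>normalizing_coordinate\<close>). This is the fourth normal form with the coordinates
  exchanged.

  For \<open>j = 3\<close> the first change makes the sum of the slopes zero, so that they are the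
  roots of \<open>r^3 + q(x) r + k(x)\<close>. A flat web has local first integrals \<open>F\<^sub>1
  + F\<^sub>2 + F\<^sub>3 = 0\<close>. Each is a function \<open>f\<^sub>i\<close> of \<open>u -
  R\<^sub>i(x)\<close> with \<open>R\<^sub>i' = r\<^sub>i\<close>; differentiating the sum in
  \<open>u\<close> and \<open>x\<close> shows that all \<open>f\<^sub>i''/f\<^sub>i'\<close> are one
  constant (\<open>abelian_equation\<close>), and in terms of \<open>q\<close> and \<open>k\<close>
  this reads \<open>2 q k' - 3 k q' = C (4 q^3 + 27 k^2)\<close> with a constant \<open>C\<close>
  (\<open>flat_ode\<close>). If \<open>q = 0\<close>, a new coordinate makes \<open>-k\<close> a
  power of \<open>x\<close>: the first normal form. Otherwise make \<open>q = x^N\<close>, and let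
  \<open>x = s^2\<close>. The function \<open>T = - (\<surd>27/2) k / s^(3N)\<close> then satisfies
  \<open>T' = c s^(N+1) (1 + T^2)\<close>, and its Cayley transform \<open>(1 + \<i>T)/(1 -
  \<i>T)\<close> a linear equation, so that \<open>T = tan (L\<^sub>0 s^(N+2) + L\<^sub>1)\<close>
  (\<open>cayley_solution\<close>, \<open>normalized_ode_solution\<close>). A pole of
  \<open>T\<close> at \<open>s = 0\<close> gives the third normal form, a finite value the second.
  For odd \<open>N\<close> the function \<open>T\<close> is odd, so a finite value at
  \<open>0\<close> vanishes and \<open>L\<^sub>1 = 0\<close>; the sign of \<open>L\<^sub>1\<close>
  can be changed by rotating \<open>x\<close> by a root of unity, which leaves \<open>q =
  x^N\<close> unchanged (\<open>tan_coefficient_flip\<close>).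
\<close>

section \<open>Holomorphic functions of two variables\<close>

text \<open>
  The two coefficients of the derivative are arguments here, because the chain rules, the Jacobian
  determinant and the tangent directions of leaves refer to them.
\<close>

definition has_partials :: "(point \<Rightarrow> complex) \<Rightarrow> complex \<Rightarrow> complex \<Rightarrow> point \<Rightarrow> bool" where
  "has_partials F a b z \<longleftrightarrow> (F has_derivative (\<lambda>(u, v). a * u + b * v)) (at z)"

lemma holo2_on_altdef: "holo2_on F U \<longleftrightarrow> open U \<and> (\<forall>z\<in>U. \<exists>a b. has_partials F a b z)"
  by (simp add: holo2_on_def has_partials_def)

lemma holo2_on_subset: "holo2_on F U \<Longrightarrow> open V \<Longrightarrow> V \<subseteq> U \<Longrightarrow> holo2_on F V"
  by (auto simp: holo2_on_def)

lemma has_partials_unique: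
  assumes "has_partials F a b z" "has_partials F a' b' z"
  shows "a = a'" "b = b'"
proof -
  have "(\<lambda>(u, v). a * u + b * v) = (\<lambda>(u, v). a' * u + b' * v)"
    using assms unfolding has_partials_def by (rule has_derivative_unique)
  from fun_cong[OF this, of "(1,0)"] fun_cong[OF this, of "(0,1)"]
  show "a = a'" "b = b'" by auto
qed

lemma has_partials_isCont: "has_partials F a b z \<Longrightarrow> isCont F z"
  unfolding has_partials_def by (rule has_derivative_continuous)

lemma holo2_on_imp_continuous_on: "holo2_on F U \<Longrightarrow> continuous_on U F"
  unfolding holo2_on_altdef by (meson continuous_at_imp_continuous_on has_partials_isCont)

lemma has_partials_transform:
  assumes "has_partials F a b z" "open S" "z \<in> S" "\<And>w. w \<in> S \<Longrightarrow> F w = G w"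
  shows "has_partials G a b z"
  using assms unfolding has_partials_def by (metis has_derivative_transform_within_open)

lemma holo2_on_cong:
  assumes "holo2_on F U" "\<And>w. w \<in> U \<Longrightarrow> F w = G w"
  shows "holo2_on G U"
  using assms has_partials_transform[of F _ _ _ U G] unfolding holo2_on_altdef by meson

lemma has_partials_const: "has_partials (\<lambda>z. c) 0 0 z"
  unfolding has_partials_def by (simp add: case_prod_unfold)

lemma has_partials_fst: "has_partials fst 1 0 z"
  unfolding has_partials_def
  by (rule has_derivative_eq_rhs[OF has_derivative_fst[OF has_derivative_ident]]) (auto simp: fun_eq_iff)

lemma has_partials_snd: "has_partials snd 0 1 z"
  unfolding has_partials_def
  by (rule has_derivative_eq_rhs[OF has_derivative_snd[OF has_derivative_ident]]) (auto simp: fun_eq_iff)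

lemma has_partials_add:
  assumes "has_partials F a b z" "has_partials G c d z"
  shows "has_partials (\<lambda>z. F z + G z) (a + c) (b + d) z"
  using assms unfolding has_partials_def
  by (elim has_derivative_eq_rhs[OF has_derivative_add]) (auto simp: fun_eq_iff algebra_simps)

lemma has_partials_mult:
  assumes "has_partials F a b z" "has_partials G c d z"
  shows "has_partials (\<lambda>z. F z * G z) (a * G z + F z * c) (b * G z + F z * d) z"
  using assms unfolding has_partials_def
  by (elim has_derivative_eq_rhs[OF has_derivative_mult]) (auto simp: fun_eq_iff algebra_simps)

lemma has_partials_compose_field:
  assumes "(g has_field_derivative g') (at (F z))" "has_partials F a b z"
  shows "has_partials (\<lambda>z. g (F z)) (g' * a) (g' * b) z"
  using has_derivative_compose[OF assms(2)[unfolded has_partials_def] assms(1)[unfolded has_field_derivative_def]]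
  unfolding has_partials_def
  by (rule has_derivative_eq_rhs) (auto simp: fun_eq_iff algebra_simps)

lemma has_partials_compose_map:
  assumes "has_partials G p q (\<phi> z)" "has_partials (\<lambda>z. fst (\<phi> z)) a b z"
    and "has_partials (\<lambda>z. snd (\<phi> z)) c d z"
  shows "has_partials (\<lambda>z. G (\<phi> z)) (p * a + q * c) (p * b + q * d) z"
proof -
  have "((\<lambda>z. (fst (\<phi> z), snd (\<phi> z))) has_derivative (\<lambda>h. ((\<lambda>(u,v). a * u + b * v) h, (\<lambda>(u,v). c * u + d * v) h))) (at z)"
    using assms(2,3) unfolding has_partials_def by (rule has_derivative_Pair)
  hence "(\<phi> has_derivative (\<lambda>h. ((\<lambda>(u,v). a * u + b * v) h, (\<lambda>(u,v). c * u + d * v) h))) (at z)"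
    by simp
  from has_derivative_compose[OF this assms(1)[unfolded has_partials_def]]
  show ?thesis unfolding has_partials_def
    by (rule has_derivative_eq_rhs) (auto simp: fun_eq_iff algebra_simps)
qed

lemma has_partials_compose_curve:
  assumes "has_partials F a b (x t, y t)"
    and "(x has_field_derivative x') (at t)" "(y has_field_derivative y') (at t)"
  shows "((\<lambda>t. F (x t, y t)) has_field_derivative a * x' + b * y') (at t)"
proof -
  have "((\<lambda>t. (x t, y t)) has_derivative (\<lambda>h. (x' * h, y' * h))) (at t)"
    using assms(2,3) unfolding has_field_derivative_def by (rule has_derivative_Pair)
  from has_derivative_compose[OF this assms(1)[unfolded has_partials_def]]
  show ?thesis unfolding has_field_derivative_def
    by (rule has_derivative_eq_rhs) (auto simp: fun_eq_iff algebra_simps)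
qed

lemma holo2_on_compose_curve:
  assumes "holo2_on F U" "x holomorphic_on D" "y holomorphic_on D" "open D" "\<And>t. t \<in> D \<Longrightarrow> (x t, y t) \<in> U"
  shows "(\<lambda>t. F (x t, y t)) holomorphic_on D"
proof -
  have "(\<lambda>t. F (x t, y t)) field_differentiable at t" if t: "t \<in> D" for t
  proof -
    obtain a b where "has_partials F a b (x t, y t)" using assms(1) assms(5)[OF t] unfolding holo2_on_altdef by blast
    from has_partials_compose_curve[of F a b x t y, OF this]
    show ?thesis using assms(2-4) t by (meson field_differentiable_def holomorphic_derivI)
  qed
  thus ?thesis using assms(4) by (simp add: holomorphic_on_open field_differentiable_def)
qed

lemma holo2_on_mult: "holo2_on F U \<Longrightarrow> holo2_on G U \<Longrightarrow> holo2_on (\<lambda>z. F z * G z) U"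
  unfolding holo2_on_altdef by (blast intro: has_partials_mult)

lemma holo2_on_add: "holo2_on F U \<Longrightarrow> holo2_on G U \<Longrightarrow> holo2_on (\<lambda>z. F z + G z) U"
  unfolding holo2_on_altdef by (blast intro: has_partials_add)

lemma holo2_on_const: "open U \<Longrightarrow> holo2_on (\<lambda>z. c) U"
  unfolding holo2_on_altdef by (blast intro: has_partials_const)

lemma holo2_on_minus: "holo2_on F U \<Longrightarrow> holo2_on (\<lambda>z. - F z) U"
  using holo2_on_mult[OF holo2_on_const[of U "-1"]] by (simp add: holo2_on_def)

lemma holo2_on_diff: "holo2_on F U \<Longrightarrow> holo2_on G U \<Longrightarrow> holo2_on (\<lambda>z. F z - G z) U"
  using holo2_on_add[OF _ holo2_on_minus[of G U], of F] by simp

lemma holo2_on_power: "holo2_on F U \<Longrightarrow> holo2_on (\<lambda>z. F z ^ n) U"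
proof (induction n)
  case 0 thus ?case by (simp add: holo2_on_const holo2_on_altdef[of F])
next
  case (Suc n) thus ?case using holo2_on_mult[of F U "\<lambda>z. F z ^ n"] by simp
qed

lemma holo2_on_fst: "open U \<Longrightarrow> holo2_on fst U"
  unfolding holo2_on_altdef by (blast intro: has_partials_fst)

lemma holo2_on_snd: "open U \<Longrightarrow> holo2_on snd U"
  unfolding holo2_on_altdef by (blast intro: has_partials_snd)

lemma holo2_on_compose_field:
  assumes "g holomorphic_on S" "open S" "holo2_on F U" "\<And>z. z \<in> U \<Longrightarrow> F z \<in> S"
  shows "holo2_on (\<lambda>z. g (F z)) U"
  using assms unfolding holo2_on_altdef by (blast intro: has_partials_compose_field holomorphic_derivI)

lemma holo2_on_compose_map:
  assumes "holo2_on G V" "holo_map_on \<phi> U" "\<And>z. z \<in> U \<Longrightarrow> \<phi> z \<in> V"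
  shows "holo2_on (\<lambda>z. G (\<phi> z)) U"
  using assms unfolding holo2_on_altdef holo_map_on_def by (blast intro: has_partials_compose_map)

lemma holo_map_on_compose:
  assumes "holo_map_on \<psi> V" "holo_map_on \<phi> U" "\<And>z. z \<in> U \<Longrightarrow> \<phi> z \<in> V"
  shows "holo_map_on (\<lambda>z. \<psi> (\<phi> z)) U"
  using assms holo2_on_compose_map[OF _ assms(2,3)] unfolding holo_map_on_def[of \<psi>] holo_map_on_def[of "\<lambda>z. \<psi> (\<phi> z)"]
  by blast

lemma holo_map_on_imp_continuous_on:
  assumes "holo_map_on \<phi> U" shows "continuous_on U \<phi>"
proof -
  have "continuous_on U (\<lambda>z. (fst (\<phi> z), snd (\<phi> z)))"
    using assms unfolding holo_map_on_def by (intro continuous_on_Pair holo2_on_imp_continuous_on) auto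
  thus ?thesis by simp
qed

section \<open>Biholomorphisms and solutions\<close>

text \<open>
  An explicit inverse is easier to handle than \<open>inv_into\<close>, with which it agrees on the
  image.
\<close>

lemma biholo_onI:
  assumes "holo_map_on \<phi> U" "holo_map_on \<psi> V" "\<phi> ` U = V" "\<And>z. z \<in> U \<Longrightarrow> \<psi> (\<phi> z) = z"
  shows "biholo_on \<phi> U"
proof -
  have inj: "inj_on \<phi> U" using assms(4) by (metis inj_onI)
  have eq: "inv_into U \<phi> w = \<psi> w" if "w \<in> V" for w
    using that assms(3,4) inj by (auto simp: inv_into_f_f)
  have "open V" using assms(2) by (auto simp: holo_map_on_def holo2_on_def)
  have "holo2_on (\<lambda>w. fst (inv_into U \<phi> w)) V" "holo2_on (\<lambda>w. snd (inv_into U \<phi> w)) V"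
    using assms(2) eq holo2_on_cong[of "\<lambda>w. fst (\<psi> w)" V "\<lambda>w. fst (inv_into U \<phi> w)"]
      holo2_on_cong[of "\<lambda>w. snd (\<psi> w)" V "\<lambda>w. snd (inv_into U \<phi> w)"]
    unfolding holo_map_on_def by metis+
  thus ?thesis unfolding biholo_on_def using assms inj by (auto simp: holo_map_on_def)
qed

lemma biholo_on_inverse:
  assumes "biholo_on \<phi> U" shows "biholo_on (inv_into U \<phi>) (\<phi> ` U)"
proof (rule biholo_onI[of _ _ \<phi> U])
  show "inv_into U \<phi> ` \<phi> ` U = U" using assms by (force simp: biholo_on_def)
qed (use assms in \<open>auto simp: biholo_on_def f_inv_into_f\<close>)

lemma biholo_on_open: "biholo_on \<phi> U \<Longrightarrow> open U" "biholo_on \<phi> U \<Longrightarrow> open (\<phi> ` U)"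
  by (auto simp: biholo_on_def holo_map_on_def holo2_on_def)

lemma biholo_on_open_image:
  assumes "biholo_on \<phi> U" "open W" "W \<subseteq> U"
  shows "open (\<phi> ` W)"
proof -
  have c: "continuous_on (\<phi> ` U) (inv_into U \<phi>)"
    using assms(1) by (auto simp: biholo_on_def intro: holo_map_on_imp_continuous_on)
  have "\<phi> ` W = inv_into U \<phi> -` W \<inter> \<phi> ` U"
    using assms(1,3) by (auto simp: biholo_on_def inv_into_f_f)
  thus ?thesis using continuous_on_open_vimage[OF biholo_on_open(2)[OF assms(1)]] c assms(2) by metis
qed

text \<open>
  By the chain rule the Jacobian matrix of the inverse map is a left inverse, so the product of the
  two determinants is \<open>1\<close>.
\<close>

lemma biholo_on_jacobian:
  assumes "biholo_on \<phi> U" "z \<in> U"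
    and "has_partials (\<lambda>z. fst (\<phi> z)) a b z" "has_partials (\<lambda>z. snd (\<phi> z)) c d z"
  shows "a * d - b * c \<noteq> 0"
proof -
  let ?\<psi> = "inv_into U \<phi>"
  have U: "open U" using biholo_on_open[OF assms(1)] by auto
  obtain a' b' c' d' where 1: "has_partials (\<lambda>w. fst (?\<psi> w)) a' b' (\<phi> z)"
     "has_partials (\<lambda>w. snd (?\<psi> w)) c' d' (\<phi> z)"
    using assms(1,2) unfolding biholo_on_def holo_map_on_def holo2_on_altdef by (meson imageI)
  have inv: "?\<psi> (\<phi> w) = w" if "w \<in> U" for w using assms(1) that by (auto simp: biholo_on_def inv_into_f_f)
  have "has_partials fst (a' * a + b' * c) (a' * b + b' * d) z"
    by (rule has_partials_transform[OF has_partials_compose_map[OF 1(1) assms(3,4)] U assms(2)]) (simp add: inv)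
  from has_partials_unique[OF this has_partials_fst]
  have e1: "a' * a + b' * c = 1" "a' * b + b' * d = 0" by auto
  have "has_partials snd (c' * a + d' * c) (c' * b + d' * d) z"
    by (rule has_partials_transform[OF has_partials_compose_map[OF 1(2) assms(3,4)] U assms(2)]) (simp add: inv)
  from has_partials_unique[OF this has_partials_snd]
  have e2: "c' * a + d' * c = 0" "c' * b + d' * d = 1" by auto
  have "(a' * d' - b' * c') * (a * d - b * c) = (a' * a + b' * c) * (c' * b + d' * d) - (a' * b + b' * d) * (c' * a + d' * c)"
    by (simp add: algebra_simps)
  also have "\<dots> = 1" using e1 e2 by simp
  finally show ?thesis by auto
qed

text \<open>
  Composing a parametrization with \<open>\<phi>\<close> parametrizes the image curve; it stays
  immersed because the Jacobian matrix of \<open>\<phi>\<close> is regular.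
\<close>

lemma solutions_push:
  assumes bi: "biholo_on \<phi> U" and S: "S \<subseteq> U"
    and form: "\<And>z a b c d u v. z \<in> S \<Longrightarrow> has_partials (\<lambda>z. fst (\<phi> z)) a b z \<Longrightarrow>
       has_partials (\<lambda>z. snd (\<phi> z)) c d z \<Longrightarrow> cubic_form K z u v = 0 \<Longrightarrow>
       cubic_form K' (\<phi> z) (a * u + b * v) (c * u + d * v) = 0"
    and C: "C \<in> solutions K S"
  shows "\<phi> ` C \<in> solutions K' (\<phi> ` S)"
proof -
  obtain x y D where C: "C = (\<lambda>t. (x t, y t)) ` D" and D: "open D" "connected D" "D \<noteq> {}"
    and xy: "x holomorphic_on D" "y holomorphic_on D"
    and *: "\<And>t. t \<in> D \<Longrightarrow> (x t, y t) \<in> S \<and> (deriv x t, deriv y t) \<noteq> (0, 0) \<and>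
            cubic_form K (x t, y t) (deriv x t) (deriv y t) = 0"
    using C unfolding solutions_def by blast
  define X where "X t = fst (\<phi> (x t, y t))" for t
  define Y where "Y t = snd (\<phi> (x t, y t))" for t
  have hol: "holo2_on (\<lambda>z. fst (\<phi> z)) U" "holo2_on (\<lambda>z. snd (\<phi> z)) U"
    using bi by (auto simp: biholo_on_def holo_map_on_def)
  have XY: "X holomorphic_on D" "Y holomorphic_on D"
    unfolding X_def Y_def using holo2_on_compose_curve[OF _ xy D(1)] hol * S by blast+
  have "(X t, Y t) \<in> \<phi> ` S \<and> (deriv X t, deriv Y t) \<noteq> (0, 0) \<and>
            cubic_form K' (X t, Y t) (deriv X t) (deriv Y t) = 0" if t: "t \<in> D" for t
  proof -
    have z: "(x t, y t) \<in> S" "(x t, y t) \<in> U" using *[OF t] S by auto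
    obtain a b c d where p: "has_partials (\<lambda>z. fst (\<phi> z)) a b (x t, y t)"
      "has_partials (\<lambda>z. snd (\<phi> z)) c d (x t, y t)"
      using hol z unfolding holo2_on_altdef by meson
    have dx: "(x has_field_derivative deriv x t) (at t)" "(y has_field_derivative deriv y t) (at t)"
      using xy D(1) t holomorphic_derivI by blast+
    have dX: "deriv X t = a * deriv x t + b * deriv y t"
      unfolding X_def by (rule DERIV_imp_deriv, rule has_partials_compose_curve[OF p(1) dx])
    have dY: "deriv Y t = c * deriv x t + d * deriv y t"
      unfolding Y_def by (rule DERIV_imp_deriv, rule has_partials_compose_curve[OF p(2) dx])
    have jac: "a * d - b * c \<noteq> 0" by (rule biholo_on_jacobian[OF bi z(2) p])
    have "(deriv X t, deriv Y t) \<noteq> (0, 0)"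
    proof
      assume "(deriv X t, deriv Y t) = (0, 0)"
      hence "a * deriv x t + b * deriv y t = 0" "c * deriv x t + d * deriv y t = 0" using dX dY by auto
      hence "(a * d - b * c) * deriv x t = 0" "(a * d - b * c) * deriv y t = 0" by algebra+
      thus False using jac *[OF t] by auto
    qed
    moreover have "(X t, Y t) = \<phi> (x t, y t)" by (simp add: X_def Y_def)
    ultimately show ?thesis using form[OF z(1) p] *[OF t] z dX dY by auto
  qed
  moreover have "\<phi> ` C = (\<lambda>t. (X t, Y t)) ` D" by (simp add: C image_image X_def Y_def)
  ultimately show ?thesis unfolding solutions_def using D XY by blast
qed

text \<open>
  The correspondence of the two forms along \<open>\<phi>\<close> is also one along the inverse map,
  since the Jacobian matrices are inverse to each other. So \<open>solutions_push\<close> applies in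
  both directions.
\<close>

lemma solutions_image:
  assumes bi: "biholo_on \<phi> U" and S: "S \<subseteq> U"
    and form: "\<And>z a b c d u v. z \<in> S \<Longrightarrow> has_partials (\<lambda>z. fst (\<phi> z)) a b z \<Longrightarrow>
       has_partials (\<lambda>z. snd (\<phi> z)) c d z \<Longrightarrow> cubic_form K z u v = 0 \<longleftrightarrow>
       cubic_form K' (\<phi> z) (a * u + b * v) (c * u + d * v) = 0"
  shows "(\<lambda>C. \<phi> ` C) ` solutions K S = solutions K' (\<phi> ` S)"
proof (intro equalityI subsetI)
  fix C' assume "C' \<in> (\<lambda>C. \<phi> ` C) ` solutions K S"
  thus "C' \<in> solutions K' (\<phi> ` S)" using solutions_push[OF bi S] form by blast
next
  fix C' assume C': "C' \<in> solutions K' (\<phi> ` S)"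
  let ?\<psi> = "inv_into U \<phi>"
  have inv: "?\<psi> (\<phi> w) = w" if "w \<in> U" for w using bi that by (auto simp: biholo_on_def inv_into_f_f)
  have im: "?\<psi> ` \<phi> ` S = S" using S inv by force
  have "?\<psi> ` C' \<in> solutions K (?\<psi> ` \<phi> ` S)"
  proof (rule solutions_push[OF biholo_on_inverse[OF bi] image_mono[OF S] _ C'])
    fix w a' b' c' d' u v
    assume w: "w \<in> \<phi> ` S" and p': "has_partials (\<lambda>w. fst (?\<psi> w)) a' b' w" "has_partials (\<lambda>w. snd (?\<psi> w)) c' d' w"
      and K': "cubic_form K' w u v = 0"
    obtain z where z: "z \<in> S" "w = \<phi> z" using w by blast
    obtain a b c d where p: "has_partials (\<lambda>z. fst (\<phi> z)) a b z" "has_partials (\<lambda>z. snd (\<phi> z)) c d z"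
      using bi subsetD[OF S z(1)] unfolding biholo_on_def holo_map_on_def holo2_on_altdef by meson
    have o: "open (\<phi> ` U)" "w \<in> \<phi> ` U" using biholo_on_open(2)[OF bi] w S by auto
    have f: "\<phi> (?\<psi> w') = w'" if "w' \<in> \<phi> ` U" for w' using that by (simp add: f_inv_into_f)
    have zw: "?\<psi> w = z" using inv[of z] z S by blast
    have "has_partials fst (a * a' + b * c') (a * b' + b * d') w"
      by (rule has_partials_transform[OF has_partials_compose_map[OF _ p'] o, of "\<lambda>z. fst (\<phi> z)"]) (simp_all add: p zw f)
    from has_partials_unique[OF this has_partials_fst]
    have e1: "a * a' + b * c' = 1" "a * b' + b * d' = 0" by auto
    have "has_partials snd (c * a' + d * c') (c * b' + d * d') w"
      by (rule has_partials_transform[OF has_partials_compose_map[OF _ p'] o, of "\<lambda>z. snd (\<phi> z)"]) (simp_all add: p zw f)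
    from has_partials_unique[OF this has_partials_snd]
    have e2: "c * a' + d * c' = 0" "c * b' + d * d' = 1" by auto
    have "a * (a' * u + b' * v) + b * (c' * u + d' * v) = (a * a' + b * c') * u + (a * b' + b * d') * v"
         "c * (a' * u + b' * v) + d * (c' * u + d' * v) = (c * a' + d * c') * u + (c * b' + d * d') * v"
      by (simp_all add: algebra_simps)
    hence "a * (a' * u + b' * v) + b * (c' * u + d' * v) = u" "c * (a' * u + b' * v) + d * (c' * u + d' * v) = v"
      using e1 e2 by auto
    thus "cubic_form K (?\<psi> w) (a' * u + b' * v) (c' * u + d' * v) = 0"
      using form[OF z(1) p, of "a' * u + b' * v" "c' * u + d' * v"] K' z zw by auto
  qed
  moreover have "C' \<subseteq> \<phi> ` S" using C' unfolding solutions_def by auto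
  hence "\<phi> ` ?\<psi> ` C' = C'" using S by (force simp: f_inv_into_f image_image)
  ultimately show "C' \<in> (\<lambda>C. \<phi> ` C) ` solutions K S" unfolding im by (metis imageI)
qed

lemma biholo_on_compose:
  assumes "biholo_on \<phi> U" "biholo_on \<psi> (\<phi> ` U)"
  shows "biholo_on (\<lambda>z. \<psi> (\<phi> z)) U"
proof (rule biholo_onI[of _ _ "\<lambda>w. inv_into U \<phi> (inv_into (\<phi> ` U) \<psi> w)" "\<psi> ` \<phi> ` U"])
  show "holo_map_on (\<lambda>z. \<psi> (\<phi> z)) U"
    using assms unfolding biholo_on_def by (blast intro: holo_map_on_compose)
  show "holo_map_on (\<lambda>w. inv_into U \<phi> (inv_into (\<phi> ` U) \<psi> w)) (\<psi> ` \<phi> ` U)"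
    by (rule holo_map_on_compose[of "inv_into U \<phi>" "\<phi> ` U"])
       (use assms in \<open>simp_all add: biholo_on_def inv_into_into\<close>)
  show "(\<lambda>z. \<psi> (\<phi> z)) ` U = \<psi> ` \<phi> ` U" by (simp add: image_image)
  show "inv_into U \<phi> (inv_into (\<phi> ` U) \<psi> (\<psi> (\<phi> z))) = z" if "z \<in> U" for z
    using assms that by (simp add: biholo_on_def inv_into_f_f)
qed

section \<open>Exchange of the coordinates\<close>

definition swap_cubic :: "cubic \<Rightarrow> cubic" where
  "swap_cubic K = Cubic (\<lambda>z. cf0 K (prod.swap z)) (\<lambda>z. cf1 K (prod.swap z))
                        (\<lambda>z. cf2 K (prod.swap z)) (\<lambda>z. cf3 K (prod.swap z))"

lemma swap_cubic_swap_cubic [simp]: "swap_cubic (swap_cubic K) = K"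
  by (cases K) (simp add: swap_cubic_def)

lemma cubic_form_swap: "cubic_form (swap_cubic K) (prod.swap z) v u = cubic_form K z u v"
  by (simp add: swap_cubic_def cubic_form_def algebra_simps)

lemma discr_swap: "discr (swap_cubic K) z = discr K (prod.swap z)"
  by (simp add: swap_cubic_def discr_def Let_def algebra_simps)

lemma discr_curve_swap: "discr_curve (swap_cubic K) = prod.swap ` discr_curve K"
  by (force simp: discr_curve_def discr_swap)

lemma biholo_on_swap:
  assumes "open U" shows "biholo_on prod.swap U"
proof (rule biholo_onI[of _ _ prod.swap "prod.swap ` U"])
  have "open (prod.swap -` U)"
    by (rule open_vimage[OF assms]) (auto simp: prod.swap_def intro!: continuous_intros)
  moreover have eq: "prod.swap -` U = prod.swap ` U" by force
  ultimately have o: "open (prod.swap ` U)" by simp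
  show "holo_map_on prod.swap U" "holo_map_on prod.swap (prod.swap ` U)"
    using assms o by (auto simp: holo_map_on_def intro: holo2_on_fst holo2_on_snd)
qed auto

lemma open_swap: "open (U :: point set) \<Longrightarrow> open (prod.swap ` U)"
  by (rule biholo_on_open(2)[OF biholo_on_swap])

lemma solutions_swap: "(\<lambda>C. prod.swap ` C) ` solutions K S = solutions (swap_cubic K) (prod.swap ` S)"
proof (rule solutions_image[OF biholo_on_swap[OF open_UNIV]])
  fix z a b c d u v
  assume p: "has_partials (\<lambda>z. fst (prod.swap z)) a b z" "has_partials (\<lambda>z. snd (prod.swap z)) c d z"
  have "a = 0" "b = 1" "c = 1" "d = 0"
    using has_partials_unique[OF p(1)[simplified] has_partials_snd]
      has_partials_unique[OF p(2)[simplified] has_partials_fst] by auto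
  thus "(cubic_form K z u v = 0) = (cubic_form (swap_cubic K) (prod.swap z) (a * u + b * v) (c * u + d * v) = 0)"
    by (simp add: cubic_form_swap)
qed auto

lemma swap_image_Diff: "prod.swap ` (A - B) = prod.swap ` A - prod.swap ` B"
  by (rule image_set_diff) simp

text \<open>
  Composition of equivalences with the exchange of coordinates, on either side, is all that is
  needed to move the vanishing weight to \<open>x\<close> and to reach the fourth normal form.
\<close>

lemma maps_web_swap_pre:
  assumes "maps_web \<phi> (swap_cubic K) K'"
  shows "maps_web (\<lambda>z. \<phi> (prod.swap z)) K K'"
proof -
  obtain U where U: "(0,0) \<in> U" "biholo_on \<phi> U" "\<phi> (0,0) = (0,0)"
    "(\<lambda>C. \<phi> ` C) ` solutions (swap_cubic K) (U - discr_curve (swap_cubic K)) = solutions K' (\<phi> ` U - discr_curve K')"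
    using assms unfolding maps_web_def by blast
  let ?U = "prod.swap ` U"
  have im: "prod.swap ` ?U = U" by (simp add: image_image)
  have 1: "biholo_on (\<lambda>z. \<phi> (prod.swap z)) ?U"
    by (rule biholo_on_compose[OF biholo_on_swap]) (use U(2) open_swap biholo_on_open im in auto)
  have 2: "solutions (swap_cubic K) (U - discr_curve (swap_cubic K))
      = (\<lambda>C. prod.swap ` C) ` solutions K (?U - discr_curve K)"
    unfolding solutions_swap discr_curve_swap swap_image_Diff im ..
  have "(\<lambda>C. (\<lambda>z. \<phi> (prod.swap z)) ` C) ` solutions K (?U - discr_curve K) =
        solutions K' ((\<lambda>z. \<phi> (prod.swap z)) ` ?U - discr_curve K')"
    using U(4) unfolding 2 by (simp add: image_image)
  moreover have "(0, 0) \<in> ?U" using imageI[OF U(1), of prod.swap] by simp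
  ultimately show ?thesis unfolding maps_web_def using 1 U(3) by (intro conjI exI[of _ ?U]) auto
qed

lemma maps_web_swap_post:
  assumes "maps_web \<phi> K K'"
  shows "maps_web (\<lambda>z. prod.swap (\<phi> z)) K (swap_cubic K')"
proof -
  obtain U where U: "(0,0) \<in> U" "biholo_on \<phi> U" "\<phi> (0,0) = (0,0)"
    "(\<lambda>C. \<phi> ` C) ` solutions K (U - discr_curve K) = solutions K' (\<phi> ` U - discr_curve K')"
    using assms unfolding maps_web_def by blast
  have 1: "biholo_on (\<lambda>z. prod.swap (\<phi> z)) U"
    by (rule biholo_on_compose[OF U(2) biholo_on_swap[OF biholo_on_open(2)[OF U(2)]]])
  have "(\<lambda>C. (\<lambda>z. prod.swap (\<phi> z)) ` C) ` solutions K (U - discr_curve K)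
      = (\<lambda>C. prod.swap ` C) ` (\<lambda>C. \<phi> ` C) ` solutions K (U - discr_curve K)" by (simp add: image_image)
  also have "\<dots> = solutions (swap_cubic K') ((\<lambda>z. prod.swap (\<phi> z)) ` U - discr_curve (swap_cubic K'))"
    unfolding U(4) solutions_swap discr_curve_swap swap_image_Diff by (simp add: image_image)
  finally show ?thesis unfolding maps_web_def using 1 U by (intro conjI exI[of _ U]) auto
qed

lemma weighted_homogeneous_swap:
  assumes "weighted_homogeneous K wx wy"
  shows "weighted_homogeneous (swap_cubic K) wy wx"
proof -
  have "maps_web (euler_flow wy wx t) (swap_cubic K) (swap_cubic K)" for t
  proof -
    have "maps_web (euler_flow wx wy t) (swap_cubic (swap_cubic K)) K"
      using assms by (simp add: weighted_homogeneous_def)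
    from maps_web_swap_post[OF maps_web_swap_pre[OF this]]
    have "maps_web (\<lambda>z. prod.swap (euler_flow wx wy t (prod.swap z))) (swap_cubic K) (swap_cubic K)" .
    moreover have "(\<lambda>z. prod.swap (euler_flow wx wy t (prod.swap z))) = euler_flow wy wx t"
      by (auto simp: euler_flow_def)
    ultimately show ?thesis by simp
  qed
  thus ?thesis using assms by (auto simp: weighted_homogeneous_def)
qed

lemma flat_web_swap:
  assumes "flat_web K"
  shows "flat_web (swap_cubic K)"
proof -
  obtain U where U: "open U" "(0,0) \<in> U" "\<forall>z\<in>U - discr_curve K. \<exists>V \<phi> d1 d2 d3.
        z \<in> V \<and> V \<subseteq> U - discr_curve K \<and> biholo_on \<phi> V \<and>
        independent2 d1 d2 \<and> independent2 d1 d3 \<and> independent2 d2 d3 \<and>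
        (\<lambda>C. \<phi> ` C) ` solutions K V =
          line_pieces d1 (\<phi> ` V) \<union> line_pieces d2 (\<phi> ` V) \<union> line_pieces d3 (\<phi> ` V)"
    using assms unfolding flat_web_def by blast
  show ?thesis unfolding flat_web_def
  proof (intro exI[of _ "prod.swap ` U"] conjI, goal_cases)
    case 1
    show ?case by (rule open_swap[OF U(1)])
  next
    case 2
    show ?case using imageI[OF U(2), of prod.swap] by simp
  next
    case 3
    show ?case
    proof
    fix z assume "z \<in> prod.swap ` U - discr_curve (swap_cubic K)"
    hence "prod.swap z \<in> U - discr_curve K" by (auto simp: discr_curve_def discr_swap)
    then obtain V \<phi> d1 d2 d3 where V: "prod.swap z \<in> V" "V \<subseteq> U - discr_curve K" "biholo_on \<phi> V"
        "independent2 d1 d2" "independent2 d1 d3" "independent2 d2 d3"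
        "(\<lambda>C. \<phi> ` C) ` solutions K V =
          line_pieces d1 (\<phi> ` V) \<union> line_pieces d2 (\<phi> ` V) \<union> line_pieces d3 (\<phi> ` V)"
      using U(3) by meson
    let ?V = "prod.swap ` V" and ?\<phi> = "\<lambda>z. \<phi> (prod.swap z)"
    have im: "prod.swap ` ?V = V" "?\<phi> ` ?V = \<phi> ` V" by (simp_all add: image_image)
    have "biholo_on ?\<phi> ?V"
      by (rule biholo_on_compose[OF biholo_on_swap]) (use V(3) open_swap biholo_on_open im in auto)
    moreover have "(\<lambda>C. ?\<phi> ` C) ` solutions (swap_cubic K) ?V = (\<lambda>C. \<phi> ` C) ` solutions K V"
      unfolding solutions_swap[symmetric] by (simp add: image_image)
    moreover have "z \<in> ?V" using V(1) by (metis imageI swap_swap)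
    moreover have "?V \<subseteq> prod.swap ` U - discr_curve (swap_cubic K)"
      using V(2) by (auto simp: discr_curve_def discr_swap)
    ultimately show "\<exists>V \<phi> d1 d2 d3. z \<in> V \<and> V \<subseteq> prod.swap ` U - discr_curve (swap_cubic K) \<and> biholo_on \<phi> V \<and>
        independent2 d1 d2 \<and> independent2 d1 d3 \<and> independent2 d2 d3 \<and>
        (\<lambda>C. \<phi> ` C) ` solutions (swap_cubic K) V =
          line_pieces d1 (\<phi> ` V) \<union> line_pieces d2 (\<phi> ` V) \<union> line_pieces d3 (\<phi> ` V)"
      using V(4-7) im by (intro exI[of _ ?V] exI[of _ ?\<phi>] exI[of _ d1] exI[of _ d2] exI[of _ d3]) auto
    qed
  qed
qed

lemma cubic_equation_swap:
  assumes "cubic_equation K"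
  shows "cubic_equation (swap_cubic K)"
proof -
  obtain U where U: "(0, 0) \<in> U" "holo2_on (cf3 K) U" "holo2_on (cf2 K) U"
          "holo2_on (cf1 K) U" "holo2_on (cf0 K) U"
    using assms by (auto simp: cubic_equation_def)
  let ?U = "prod.swap ` U"
  have sw: "holo_map_on prod.swap ?U" "\<And>z. z \<in> ?U \<Longrightarrow> prod.swap z \<in> U"
    using biholo_on_swap[OF open_swap, of U] U(2) by (auto simp: biholo_on_def holo2_on_def)
  have h: "holo2_on (\<lambda>z. G (prod.swap z)) ?U" if "holo2_on G U" for G
    by (rule holo2_on_compose_map[OF that sw])
  have "\<not> (\<forall>\<^sub>F z in nhds (0, 0). discr (swap_cubic K) z = 0)"
  proof
    assume "\<forall>\<^sub>F z in nhds (0, 0). discr (swap_cubic K) z = 0"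
    then obtain S where S: "open S" "(0,0) \<in> S" "\<forall>z\<in>S. discr (swap_cubic K) z = 0"
      by (auto simp: eventually_nhds)
    have "(0, 0) \<in> prod.swap ` S" using imageI[OF S(2), of prod.swap] by simp
    hence "\<forall>\<^sub>F z in nhds (0, 0). discr K z = 0" unfolding eventually_nhds
      using S(3) open_swap[OF S(1)] by (intro exI[of _ "prod.swap ` S"]) (auto simp: discr_swap)
    thus False using assms by (auto simp: cubic_equation_def)
  qed
  moreover have "(0, 0) \<in> ?U" using imageI[OF U(1), of prod.swap] by simp
  ultimately show ?thesis using assms h[OF U(2)] h[OF U(3)] h[OF U(4)] h[OF U(5)]
    unfolding cubic_equation_def by (intro conjI exI[of _ ?U]) (auto simp: swap_cubic_def)
qed

section \<open>First integrals of a flat web\<close>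

lemma solutions_mono: "C \<in> solutions K V \<Longrightarrow> C \<subseteq> W \<Longrightarrow> C \<in> solutions K W"
  unfolding solutions_def by blast

lemma solutions_subset: "C \<in> solutions K V \<Longrightarrow> C \<subseteq> V"
  unfolding solutions_def by blast

text \<open>
  The kernel of a nonzero derivative of \<open>F\<close> is spanned by \<open>(b, -a)\<close>, so a
  curve on which \<open>F\<close> is constant has this tangent direction, however it is
  parametrized.
\<close>

lemma solution_tangent:
  assumes C: "C \<in> solutions K S" "z \<in> C" and F: "has_partials F a b z" "\<And>w. w \<in> C \<Longrightarrow> F w = F z"
    and ab: "(a, b) \<noteq> (0, 0)"
  shows "cubic_form K z b (- a) = 0"
proof -
  obtain x y D where C': "C = (\<lambda>t. (x t, y t)) ` D" and D: "open D"
    and xy: "x holomorphic_on D" "y holomorphic_on D"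
    and *: "\<And>t. t \<in> D \<Longrightarrow> (deriv x t, deriv y t) \<noteq> (0, 0) \<and>
            cubic_form K (x t, y t) (deriv x t) (deriv y t) = 0"
    using C(1) unfolding solutions_def by blast
  obtain t where t: "t \<in> D" "z = (x t, y t)" using C(2) C' by auto
  have "((\<lambda>t. F (x t, y t)) has_field_derivative a * deriv x t + b * deriv y t) (at t)"
    by (rule has_partials_compose_curve) (use F(1) t xy D holomorphic_derivI in blast)+
  moreover have "((\<lambda>t. F (x t, y t)) has_field_derivative 0) (at t)"
    by (rule has_field_derivative_transform_within_open[OF DERIV_const D t(1), of "F z"]) (use F(2) C' in \<open>metis imageI\<close>)
  ultimately have 0: "a * deriv x t + b * deriv y t = 0" by (rule DERIV_unique)
  obtain k where k: "deriv x t = k * b" "deriv y t = - k * a"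
  proof (cases "b = 0")
    case True
    hence "a \<noteq> 0" "deriv x t = 0" using ab 0 by auto
    thus ?thesis using that[of "- deriv y t / a"] True by (simp add: field_simps)
  next
    case False
    have "deriv y t = - a * deriv x t / b" using 0 False by (simp add: field_simps) algebra
    thus ?thesis using that[of "deriv x t / b"] False by (simp add: field_simps)
  qed
  have "k \<noteq> 0" using k *[OF t(1)] by auto
  moreover have "cubic_form K z (k * b) (- k * a) = k^3 * cubic_form K z b (- a)"
    unfolding cubic_form_def by algebra
  ultimately show ?thesis using *[OF t(1)] k t(2) by auto
qed

text \<open>
  Leaves have to exist inside every neighbourhood of a point, because a map that preserves the web
  is known to do so on an unspecified domain only.
\<close>

definition first_integral_on :: "cubic \<Rightarrow> point set \<Rightarrow> (point \<Rightarrow> complex) \<Rightarrow> bool" where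
  "first_integral_on K V F \<longleftrightarrow> holo2_on F V \<and>
     (\<forall>z\<in>V. \<forall>W. open W \<and> z \<in> W \<and> W \<subseteq> V \<longrightarrow> (\<exists>C\<in>solutions K W. z \<in> C \<and> (\<forall>w\<in>C. F w = F z)))"

definition transverse_on :: "point set \<Rightarrow> (point \<Rightarrow> complex) \<Rightarrow> (point \<Rightarrow> complex) \<Rightarrow> bool" where
  "transverse_on V F G \<longleftrightarrow> (\<forall>z\<in>V. \<forall>a b c d. has_partials F a b z \<longrightarrow> has_partials G c d z \<longrightarrow> a * d - b * c \<noteq> 0)"

text \<open>
  In flat coordinates the three foliations are given by linear functions, and suitable multiples of
  three linear functions of two variables add up to zero. In the original coordinates such a
  dependence of first integrals is what web geometry calls an abelian relation.
\<close>

definition abelian_relation_on :: "cubic \<Rightarrow> point set \<Rightarrow> (point \<Rightarrow> complex) \<Rightarrow> (point \<Rightarrow> complex) \<Rightarrow> (point \<Rightarrow> complex) \<Rightarrow> bool" where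
  "abelian_relation_on K V F1 F2 F3 \<longleftrightarrow>
     first_integral_on K V F1 \<and> first_integral_on K V F2 \<and> first_integral_on K V F3 \<and>
     transverse_on V F1 F2 \<and> transverse_on V F1 F3 \<and> transverse_on V F2 F3 \<and>
     (\<forall>z\<in>V. F1 z + F2 z + F3 z = 0)"

definition locally_abelian_on :: "cubic \<Rightarrow> point set \<Rightarrow> bool" where
  "locally_abelian_on K P \<longleftrightarrow> (\<forall>z\<in>P - discr_curve K. \<exists>V F1 F2 F3.
     open V \<and> z \<in> V \<and> V \<subseteq> P - discr_curve K \<and> abelian_relation_on K V F1 F2 F3)"

lemma locally_abelian_onE:
  assumes "locally_abelian_on K P" "z \<in> P - discr_curve K"
  obtains V F1 F2 F3 where "open V" "z \<in> V" "V \<subseteq> P - discr_curve K" "abelian_relation_on K V F1 F2 F3"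
  using bspec[OF assms(1)[unfolded locally_abelian_on_def] assms(2)] by (elim exE conjE)

text \<open>
  The linear function annihilating the direction \<open>d\<close> is constant on lines of direction
  \<open>d\<close>. Flatness makes every small disc in such a line the image of a leaf.
\<close>

lemma linear_first_integral:
  assumes bi: "biholo_on \<phi> V" and lines: "line_pieces d (\<phi> ` V) \<subseteq> (\<lambda>C. \<phi> ` C) ` solutions K V"
  shows "first_integral_on K V (\<lambda>z. k * (fst d * snd (\<phi> z) + - snd d * fst (\<phi> z)))"
  unfolding first_integral_on_def
proof (intro conjI ballI allI impI)
  have V: "open V" by (rule biholo_on_open[OF bi])
  show "holo2_on (\<lambda>z. k * (fst d * snd (\<phi> z) + - snd d * fst (\<phi> z))) V"
    using bi V unfolding biholo_on_def holo_map_on_def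
    by (intro holo2_on_mult holo2_on_add holo2_on_const) auto
  fix z W assume z: "z \<in> V" and W: "open W \<and> z \<in> W \<and> W \<subseteq> V"
  let ?c = "\<lambda>t. (fst (\<phi> z) + t * fst d, snd (\<phi> z) + t * snd d)"
  have "open (\<phi> ` W)" using biholo_on_open_image[OF bi] W by blast
  hence "open (?c -` (\<phi> ` W))" by (rule open_vimage) (auto intro!: continuous_intros)
  moreover have "0 \<in> ?c -` (\<phi> ` W)" using W by auto
  ultimately obtain r where r: "r > 0" "ball 0 r \<subseteq> ?c -` (\<phi> ` W)" using openE by blast
  have "?c ` ball 0 r \<in> line_pieces d (\<phi> ` V)"
    unfolding line_pieces_def using r W by (intro CollectI exI[of _ "\<phi> z"] exI[of _ "ball 0 r"]) auto
  from subsetD[OF lines this] obtain C where C: "C \<in> solutions K V" "?c ` ball 0 r = \<phi> ` C"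
    by (rule imageE)
  have inj: "inj_on \<phi> V" using bi by (auto simp: biholo_on_def)
  have CV: "C \<subseteq> V" by (rule solutions_subset[OF C(1)])
  have "\<phi> ` C \<subseteq> \<phi> ` W" unfolding C(2)[symmetric] image_subset_iff_subset_vimage by (rule r(2))
  hence CW: "C \<subseteq> W" using inj CV W by (meson inj_on_image_subset_iff)
  have "\<phi> z \<in> \<phi> ` C" unfolding C(2)[symmetric] using r(1) by (intro image_eqI[of _ _ 0]) auto
  hence "z \<in> C" using inj CV z by (meson inj_on_image_mem_iff)
  moreover have "k * (fst d * snd (\<phi> w) + - snd d * fst (\<phi> w)) = k * (fst d * snd (\<phi> z) + - snd d * fst (\<phi> z))"
    if "w \<in> C" for w
  proof -
    have "\<phi> w \<in> ?c ` ball 0 r" unfolding C(2) using that by (rule imageI)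
    then obtain t where "\<phi> w = ?c t" by (rule imageE)
    thus ?thesis by (simp add: algebra_simps)
  qed
  ultimately show "\<exists>C\<in>solutions K W. z \<in> C \<and> (\<forall>w\<in>C. k * (fst d * snd (\<phi> w) + - snd d * fst (\<phi> w)) = k * (fst d * snd (\<phi> z) + - snd d * fst (\<phi> z)))"
    using solutions_mono[OF C(1) CW] by blast
qed

lemma linear_transverse:
  assumes bi: "biholo_on \<phi> V" and "independent2 d e" "k \<noteq> 0" "l \<noteq> 0"
  shows "transverse_on V (\<lambda>z. k * (fst d * snd (\<phi> z) + - snd d * fst (\<phi> z)))
                         (\<lambda>z. l * (fst e * snd (\<phi> z) + - snd e * fst (\<phi> z)))"
  unfolding transverse_on_def
proof (intro ballI allI impI)
  fix z a b c d'
  assume z: "z \<in> V" and p: "has_partials (\<lambda>z. k * (fst d * snd (\<phi> z) + - snd d * fst (\<phi> z))) a b z"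
     "has_partials (\<lambda>z. l * (fst e * snd (\<phi> z) + - snd e * fst (\<phi> z))) c d' z"
  obtain A B C D where q: "has_partials (\<lambda>z. fst (\<phi> z)) A B z" "has_partials (\<lambda>z. snd (\<phi> z)) C D z"
    using bi z unfolding biholo_on_def holo_map_on_def holo2_on_altdef by blast
  have 1: "has_partials (\<lambda>z. k * (fst d * snd (\<phi> z) + - snd d * fst (\<phi> z)))
      (k * (fst d * C - snd d * A)) (k * (fst d * D - snd d * B)) z" for k d
    using has_partials_mult[OF has_partials_const[of k] has_partials_add[OF
         has_partials_mult[OF has_partials_const[of "fst d"] q(2)] has_partials_mult[OF has_partials_const[of "- snd d"] q(1)]]]
    by simp
  have "a * d' - b * c = k * l * (fst d * snd e - snd d * fst e) * (A * D - B * C)"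
    unfolding has_partials_unique[OF p(1) 1] has_partials_unique[OF p(2) 1] by algebra
  thus "a * d' - b * c \<noteq> 0"
    using biholo_on_jacobian[OF bi z q] assms(2-4) by (auto simp: independent2_def)
qed

lemma flat_web_abelian_relation:
  assumes "flat_web K"
  obtains U where "open U" "(0,0) \<in> U" "locally_abelian_on K U"
proof -
  obtain U where U: "open U" "(0,0) \<in> U" "\<forall>z\<in>U - discr_curve K. \<exists>V \<phi> d1 d2 d3.
        z \<in> V \<and> V \<subseteq> U - discr_curve K \<and> biholo_on \<phi> V \<and>
        independent2 d1 d2 \<and> independent2 d1 d3 \<and> independent2 d2 d3 \<and>
        (\<lambda>C. \<phi> ` C) ` solutions K V =
          line_pieces d1 (\<phi> ` V) \<union> line_pieces d2 (\<phi> ` V) \<union> line_pieces d3 (\<phi> ` V)"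
    using assms unfolding flat_web_def by blast
  show ?thesis
  proof (rule that[OF U(1,2)], unfold locally_abelian_on_def, rule ballI)
    fix z assume "z \<in> U - discr_curve K"
    then obtain V \<phi> d1 d2 d3 where V: "z \<in> V" "V \<subseteq> U - discr_curve K" "biholo_on \<phi> V"
        "independent2 d1 d2" "independent2 d1 d3" "independent2 d2 d3"
        "(\<lambda>C. \<phi> ` C) ` solutions K V =
          line_pieces d1 (\<phi> ` V) \<union> line_pieces d2 (\<phi> ` V) \<union> line_pieces d3 (\<phi> ` V)"
      using U(3) by meson
    let ?F = "\<lambda>k d z. k * (fst d * snd (\<phi> z) + - snd d * fst (\<phi> z))"
    \<comment> \<open>Writing \<open>[d, e]\<close> for the determinant, \<open>[d2, d3] d1 + [d3, d1] d2 + [d1, d2] d3 = 0\<close>.\<close>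
    let ?k1 = "fst d2 * snd d3 - snd d2 * fst d3"
    let ?k2 = "fst d3 * snd d1 - snd d3 * fst d1"
    let ?k3 = "fst d1 * snd d2 - snd d1 * fst d2"
    have k: "?k1 \<noteq> 0" "?k2 \<noteq> 0" "?k3 \<noteq> 0" using V(4-6) by (auto simp: independent2_def algebra_simps)
    have "?F ?k1 d1 w + ?F ?k2 d2 w + ?F ?k3 d3 w = 0" for w by algebra
    hence "abelian_relation_on K V (?F ?k1 d1) (?F ?k2 d2) (?F ?k3 d3)"
      unfolding abelian_relation_on_def
      using V(7) k V(4-6) by (intro conjI linear_first_integral linear_transverse V(3)) auto
    thus "\<exists>V F1 F2 F3. open V \<and> z \<in> V \<and> V \<subseteq> U - discr_curve K \<and> abelian_relation_on K V F1 F2 F3"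
      using V(1,2) biholo_on_open(1)[OF V(3)] by (intro exI[of _ V] exI conjI)
  qed
qed

section \<open>Homogeneity in one coordinate\<close>

text \<open>
  On the complex line through \<open>z\<close> and a point of \<open>S\<close> this is the identity
  theorem in one variable; by convexity the line meets \<open>P\<close> in a connected set.
\<close>

lemma holo2_on_identity:
  assumes P: "convex P" "holo2_on H P" and S: "open S" "S \<subseteq> P" "S \<noteq> {}"
    and H: "\<And>z. z \<in> S \<Longrightarrow> H z = 0" and z: "z \<in> P"
  shows "H z = 0"
proof -
  obtain w where w: "w \<in> S" using S by auto
  define x y where "x t = fst w + t * (fst z - fst w)" and "y t = snd w + t * (snd z - snd w)" for t
  have cont: "isCont (\<lambda>t. (x t, y t)) t" for t
    unfolding x_def y_def by (intro continuous_intros)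
  have vim: "open ((\<lambda>t. (x t, y t)) -` A)" if "open A" for A
    by (rule open_vimage[OF that]) (use cont in \<open>simp add: continuous_at_imp_continuous_on\<close>)
  have hol: "x holomorphic_on A" "y holomorphic_on A" for A
    unfolding x_def y_def by (intro holomorphic_intros)+
  define D where "D = (\<lambda>t. (x t, y t)) -` P"
  have "open P" using P(2) by (auto simp: holo2_on_def)
  hence D: "open D" unfolding D_def by (rule vim)
  have "convex D" unfolding convex_def D_def
  proof (intro ballI allI impI, unfold vimage_eq)
    fix s t and u v :: real assume *: "(x s, y s) \<in> P" "(x t, y t) \<in> P" "0 \<le> u" "0 \<le> v" "u + v = 1"
    have v: "complex_of_real v = 1 - complex_of_real u" using *(5) by (simp add: eq_diff_eq flip: of_real_add)
    have "(x (u *\<^sub>R s + v *\<^sub>R t), y (u *\<^sub>R s + v *\<^sub>R t)) = u *\<^sub>R (x s, y s) + v *\<^sub>R (x t, y t)"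
      unfolding x_def y_def by (simp add: scaleR_conv_of_real v algebra_simps)
    thus "(x (u *\<^sub>R s + v *\<^sub>R t), y (u *\<^sub>R s + v *\<^sub>R t)) \<in> P" using convexD[OF P(1) *] by simp
  qed
  hence "connected D" by (rule convex_connected)
  have o: "open ((\<lambda>t. (x t, y t)) -` S)" by (rule vim[OF S(1)])
  have "H (x 1, y 1) = 0"
  proof (rule analytic_continuation_open[of "(\<lambda>t. (x t, y t)) -` S" D "\<lambda>t. H (x t, y t)" "\<lambda>_. 0" 1])
    show "(\<lambda>t. (x t, y t)) -` S \<noteq> {}"
    proof -
      have "0 \<in> (\<lambda>t. (x t, y t)) -` S" using w by (simp add: x_def y_def)
      thus ?thesis by blast
    qed
    show "(\<lambda>t. H (x t, y t)) holomorphic_on D"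
      by (rule holo2_on_compose_curve[OF P(2) hol D]) (simp add: D_def)
    show "1 \<in> D" using z by (simp add: D_def x_def y_def)
  qed (use D o S(2) H \<open>connected D\<close> in \<open>auto simp: D_def\<close>)
  thus ?thesis by (simp add: x_def y_def)
qed

text \<open>
  A binary cubic form with three given roots has its coefficient vector orthogonal to three vectors
  \<open>(w^3, w^2 u, w u^2, u^3)\<close>, hence proportional to their generalized cross product.
  The latter is a Vandermonde determinant times the coefficient vector \<open>E\<close> of the
  product of the three linear factors. Each identity below states this for one
  \<open>2\<times>2\<close> minor, as a combination of the three equations.
\<close>

lemma cubic_roots_minors:
  fixes u1 u2 u3 w1 w2 w3 A0 A1 A2 A3 :: complex
  assumes f: "A3 * w1^3 + A2 * w1^2 * u1 + A1 * w1 * u1^2 + A0 * u1^3 = 0"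
             "A3 * w2^3 + A2 * w2^2 * u2 + A1 * w2 * u2^2 + A0 * u2^3 = 0"
             "A3 * w3^3 + A2 * w3^2 * u3 + A1 * w3 * u3^2 + A0 * u3^3 = 0"
    and ind: "u1 * w2 - w1 * u2 \<noteq> 0" "u1 * w3 - w1 * u3 \<noteq> 0" "u2 * w3 - w2 * u3 \<noteq> 0"
    and E: "E3 = u1 * u2 * u3" "E2 = - (w1 * u2 * u3 + u1 * w2 * u3 + u1 * u2 * w3)"
           "E1 = w1 * w2 * u3 + w1 * u2 * w3 + u1 * w2 * w3" "E0 = - w1 * w2 * w3"
  shows "A0 * E3 = A3 * E0" "A1 * E3 = A3 * E1" "A2 * E3 = A3 * E2" "A0 * E2 = A2 * E0" "A1 * E2 = A2 * E1"
proof -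
  let ?V = "(u1 * w2 - w1 * u2) * (u1 * w3 - w1 * u3) * (u2 * w3 - w2 * u3)"
  let ?f1 = "A3 * w1^3 + A2 * w1^2 * u1 + A1 * w1 * u1^2 + A0 * u1^3"
  let ?f2 = "A3 * w2^3 + A2 * w2^2 * u2 + A1 * w2 * u2^2 + A0 * u2^3"
  let ?f3 = "A3 * w3^3 + A2 * w3^2 * u3 + A1 * w3 * u3^2 + A0 * u3^3"
  have "?V * (A0 * E3 - A3 * E0) =
     (w2 * u2^2 * (w3^2 * u3) - w2^2 * u2 * (w3 * u3^2)) * ?f1
   - (w1 * u1^2 * (w3^2 * u3) - w1^2 * u1 * (w3 * u3^2)) * ?f2
   + (w1 * u1^2 * (w2^2 * u2) - w1^2 * u1 * (w2 * u2^2)) * ?f3"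
    unfolding E by algebra
  thus "A0 * E3 = A3 * E0" using f ind by simp
  have "?V * (A1 * E3 - A3 * E1) =
    - ((u2^3 * (w3^2 * u3) - w2^2 * u2 * u3^3) * ?f1
     - (u1^3 * (w3^2 * u3) - w1^2 * u1 * u3^3) * ?f2
     + (u1^3 * (w2^2 * u2) - w1^2 * u1 * u2^3) * ?f3)"
    unfolding E by algebra
  thus "A1 * E3 = A3 * E1" using f ind by simp
  have "?V * (A2 * E3 - A3 * E2) =
      (u2^3 * (w3 * u3^2) - w2 * u2^2 * u3^3) * ?f1
     - (u1^3 * (w3 * u3^2) - w1 * u1^2 * u3^3) * ?f2
     + (u1^3 * (w2 * u2^2) - w1 * u1^2 * u2^3) * ?f3"
    unfolding E by algebra
  thus "A2 * E3 = A3 * E2" using f ind by simp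
  have "?V * (A0 * E2 - A2 * E0) =
     - ((w2 * u2^2 * w3^3 - w2^3 * (w3 * u3^2)) * ?f1
     - (w1 * u1^2 * w3^3 - w1^3 * (w3 * u3^2)) * ?f2
     + (w1 * u1^2 * w2^3 - w1^3 * (w2 * u2^2)) * ?f3)"
    unfolding E by algebra
  thus "A0 * E2 = A2 * E0" using f ind by simp
  have "?V * (A1 * E2 - A2 * E1) =
     (u2^3 * w3^3 - w2^3 * u3^3) * ?f1
     - (u1^3 * w3^3 - w1^3 * u3^3) * ?f2
     + (u1^3 * w2^3 - w1^3 * u2^3) * ?f3"
    unfolding E by algebra
  thus "A1 * E2 = A2 * E1" using f ind by simp
qed

definition binary_cubic :: "(nat \<Rightarrow> complex) \<Rightarrow> complex \<Rightarrow> complex \<Rightarrow> complex" where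
  "binary_cubic A u w = A 3 * w^3 + A 2 * w^2 * u + A 1 * w * u^2 + A 0 * u^3"

lemma le3_cases: "(i::nat) \<le> 3 \<Longrightarrow> i = 0 \<or> i = 1 \<or> i = 2 \<or> i = 3" by auto

text \<open>
  Both forms are multiples of the same \<open>E\<close>. At most one of the pairwise independent
  roots has \<open>u = 0\<close>, therefore \<open>E 3\<close> and \<open>E 2\<close> are not both
  zero.
\<close>

lemma binary_cubics_proportional:
  assumes A: "binary_cubic A u1 w1 = 0" "binary_cubic A u2 w2 = 0" "binary_cubic A u3 w3 = 0"
    and B: "binary_cubic B u1 w1 = 0" "binary_cubic B u2 w2 = 0" "binary_cubic B u3 w3 = 0"
    and ind: "u1 * w2 - w1 * u2 \<noteq> 0" "u1 * w3 - w1 * u3 \<noteq> 0" "u2 * w3 - w2 * u3 \<noteq> 0"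
    and ij: "i \<le> 3" "j \<le> 3"
  shows "A i * B j = A j * B i"
proof -
  define E where "E = (!) [- w1 * w2 * w3, w1 * w2 * u3 + w1 * u2 * w3 + u1 * w2 * w3,
     - (w1 * u2 * u3 + u1 * w2 * u3 + u1 * u2 * w3), u1 * u2 * u3]"
  have E: "E 3 = u1 * u2 * u3" "E 2 = - (w1 * u2 * u3 + u1 * w2 * u3 + u1 * u2 * w3)"
           "E 1 = w1 * w2 * u3 + w1 * u2 * w3 + u1 * w2 * w3" "E 0 = - w1 * w2 * w3"
    by (simp_all add: E_def)
  have *: "C i * E k = C k * E i" if "binary_cubic C u1 w1 = 0" "binary_cubic C u2 w2 = 0" "binary_cubic C u3 w3 = 0"
    "i \<le> 3" "k = 2 \<or> k = 3" for C i k
    using cubic_roots_minors[OF that(1-3)[unfolded binary_cubic_def] ind E] le3_cases[OF that(4)] that(5) by auto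
  have "E 3 \<noteq> 0 \<or> E 2 \<noteq> 0" using ind unfolding E by auto
  then obtain k where k: "E k \<noteq> 0" "k = 2 \<or> k = 3" by auto
  have "(A i * B j) * (E k * E k) = (A i * E k) * (B j * E k)" by simp
  also have "\<dots> = (A k * E i) * (B k * E j)" using *[OF A ij(1) k(2)] *[OF B ij(2) k(2)] by simp
  also have "\<dots> = (A k * E j) * (B k * E i)" by simp
  also have "\<dots> = (A j * E k) * (B i * E k)" using *[OF A ij(2) k(2)] *[OF B ij(1) k(2)] by simp
  finally have "(A i * B j) * (E k * E k) = (A j * B i) * (E k * E k)" by (simp add: mult_ac)
  thus ?thesis using k(1) by simp
qed

text \<open>
  Indexing the coefficients by the power of \<open>dy\<close> makes the weight of a coefficient a
  function of its index.
\<close>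

definition coeff_at :: "cubic \<Rightarrow> point \<Rightarrow> nat \<Rightarrow> complex" where
  "coeff_at K z = (!) [cf0 K z, cf1 K z, cf2 K z, cf3 K z]"

lemma coeff_at_simps [simp]: "coeff_at K z 0 = cf0 K z" "coeff_at K z (Suc 0) = cf1 K z" "coeff_at K z 2 = cf2 K z" "coeff_at K z 3 = cf3 K z"
  by (simp_all add: coeff_at_def)

lemma cubic_form_eq_binary_cubic: "cubic_form K z u w = binary_cubic (coeff_at K z) u w"
  by (simp add: cubic_form_def binary_cubic_def)

text \<open>
  Halving the argument multiplies the \<open>n\<close>-th Taylor coefficient by
  \<open>2^(-n)\<close>, so only the one with \<open>i + n = j\<close> survives.
\<close>

lemma homogeneous_function_monomial:
  assumes g: "g holomorphic_on ball 0 r" and r: "r > 0"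
    and hom: "\<And>y. y \<in> ball 0 r \<Longrightarrow> (1/2)^i * g (y / 2) = (1/2)^j * g y"
  shows "\<exists>a. \<forall>y\<in>ball 0 r. g y = (if i \<le> j then a * y^(j - i) else 0)"
proof -
  have zero: "(deriv ^^ n) g 0 = 0" if "i + n \<noteq> j" for n
  proof -
    have "(deriv ^^ n) (\<lambda>y. (1/2)^j * g y) 0 = (1/2)^j * (deriv ^^ n) g 0"
      by (rule higher_deriv_cmult[OF g]) (use r in auto)
    moreover have "(deriv ^^ n) (\<lambda>y. (1/2)^i * g (1/2 * y)) 0 = (1/2)^i * ((1/2)^n * (deriv ^^ n) g (1/2 * 0))"
    proof (subst higher_deriv_cmult[of _ "ball 0 r"])
      have half: "1/2 * w \<in> ball 0 r" if "w \<in> ball 0 r" for w :: complex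
        using that norm_ge_zero[of w] by (simp add: norm_divide del: norm_ge_zero)
      show "(\<lambda>y. g (1 / 2 * y)) holomorphic_on ball 0 r"
        by (rule holomorphic_on_compose[OF _ holomorphic_on_subset[OF g], unfolded o_def])
           (use half in \<open>auto intro!: holomorphic_intros\<close>)
      show "(1/2)^i * (deriv ^^ n) (\<lambda>y. g (1/2 * y)) 0 = (1/2)^i * ((1/2)^n * (deriv ^^ n) g (1/2 * 0))"
        by (subst higher_deriv_compose_linear[OF g open_ball[of 0 r] open_ball _ half]) (use r in auto)
    qed (use r in auto)
    moreover have "(deriv ^^ n) (\<lambda>y. (1/2)^j * g y) 0 = (deriv ^^ n) (\<lambda>y. (1/2)^i * g (1/2 * y)) 0"
    proof (rule higher_deriv_cong_ev)
      have "\<forall>\<^sub>F y in nhds 0. y \<in> ball 0 r" using r by (intro eventually_nhds_in_open) auto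
      thus "\<forall>\<^sub>F y in nhds 0. (1/2)^j * g y = (1/2)^i * g (1/2 * y)"
        by eventually_elim (use hom in auto)
    qed simp
    ultimately have "(1/2)^j * (deriv ^^ n) g 0 = (1/2)^(i + n) * (deriv ^^ n) g 0" by (simp add: power_add)
    moreover have "(1/2::complex)^j \<noteq> (1/2)^(i + n)"
    proof
      assume "(1/2::complex)^j = (1/2)^(i + n)"
      hence "norm ((1/2::complex)^j) = norm ((1/2::complex)^(i + n))" by simp
      hence "(1/2::real)^j = (1/2)^(i + n)" by (simp add: norm_power norm_divide)
      thus False using that by (simp add: power_inject_exp')
    qed
    ultimately show ?thesis by simp
  qed
  have "g y = (if i \<le> j then (deriv ^^ (j - i)) g 0 / fact (j - i) * y^(j - i) else 0)" if y: "y \<in> ball 0 r" for y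
  proof -
    define c where "c = (if i \<le> j then (deriv ^^ (j - i)) g 0 / fact (j - i) * y^(j - i) else 0)"
    have "(\<lambda>n. (deriv ^^ n) g 0 / fact n * (y - 0)^n) sums g y" by (rule holomorphic_power_series[OF g y])
    moreover have "(\<lambda>n. (deriv ^^ n) g 0 / fact n * (y - 0)^n) = (\<lambda>n. if n = j - i then c else 0)"
      using zero zero[of 0] by (auto simp: fun_eq_iff c_def)
    ultimately have "(\<lambda>n. if n = j - i then c else 0) sums g y" by simp
    moreover have "(\<lambda>n. if n = j - i then c else 0) sums c" by (rule sums_single)
    ultimately show ?thesis unfolding c_def[symmetric] by (rule sums_unique2)
  qed
  thus ?thesis by blast
qed

lemma abelian_relation_subset:
  assumes "abelian_relation_on K V F1 F2 F3" "open W" "W \<subseteq> V"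
  shows "abelian_relation_on K W F1 F2 F3"
proof -
  have "first_integral_on K W F" if "first_integral_on K V F" for F
    unfolding first_integral_on_def
  proof (intro conjI ballI allI impI)
    show "holo2_on F W" using that assms(2,3) holo2_on_subset unfolding first_integral_on_def by blast
    fix z X assume "z \<in> W" "open X \<and> z \<in> X \<and> X \<subseteq> W"
    hence "z \<in> V" "open X \<and> z \<in> X \<and> X \<subseteq> V" using assms(3) by auto
    thus "\<exists>C\<in>solutions K X. z \<in> C \<and> (\<forall>w\<in>C. F w = F z)"
      using that unfolding first_integral_on_def by meson
  qed
  moreover have "transverse_on W F G" if "transverse_on V F G" for F G
    using that assms(3) unfolding transverse_on_def by auto
  ultimately show ?thesis using assms unfolding abelian_relation_on_def by auto
qed

lemma locally_abelian_on_subset: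
  assumes "locally_abelian_on K P" "open Q" "Q \<subseteq> P"
  shows "locally_abelian_on K Q"
  unfolding locally_abelian_on_def
proof
  fix z assume z: "z \<in> Q - discr_curve K"
  hence "z \<in> P - discr_curve K" using assms(3) by auto
  from assms(1) this obtain V F1 F2 F3 where V: "open V" "z \<in> V" "V \<subseteq> P - discr_curve K" "abelian_relation_on K V F1 F2 F3"
    by (rule locally_abelian_onE)
  have o: "open (V \<inter> Q)" using V(1) assms(2) by (rule open_Int)
  have "abelian_relation_on K (V \<inter> Q) F1 F2 F3" by (rule abelian_relation_subset[OF V(4) o]) auto
  moreover have "V \<inter> Q \<subseteq> Q - discr_curve K" "z \<in> V \<inter> Q" using V z by auto
  ultimately show "\<exists>V F1 F2 F3. open V \<and> z \<in> V \<and> V \<subseteq> Q - discr_curve K \<and> abelian_relation_on K V F1 F2 F3"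
    using o by (intro exI[of _ "V \<inter> Q"] exI conjI)
qed

lemma first_integral_root:
  assumes "first_integral_on K V F" "z \<in> V" "has_partials F a b z" "(a, b) \<noteq> (0, 0)"
  shows "cubic_form K z b (- a) = 0"
proof -
  have "open V" using assms(1) by (auto simp: first_integral_on_def holo2_on_def)
  then obtain C where C: "C \<in> solutions K V" "z \<in> C" "\<forall>w\<in>C. F w = F z"
    using assms(1,2) unfolding first_integral_on_def by (meson subset_refl)
  show ?thesis by (rule solution_tangent[OF C(1,2) assms(3) _ assms(4)]) (use C(3) in blast)
qed

text \<open>
  The image of a leaf under the flow is again a leaf, and \<open>F(x, 2y)\<close> is constant on it.
\<close>

lemma first_integral_root_image:
  assumes F: "first_integral_on K V F" "z \<in> V" "has_partials F a b z" "(a, b) \<noteq> (0, 0)"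
    and U: "V \<subseteq> U" "(\<lambda>C. euler_flow 0 w t ` C) ` solutions K U \<subseteq> solutions K U'" and t: "exp (w * t) = 1/2"
  shows "cubic_form K (fst z, snd z / 2) (2 * b) (- a) = 0"
proof -
  let ?\<psi> = "euler_flow 0 w t"
  have \<psi>: "?\<psi> p = (fst p, snd p / 2)" for p using t by (cases p) (simp add: euler_flow_def)
  have "open V" using F(1) by (auto simp: first_integral_on_def holo2_on_def)
  then obtain C where C: "C \<in> solutions K V" "z \<in> C" "\<forall>w\<in>C. F w = F z"
    using F(1,2) unfolding first_integral_on_def by (meson subset_refl)
  have "C \<in> solutions K U" using C(1) U(1) solutions_mono solutions_subset by blast
  hence "?\<psi> ` C \<in> solutions K U'" using U(2) by blast
  hence "cubic_form K (?\<psi> z) (2 * b) (- a) = 0"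
  proof (rule solution_tangent)
    let ?i = "\<lambda>p::point. (fst p, 2 * snd p)"
    have i: "?i (?\<psi> p) = p" for p unfolding \<psi> by simp
    have s: "has_partials (\<lambda>p. 2 * snd p) 0 2 (?\<psi> z)"
      using has_partials_mult[OF has_partials_const[of 2] has_partials_snd] by simp
    have "has_partials (\<lambda>p. F (?i p)) (a * 1 + b * 0) (a * 0 + b * 2) (?\<psi> z)"
      by (rule has_partials_compose_map) (use F(3) i s in \<open>simp_all add: has_partials_fst\<close>)
    thus "has_partials (\<lambda>p. F (?i p)) a (2 * b) (?\<psi> z)" by (simp add: mult.commute)
    show "F (?i p) = F (?i (?\<psi> z))" if "p \<in> ?\<psi> ` C" for p
      using that C(3) i by (metis (no_types, lifting) imageE)
    show "(a, 2 * b) \<noteq> (0, 0)" using F(4) by auto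
  qed (use C(2) in auto)
  thus ?thesis by (simp add: \<psi>)
qed

lemma open_contains_bidisc:
  assumes "open U" "(0::complex, 0::complex) \<in> U"
  obtains r where "r > 0" "ball 0 r \<times> ball 0 r \<subseteq> U"
proof -
  obtain A B where AB: "open A" "open B" "(0, 0) \<in> A \<times> B" "A \<times> B \<subseteq> U" using open_prod_elim[OF assms] by metis
  obtain r s where "r > 0" "ball 0 r \<subseteq> A" "s > 0" "ball 0 s \<subseteq> B" using AB openE by (metis mem_Sigma_iff)
  thus ?thesis using that[of "min r s"] AB(4) by fastforce
qed

definition bidisc :: "real \<Rightarrow> point set" where "bidisc r = ball 0 r \<times> ball 0 r"

lemma bidisc_simps [simp]:
  "open (bidisc r)" "convex (bidisc r)"
  "(x, y) \<in> bidisc r \<longleftrightarrow> norm x < r \<and> norm y < r"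
  by (auto simp: bidisc_def open_Times convex_Times)

lemma bidisc_mono: "r \<le> s \<Longrightarrow> bidisc r \<subseteq> bidisc s" by (auto simp: bidisc_def)

lemma cubic_equation_nonzero_discr:
  assumes "cubic_equation K" "r > 0"
  obtains z where "z \<in> bidisc r" "discr K z \<noteq> 0"
proof -
  have "open (bidisc r)" "(0,0) \<in> bidisc r" using assms(2) by auto
  thus ?thesis using that assms(1) unfolding cubic_equation_def eventually_nhds by blast
qed

text \<open>
  At a point off the discriminant the form and its pullback under \<open>(x, y) \<mapsto> (x,
  y/2)\<close> vanish on the tangents of the same three leaves. So the minors of the two coefficient
  vectors vanish on a nonempty open set, hence identically.
\<close>

lemma homogeneous_coefficients_proportional:
  assumes K: "cubic_equation K" and hom: "weighted_homogeneous K 0 wy" and flat: "flat_web K"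
  obtains r where "r > 0" "\<And>i. i \<le> 3 \<Longrightarrow> holo2_on (\<lambda>z. coeff_at K z i) (bidisc r)"
    "locally_abelian_on K (bidisc r)"
    "\<And>i j z. i \<le> 3 \<Longrightarrow> j \<le> 3 \<Longrightarrow> z \<in> bidisc r \<Longrightarrow>
        (1/2)^i * coeff_at K (fst z, snd z / 2) i * coeff_at K z j = (1/2)^j * coeff_at K (fst z, snd z / 2) j * coeff_at K z i"
proof -
  obtain U0 where U0: "(0,0) \<in> U0" "holo2_on (cf3 K) U0" "holo2_on (cf2 K) U0" "holo2_on (cf1 K) U0" "holo2_on (cf0 K) U0"
    using K by (auto simp: cubic_equation_def)
  obtain U1 where U1: "open U1" "(0,0) \<in> U1" "locally_abelian_on K U1"
    by (rule flat_web_abelian_relation[OF flat])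
  \<comment> \<open>The time for which the flow halves \<open>y\<close>.\<close>
  define t where "t = - of_real (ln 2) / wy"
  have "wy \<noteq> 0" using hom by (auto simp: weighted_homogeneous_def)
  hence "exp (wy * t) = exp (of_real (- ln 2))" by (simp add: t_def)
  also have "\<dots> = 1/2" unfolding exp_of_real by (simp add: exp_minus)
  finally have t: "exp (wy * t) = 1/2" .
  have \<psi>: "euler_flow 0 wy t p = (fst p, snd p / 2)" for p using t by (cases p) (simp add: euler_flow_def)
  have "maps_web (euler_flow 0 wy t) K K" using hom by (simp add: weighted_homogeneous_def)
  then obtain U2 where U2: "(0,0) \<in> U2" "biholo_on (euler_flow 0 wy t) U2"
     "(\<lambda>C. euler_flow 0 wy t ` C) ` solutions K (U2 - discr_curve K) = solutions K (euler_flow 0 wy t ` U2 - discr_curve K)"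
    unfolding maps_web_def by blast
  have "open (U0 \<inter> U1 \<inter> U2)" using U0(2) U1(1) biholo_on_open(1)[OF U2(2)] by (auto simp: holo2_on_def)
  then obtain r where r: "r > 0" "bidisc r \<subseteq> U0 \<inter> U1 \<inter> U2"
    using open_contains_bidisc[of "U0 \<inter> U1 \<inter> U2"] U0(1) U1(2) U2(1) unfolding bidisc_def by auto
  have holo: "holo2_on (\<lambda>z. coeff_at K z i) (bidisc r)" if "i \<le> 3" for i
    using le3_cases[OF that] U0(2-5) r(2) holo2_on_subset[of _ U0 "bidisc r"] by auto
  have ab: "locally_abelian_on K (bidisc r)"
    using locally_abelian_on_subset[OF U1(3) bidisc_simps(1)] r(2) by blast
  have proportional: "(1/2)^i * coeff_at K (fst z, snd z / 2) i * coeff_at K z j = (1/2)^j * coeff_at K (fst z, snd z / 2) j * coeff_at K z i"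
    if ij: "i \<le> 3" "j \<le> 3" and z: "z \<in> bidisc r" for i j z
  proof -
    let ?H = "\<lambda>z. (1/2)^i * coeff_at K (fst z, snd z / 2) i * coeff_at K z j - (1/2)^j * coeff_at K (fst z, snd z / 2) j * coeff_at K z i"
    obtain z1 where z1: "z1 \<in> bidisc r" "discr K z1 \<noteq> 0" by (rule cubic_equation_nonzero_discr[OF K r(1)])
    hence "z1 \<in> bidisc r - discr_curve K" by (simp add: discr_curve_def)
    from ab this obtain V F1 F2 F3 where V: "open V" "z1 \<in> V" "V \<subseteq> bidisc r - discr_curve K" "abelian_relation_on K V F1 F2 F3"
      by (rule locally_abelian_onE)
    have half: "(fst p, snd p / 2) \<in> bidisc r" if "p \<in> bidisc r" for p
    proof (cases p)
      case (Pair x y)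
      thus ?thesis using that norm_ge_zero[of y] by (simp add: norm_divide del: norm_ge_zero)
    qed
    have hm: "holo_map_on (\<lambda>p. (fst p, snd p / 2)) (bidisc r)"
      unfolding holo_map_on_def using holo2_on_mult[OF holo2_on_snd holo2_on_const[of _ "1/2"], of "bidisc r"]
      by (simp add: holo2_on_fst)
    have "?H z = 0"
    proof (rule holo2_on_identity[of "bidisc r" ?H V])
      show "holo2_on ?H (bidisc r)"
        by (intro holo2_on_diff holo2_on_mult holo2_on_const holo ij holo2_on_compose_map[OF holo hm]) (use half in auto)
      show "?H p = 0" if p: "p \<in> V" for p
      proof -
        have F: "first_integral_on K V F1" "first_integral_on K V F2" "first_integral_on K V F3"
           "transverse_on V F1 F2" "transverse_on V F1 F3" "transverse_on V F2 F3"
          using V(4) by (auto simp: abelian_relation_on_def)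
        obtain a1 b1 a2 b2 a3 b3 where q: "has_partials F1 a1 b1 p" "has_partials F2 a2 b2 p" "has_partials F3 a3 b3 p"
          using F(1-3) p unfolding first_integral_on_def holo2_on_altdef by meson
        have ind: "a1 * b2 - b1 * a2 \<noteq> 0" "a1 * b3 - b1 * a3 \<noteq> 0" "a2 * b3 - b2 * a3 \<noteq> 0"
          using F(4-6) q p unfolding transverse_on_def by meson+
        hence nz: "(a1, b1) \<noteq> (0, 0)" "(a2, b2) \<noteq> (0, 0)" "(a3, b3) \<noteq> (0, 0)" by auto
        have ind': "b1 * - a2 - - a1 * b2 \<noteq> 0" "b1 * - a3 - - a1 * b3 \<noteq> 0" "b2 * - a3 - - a2 * b3 \<noteq> 0"
          using ind by (auto simp: algebra_simps)
        have VU: "V \<subseteq> U2 - discr_curve K" using V(3) r(2) by auto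
        let ?B = "\<lambda>i. (1/2)^i * coeff_at K (fst p, snd p / 2) i"
        have 2: "binary_cubic ?B b (- a) = 0" if "cubic_form K (fst p, snd p / 2) (2 * b) (- a) = 0" for a b
        proof -
          have "binary_cubic ?B b (- a) = (1/8) * cubic_form K (fst p, snd p / 2) (2 * b) (- a)"
            unfolding cubic_form_def binary_cubic_def by (simp add: power2_eq_square power3_eq_cube field_simps)
          thus ?thesis using that by simp
        qed
        have "?B i * coeff_at K p j = ?B j * coeff_at K p i"
          by (rule binary_cubics_proportional[OF 2 2 2 _ _ _ ind' ij])
             (use first_integral_root_image[OF F(1) p q(1) nz(1) VU _ t] first_integral_root_image[OF F(2) p q(2) nz(2) VU _ t]
               first_integral_root_image[OF F(3) p q(3) nz(3) VU _ t] U2(3)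
               first_integral_root[OF F(1) p q(1) nz(1)] first_integral_root[OF F(2) p q(2) nz(2)]
               first_integral_root[OF F(3) p q(3) nz(3)] in \<open>auto simp: cubic_form_eq_binary_cubic\<close>)
        thus ?thesis by simp
      qed
    qed (use V z in auto)
    thus ?thesis by simp
  qed
  show ?thesis by (rule that[OF r(1) holo ab proportional])
qed

text \<open>
  Dividing by a coefficient \<open>K\<^sub>j\<close> that does not vanish at the origin turns
  proportionality into homogeneity: \<open>K\<^sub>i / K\<^sub>j\<close> has degree \<open>j -
  i\<close> in \<open>y\<close>. If \<open>j < 2\<close>, then the two leading coefficients are zero
  and \<open>dx = 0\<close> is a double root everywhere.
\<close>

lemma homogeneous_coefficients:
  assumes K: "cubic_equation K" and hom: "weighted_homogeneous K 0 wy" and flat: "flat_web K"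
  obtains r j a where "r > 0" "j = 2 \<or> j = 3" "\<And>i. i \<le> 3 \<Longrightarrow> a i holomorphic_on ball 0 r"
    "\<And>z. z \<in> bidisc r \<Longrightarrow> coeff_at K z j \<noteq> 0"
    "\<And>i x y. i \<le> 3 \<Longrightarrow> (x, y) \<in> bidisc r \<Longrightarrow>
        coeff_at K (x, y) i = coeff_at K (x, y) j * (if i \<le> j then a i x * y^(j - i) else 0)"
    "locally_abelian_on K (bidisc r)"
proof -
  obtain r0 where r0: "r0 > 0" "\<And>i. i \<le> 3 \<Longrightarrow> holo2_on (\<lambda>z. coeff_at K z i) (bidisc r0)"
    "locally_abelian_on K (bidisc r0)"
    "\<And>i j z. i \<le> 3 \<Longrightarrow> j \<le> 3 \<Longrightarrow> z \<in> bidisc r0 \<Longrightarrow>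
        (1/2)^i * coeff_at K (fst z, snd z / 2) i * coeff_at K z j = (1/2)^j * coeff_at K (fst z, snd z / 2) j * coeff_at K z i"
    using homogeneous_coefficients_proportional[OF K hom flat] by metis
  have "\<exists>j\<le>3. coeff_at K (0, 0) j \<noteq> 0"
  proof (rule ccontr)
    assume "\<not> ?thesis"
    hence *: "coeff_at K (0, 0) j = 0" if "j \<le> 3" for j using that by blast
    show False using K *[of 0] *[of 1] *[of 2] *[of 3] by (simp add: cubic_equation_def)
  qed
  then obtain j where j: "j \<le> 3" "coeff_at K (0, 0) j \<noteq> 0" by auto
  have "continuous_on (bidisc r0) (\<lambda>z. coeff_at K z j)" by (rule holo2_on_imp_continuous_on[OF r0(2)[OF j(1)]])
  hence "open ((\<lambda>z. coeff_at K z j) -` (- {0}) \<inter> bidisc r0)"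
    using continuous_on_open_vimage[OF bidisc_simps(1)] by (metis open_Compl closed_singleton)
  then obtain r1 where r1: "r1 > 0" "bidisc r1 \<subseteq> (\<lambda>z. coeff_at K z j) -` (- {0}) \<inter> bidisc r0"
    using j(2) r0(1) open_contains_bidisc[of "(\<lambda>z. coeff_at K z j) -` (- {0}) \<inter> bidisc r0"] unfolding bidisc_def[of r1]
    by (auto simp: bidisc_def)
  have nz: "coeff_at K z j \<noteq> 0" if "z \<in> bidisc r1" for z using r1(2) that by auto
  have sub: "bidisc r1 \<subseteq> bidisc r0" using r1(2) by auto
  have holo: "holo2_on (\<lambda>z. coeff_at K z i) (bidisc r1)" if "i \<le> 3" for i
    by (rule holo2_on_subset[OF r0(2)[OF that] _ sub]) simp
  define g where "g i x y = coeff_at K (x, y) i / coeff_at K (x, y) j" for i x y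
  have gy: "(\<lambda>y. g i x y) holomorphic_on ball 0 r1" if "i \<le> 3" "x \<in> ball 0 r1" for i x
    unfolding g_def using that nz
    by (intro holomorphic_on_divide holo2_on_compose_curve[OF holo]) (auto simp: j(1) intro!: holomorphic_intros)
  have gx: "(\<lambda>x. g i x y) holomorphic_on ball 0 r1" if "i \<le> 3" "y \<in> ball 0 r1" for i y
    unfolding g_def using that nz
    by (intro holomorphic_on_divide holo2_on_compose_curve[OF holo]) (auto simp: j(1) intro!: holomorphic_intros)
  have hom: "(1/2)^i * g i x (y / 2) = (1/2)^j * g i x y" if i: "i \<le> 3" and xy: "x \<in> ball 0 r1" "y \<in> ball 0 r1" for i x y
  proof -
    have 1: "(x, y) \<in> bidisc r1" using xy by simp
    have "(x, y / 2) \<in> bidisc r1" using xy norm_ge_zero[of y] by (simp add: norm_divide del: norm_ge_zero)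
    hence 2: "coeff_at K (x, y / 2) j \<noteq> 0" "coeff_at K (x, y) j \<noteq> 0" using nz 1 by auto
    have "(1/2)^i * coeff_at K (x, y / 2) i * coeff_at K (x, y) j = (1/2)^j * coeff_at K (x, y / 2) j * coeff_at K (x, y) i"
      using r0(4)[OF i j(1) subsetD[OF sub 1]] by simp
    thus ?thesis unfolding g_def using 2 by (simp add: field_simps)
  qed
  \<comment> \<open>The coefficient of the monomial is read off at a fixed nonzero \<open>y1\<close>, so it is holomorphic in \<open>x\<close>.\<close>
  define y1 :: complex where "y1 = of_real (r1 / 2)"
  have y1: "y1 \<in> ball 0 r1" "y1 \<noteq> 0" using r1(1) by (auto simp: y1_def)
  define a where "a i x = g i x y1 / y1^(j - i)" for i x
  have a: "a i holomorphic_on ball 0 r1" if "i \<le> 3" for i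
    unfolding a_def using gx[OF that y1(1)] y1(2) by (intro holomorphic_intros) auto
  have ga: "g i x y = (if i \<le> j then a i x * y^(j - i) else 0)" if i: "i \<le> 3" and xy: "x \<in> ball 0 r1" "y \<in> ball 0 r1" for i x y
  proof -
    obtain b where b: "\<forall>y\<in>ball 0 r1. g i x y = (if i \<le> j then b * y^(j - i) else 0)"
      using homogeneous_function_monomial[OF gy[OF i xy(1)] r1(1) hom[OF i xy(1)]] by blast
    have "a i x = b" if "i \<le> j" using b y1 that unfolding a_def by simp
    thus ?thesis using b xy by auto
  qed
  have coeff: "coeff_at K (x, y) i = coeff_at K (x, y) j * (if i \<le> j then a i x * y^(j - i) else 0)"
    if "i \<le> 3" "(x, y) \<in> bidisc r1" for i x y
  proof -
    have "g i x y = (if i \<le> j then a i x * y^(j - i) else 0)" using ga[OF that(1), of x y] that(2) by simp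
    moreover have "coeff_at K (x, y) i = coeff_at K (x, y) j * g i x y"
      unfolding g_def using nz[OF that(2)] by simp
    ultimately show ?thesis by metis
  qed
  have j23: "j = 2 \<or> j = 3"
  proof (rule ccontr)
    assume "\<not> ?thesis"
    hence j1: "j < 2" using j(1) by linarith
    obtain z where z: "z \<in> bidisc r1" "discr K z \<noteq> 0" by (rule cubic_equation_nonzero_discr[OF K r1(1)])
    have "cf3 K z = 0" "cf2 K z = 0" using coeff[of 3 "fst z" "snd z"] coeff[of 2 "fst z" "snd z"] z(1) j1 by auto
    thus False using z(2) by (simp add: discr_def)
  qed
  have ab: "locally_abelian_on K (bidisc r1)" by (rule locally_abelian_on_subset[OF r0(3) _ sub]) simp
  show ?thesis by (rule that[OF r1(1) j23 a nz coeff ab])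
qed

section \<open>Webs whose slopes depend on one variable\<close>

lemma has_partials_deriv:
  assumes "has_partials F a b (x, y)"
  shows "((\<lambda>x. F (x, y)) has_field_derivative a) (at x)" "((\<lambda>y. F (x, y)) has_field_derivative b) (at y)"
proof -
  show "((\<lambda>x. F (x, y)) has_field_derivative a) (at x)"
    using has_partials_compose_curve[of F a b "\<lambda>x. x" x "\<lambda>_. y" 1 0] assms by simp
  show "((\<lambda>y. F (x, y)) has_field_derivative b) (at y)"
    using has_partials_compose_curve[of F a b "\<lambda>_. x" y "\<lambda>y. y" 0 1] assms by simp
qed

text \<open>
  By Cauchy's inequality the derivatives along two neighbouring slices differ by at most the
  supremum of the difference of \<open>F\<close> on a circle divided by its radius, which is small
  by uniform continuity. Along the fixed slice \<open>x = x0\<close> the derivative is holomorphic.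
\<close>

lemma holo2_on_slice_deriv_isCont:
  assumes F: "holo2_on F U" and z: "(x0, y0) \<in> U"
  shows "isCont (\<lambda>z. deriv (\<lambda>y. F (fst z, y)) (snd z)) (x0, y0)"
proof -
  let ?D = "\<lambda>x y. deriv (\<lambda>y. F (x, y)) y"
  have U: "open U" using F by (auto simp: holo2_on_def)
  obtain A B where AB: "open A" "open B" "(x0, y0) \<in> A \<times> B" "A \<times> B \<subseteq> U" using open_prod_elim[OF U z] by metis
  obtain r1 where r1: "r1 > 0" "cball x0 r1 \<subseteq> A" using AB(1,3) open_contains_cball by (metis mem_Sigma_iff)
  obtain r2 where r2: "r2 > 0" "cball y0 r2 \<subseteq> B" using AB(2,3) open_contains_cball by (metis mem_Sigma_iff)
  define r where "r = min r1 (r2 / 2)"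
  have r: "r > 0" "r \<le> r1" "2 * r \<le> r2" using r1(1) r2(1) by (auto simp: r_def)
  define Q where "Q = cball x0 r \<times> cball y0 (2 * r)"
  have "cball x0 r \<subseteq> A" "cball y0 (2 * r) \<subseteq> B" using r1(2) r2(2) r by auto
  hence QU: "Q \<subseteq> U" using AB(4) unfolding Q_def by blast
  have hol: "(\<lambda>y. F (x, y)) holomorphic_on ball y0 (2 * r)" if "x \<in> cball x0 r" for x
    by (rule holo2_on_compose_curve[OF F]) (use that QU in \<open>auto simp: Q_def\<close>)
  have "uniformly_continuous_on Q F"
    by (rule compact_uniformly_continuous) (use holo2_on_imp_continuous_on[OF F] QU continuous_on_subset in \<open>auto simp: Q_def intro!: compact_Times\<close>)
  note uc = this
  have "isCont (\<lambda>y. ?D x0 y) y0"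
  proof -
    have "(\<lambda>y. ?D x0 y) holomorphic_on ball y0 (2 * r)"
      using hol[of x0] r by (intro holomorphic_deriv) auto
    thus ?thesis using r holomorphic_on_imp_continuous_on continuous_on_eq_continuous_at
      by (metis centre_in_ball mult_pos_pos open_ball zero_less_numeral)
  qed
  note c0 = this
  show ?thesis unfolding continuous_at_eps_delta
  proof (intro allI impI)
    fix e :: real assume e: "e > 0"
    obtain d1 where d1: "d1 > 0" "\<And>y. dist y y0 < d1 \<Longrightarrow> dist (?D x0 y) (?D x0 y0) < e / 2"
      using c0 e unfolding continuous_at_eps_delta by (meson half_gt_zero)
    obtain d2 where d2: "d2 > 0" "\<And>p q. p \<in> Q \<Longrightarrow> q \<in> Q \<Longrightarrow> dist q p < d2 \<Longrightarrow> dist (F q) (F p) < e / 2 * r"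
    proof -
      have "e / 2 * r > 0" using e r(1) by simp
      thus ?thesis using uc that unfolding uniformly_continuous_on_def by metis
    qed
    have "dist (?D (fst z) (snd z)) (?D x0 y0) < e" if z: "dist z (x0, y0) < min (min d1 d2) r" for z
    proof -
      obtain x y where zz: "z = (x, y)" by (cases z)
      have xy: "dist x x0 < min (min d1 d2) r" "dist y y0 < min (min d1 d2) r"
        using z dist_fst_le[of z "(x0, y0)"] dist_snd_le[of z "(x0, y0)"] unfolding zz by auto
      have sub: "cball y r \<subseteq> cball y0 (2 * r)" "ball y r \<subseteq> ball y0 (2 * r)"
      proof -
        have "dist y0 \<eta> \<le> dist y y0 + dist y \<eta>" for \<eta> by (metis dist_commute dist_triangle)
        thus "cball y r \<subseteq> cball y0 (2 * r)" "ball y r \<subseteq> ball y0 (2 * r)"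
          using xy(2) by (force simp: subset_iff intro: order_trans order_le_less_trans)+
      qed
      have x: "x \<in> cball x0 r" "x0 \<in> cball x0 r" using xy(1) r(1) by (auto simp: dist_commute)
      let ?h = "\<lambda>\<eta>. F (x, \<eta>) - F (x0, \<eta>)"
      have Fd: "(\<lambda>y. F (x, y)) field_differentiable at y" "(\<lambda>y. F (x0, y)) field_differentiable at y"
        using hol[OF x(1)] hol[OF x(2)] xy(2) r(1)
        by (auto intro!: holomorphic_on_imp_differentiable_at[of _ "ball y0 (2 * r)"] simp: dist_commute)
      have "norm ((deriv ^^ 1) ?h y) \<le> fact 1 * (e / 2 * r) / r ^ 1"
      proof (rule Cauchy_inequality)
        show "?h holomorphic_on ball y r"
          using hol[OF x(1)] hol[OF x(2)] sub(2) by (intro holomorphic_intros) (auto elim: holomorphic_on_subset)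
        have "continuous_on (cball y r) (\<lambda>\<eta>. F (x, \<eta>))" if "x \<in> cball x0 r" for x
          by (rule continuous_on_compose2[OF holo2_on_imp_continuous_on[OF F]])
             (use sub QU that in \<open>auto intro!: continuous_intros simp: Q_def\<close>)
        thus "continuous_on (cball y r) ?h" using x by (intro continuous_on_diff) auto
        fix \<eta> assume "norm (y - \<eta>) = r"
        hence "\<eta> \<in> cball y r" by (simp add: dist_norm)
        hence "\<eta> \<in> cball y0 (2 * r)" using sub by blast
        hence "dist (F (x, \<eta>)) (F (x0, \<eta>)) < e / 2 * r"
          using x xy(1) by (intro d2(2)) (auto simp: Q_def dist_Pair_Pair)
        thus "norm (?h \<eta>) \<le> e / 2 * r" by (simp add: dist_norm)
      qed (use r in auto)
      hence "norm (deriv ?h y) \<le> e / 2" using r(1) by simp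
      moreover have "deriv ?h y = ?D x y - ?D x0 y" by (rule deriv_diff[OF Fd])
      ultimately have "dist (?D x y) (?D x0 y) \<le> e / 2" by (simp add: dist_norm)
      moreover have "dist (?D x0 y) (?D x0 y0) < e / 2" using d1(2) xy(2) by auto
      ultimately show ?thesis unfolding zz using dist_triangle[of "?D x y" "?D x0 y0" "?D x0 y"] by simp
    qed
    thus "\<exists>d>0. \<forall>z. dist z (x0, y0) < d \<longrightarrow> dist (?D (fst z) (snd z)) (?D (fst (x0, y0)) (snd (x0, y0))) < e"
      using d1(1) d2(1) r(1) by (intro exI[of _ "min (min d1 d2) r"]) auto
  qed
qed

lemma holo2_on_partials_continuous:
  assumes F: "holo2_on F U"
  obtains Fx Fy where "\<And>z. z \<in> U \<Longrightarrow> has_partials F (Fx z) (Fy z) z" "continuous_on U Fx" "continuous_on U Fy"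
proof -
  define Fx Fy where "Fx z = deriv (\<lambda>x. F (x, snd z)) (fst z)" and "Fy z = deriv (\<lambda>y. F (fst z, y)) (snd z)" for z
  have U: "open U" using F by (auto simp: holo2_on_def)
  show ?thesis
  proof (rule that[of Fx Fy])
    fix z assume "z \<in> U"
    then obtain a b where ab: "has_partials F a b z" using F by (auto simp: holo2_on_altdef)
    have "Fx z = a" "Fy z = b" unfolding Fx_def Fy_def
      using has_partials_deriv[of F a b "fst z" "snd z"] ab by (auto intro: DERIV_imp_deriv)
    thus "has_partials F (Fx z) (Fy z) z" using ab by simp
  next
    have "isCont Fy z" if "z \<in> U" for z
      using holo2_on_slice_deriv_isCont[OF F, of "fst z" "snd z"] that by (simp add: Fy_def[abs_def])
    thus "continuous_on U Fy" by (intro continuous_at_imp_continuous_on ballI)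
    have sw: "holo2_on (\<lambda>z. F (prod.swap z)) (prod.swap ` U)"
      by (rule holo2_on_compose_map[OF F]) (use biholo_on_swap[OF open_swap[OF U]] in \<open>auto simp: biholo_on_def\<close>)
    have "isCont Fx z" if "z \<in> U" for z
    proof -
      have "isCont (\<lambda>z. deriv (\<lambda>y. F (prod.swap (fst z, y))) (snd z)) (prod.swap z)"
        using holo2_on_slice_deriv_isCont[OF sw, of "snd z" "fst z"] imageI[OF that, of prod.swap]
        by (simp add: prod.swap_def)
      moreover have "isCont (\<lambda>z::point. prod.swap z) z" unfolding prod.swap_def by (intro continuous_intros)
      ultimately have "isCont (\<lambda>w. deriv (\<lambda>y. F (prod.swap (fst (prod.swap w), y))) (snd (prod.swap w))) z"
        using isCont_o2[of z prod.swap "\<lambda>z. deriv (\<lambda>y. F (prod.swap (fst z, y))) (snd z)"] by simp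
      thus ?thesis by (simp add: Fx_def[abs_def])
    qed
    thus "continuous_on U Fx" by (intro continuous_at_imp_continuous_on ballI)
  qed
qed

lemma DERIV_const_on_open_eq_0:
  assumes "(g has_field_derivative D) (at x)" "open S" "x \<in> S" "\<And>y. y \<in> S \<Longrightarrow> g y = c"
  shows "D = 0"
proof (rule DERIV_unique[OF assms(1)])
  show "(g has_field_derivative 0) (at x)"
    by (rule has_field_derivative_transform_within_open[OF DERIV_const[of c] assms(2,3)]) (use assms(4) in auto)
qed

text \<open>
  For the web \<open>du = r\<^sub>i(x) dx\<close> let \<open>\<delta>\<^sub>1 = r\<^sub>2 -
  r\<^sub>3\<close>, \<open>\<delta>\<^sub>2 = r\<^sub>3 - r\<^sub>1\<close>,
  \<open>\<delta>\<^sub>3 = r\<^sub>1 - r\<^sub>2\<close>. The relation is \<open>\<delta>\<^sub>1'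
  \<delta>\<^sub>2 - \<delta>\<^sub>1 \<delta>\<^sub>2' = - b \<delta>\<^sub>1 \<delta>\<^sub>2
  \<delta>\<^sub>3\<close>, where \<open>b\<close> is, up to sign, the \<open>du\<close>-coefficient
  of the Chern connection form. As the coefficients of that form depend on \<open>x\<close> only,
  the curvature of the web, its exterior derivative, vanishes exactly if \<open>b\<close> is
  constant.
\<close>

definition constant_curvature :: "(complex \<Rightarrow> complex) \<Rightarrow> (complex \<Rightarrow> complex) \<Rightarrow> (complex \<Rightarrow> complex) \<Rightarrow> complex \<Rightarrow> complex \<Rightarrow> bool" where
  "constant_curvature r1 r2 r3 b x \<longleftrightarrow>
     (deriv r2 x - deriv r3 x) * (r3 x - r1 x) - (r2 x - r3 x) * (deriv r3 x - deriv r1 x)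
       = - b * ((r2 x - r3 x) * (r3 x - r1 x) * (r1 x - r2 x))"

text \<open>
  Differentiating the sum in \<open>w\<close> and in \<open>x\<close> gives two linear equations for
  the three numbers \<open>f\<^sub>i'(w - R\<^sub>i x)\<close>, so these are proportional to the
  differences of the slopes (step \<open>A\<close>). Logarithmic differentiation in \<open>w\<close>
  shows that \<open>f\<^sub>1''/f\<^sub>1'\<close> and \<open>f\<^sub>2''/f\<^sub>2'\<close> agree
  at the arguments \<open>w - R\<^sub>1 x\<close> and \<open>w - R\<^sub>2 x\<close> (step
  \<open>B\<close>). Since these arguments vary with different slopes, the common value is a
  constant \<open>b\<close> (step \<open>C\<close>). Differentiating \<open>A\<close> in
  \<open>x\<close> then gives the relation.
\<close>

lemma abelian_equation:
  fixes f1 f2 f3 R1 R2 R3 r1 r2 r3 :: "complex \<Rightarrow> complex"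
  assumes pos: "\<rho> > 0"
    and f: "f1 holomorphic_on ball 0 e" "f2 holomorphic_on ball 0 e" "f3 holomorphic_on ball 0 e"
    and R: "\<And>x. x \<in> ball x0 \<rho> \<Longrightarrow> (R1 has_field_derivative r1 x) (at x)"
           "\<And>x. x \<in> ball x0 \<rho> \<Longrightarrow> (R2 has_field_derivative r2 x) (at x)"
           "\<And>x. x \<in> ball x0 \<rho> \<Longrightarrow> (R3 has_field_derivative r3 x) (at x)"
    and R0: "R1 x0 = 0" "R2 x0 = 0"
    and r: "r1 holomorphic_on ball x0 \<rho>" "r2 holomorphic_on ball x0 \<rho>" "r3 holomorphic_on ball x0 \<rho>"
    and dom: "\<And>w x. w \<in> ball 0 \<rho> \<Longrightarrow> x \<in> ball x0 \<rho> \<Longrightarrow>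
        w - R1 x \<in> ball 0 e \<and> w - R2 x \<in> ball 0 e \<and> w - R3 x \<in> ball 0 e"
    and sum0: "\<And>w x. w \<in> ball 0 \<rho> \<Longrightarrow> x \<in> ball x0 \<rho> \<Longrightarrow> f1 (w - R1 x) + f2 (w - R2 x) + f3 (w - R3 x) = 0"
    and nz: "\<And>w. w \<in> ball 0 e \<Longrightarrow> deriv f1 w \<noteq> 0 \<and> deriv f2 w \<noteq> 0"
    and dist: "\<And>x. x \<in> ball x0 \<rho> \<Longrightarrow> r1 x \<noteq> r2 x \<and> r1 x \<noteq> r3 x \<and> r2 x \<noteq> r3 x"
  shows "\<exists>\<sigma> b. \<sigma> > 0 \<and> \<sigma> \<le> \<rho> \<and> (\<forall>x\<in>ball x0 \<sigma>.
     constant_curvature r1 r2 r3 b x)"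
proof -
  have Dw: "((\<lambda>w. f (w - c)) has_field_derivative deriv f (w - c)) (at w)"
    if "f holomorphic_on ball 0 e" "w - c \<in> ball 0 e" for f :: "complex \<Rightarrow> complex" and w c

    by (rule DERIV_chain2[of f "deriv f (w - c)" "\<lambda>w. w - c" w 1 UNIV, simplified])
       (use holomorphic_derivI[OF that(1) open_ball that(2)] in \<open>auto intro!: derivative_eq_intros\<close>)
  have Dx: "((\<lambda>x. f (w - R x)) has_field_derivative - (r * deriv f (w - R x))) (at x)"
    if "f holomorphic_on ball 0 e" "w - R x \<in> ball 0 e" "(R has_field_derivative r) (at x)"
    for f R :: "complex \<Rightarrow> complex" and w r x

    by (rule DERIV_chain2[of f "deriv f (w - R x)" "\<lambda>x. w - R x" x "- r" UNIV, THEN DERIV_cong])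
       (use holomorphic_derivI[OF that(1) open_ball that(2)] that(3) in \<open>auto intro!: derivative_eq_intros\<close>)
  have f': "deriv f1 holomorphic_on ball 0 e" "deriv f2 holomorphic_on ball 0 e"
    using f by (auto intro: holomorphic_deriv)
  have f'': "deriv (deriv f1) holomorphic_on ball 0 e" "deriv (deriv f2) holomorphic_on ball 0 e"
    using f' by (auto intro: holomorphic_deriv)
  have A: "deriv f1 (w - R1 x) * (r3 x - r1 x) = deriv f2 (w - R2 x) * (r2 x - r3 x)"
    if w: "w \<in> ball 0 \<rho>" and x: "x \<in> ball x0 \<rho>" for w x
  proof -
    have d: "w - R1 x \<in> ball 0 e" "w - R2 x \<in> ball 0 e" "w - R3 x \<in> ball 0 e" using dom[OF w x] by auto
    have "deriv f1 (w - R1 x) + deriv f2 (w - R2 x) + deriv f3 (w - R3 x) = 0"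
      by (rule DERIV_const_on_open_eq_0[OF DERIV_add[OF DERIV_add[OF Dw[OF f(1) d(1)] Dw[OF f(2) d(2)]] Dw[OF f(3) d(3)]] open_ball w])
         (rule sum0[OF _ x])
    moreover have "- (r1 x * deriv f1 (w - R1 x)) + - (r2 x * deriv f2 (w - R2 x)) + - (r3 x * deriv f3 (w - R3 x)) = 0"
      by (rule DERIV_const_on_open_eq_0[OF DERIV_add[OF DERIV_add[OF Dx[OF f(1) d(1) R(1)[OF x]] Dx[OF f(2) d(2) R(2)[OF x]]] Dx[OF f(3) d(3) R(3)[OF x]]] open_ball x])
         (rule sum0[OF w])
    ultimately show ?thesis by algebra
  qed
  define \<phi>1 \<phi>2 where "\<phi>1 w = deriv (deriv f1) w / deriv f1 w" and "\<phi>2 w = deriv (deriv f2) w / deriv f2 w" for w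
  have \<phi>: "\<phi>1 holomorphic_on ball 0 e" "\<phi>2 holomorphic_on ball 0 e"
    unfolding \<phi>1_def \<phi>2_def using f' f'' nz by (auto intro!: holomorphic_intros)
  have B: "\<phi>1 (w - R1 x) + - \<phi>2 (w - R2 x) = 0" if w: "w \<in> ball 0 \<rho>" and x: "x \<in> ball x0 \<rho>" for w x
  proof -
    have d: "w - R1 x \<in> ball 0 e" "w - R2 x \<in> ball 0 e" using dom[OF w x] by auto
    have "deriv (deriv f1) (w - R1 x) * (r3 x - r1 x) - deriv (deriv f2) (w - R2 x) * (r2 x - r3 x) = 0"
      by (rule DERIV_const_on_open_eq_0[OF DERIV_diff[OF DERIV_cmult_right[OF Dw[OF f'(1) d(1)]] DERIV_cmult_right[OF Dw[OF f'(2) d(2)]]] open_ball w])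
         (use A[OF _ x] in simp)
    hence "deriv (deriv f1) (w - R1 x) * (r3 x - r1 x) = deriv (deriv f2) (w - R2 x) * (r2 x - r3 x)" by simp
    hence "deriv (deriv f1) (w - R1 x) * (r3 x - r1 x) / (deriv f1 (w - R1 x) * (r3 x - r1 x))
       = deriv (deriv f2) (w - R2 x) * (r2 x - r3 x) / (deriv f2 (w - R2 x) * (r2 x - r3 x))"
      using A[OF w x] by simp
    thus ?thesis using dist[OF x] unfolding \<phi>1_def \<phi>2_def by (auto split: if_splits)
  qed
  have C: "deriv \<phi>1 w = 0" if w: "w \<in> ball 0 \<rho>" for w
  proof -
    have x: "x0 \<in> ball x0 \<rho>" using pos by simp
    have d: "w - R1 x0 \<in> ball 0 e" "w - R2 x0 \<in> ball 0 e" using dom[OF w x] by auto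
    have "deriv \<phi>1 (w - R1 x0) + - deriv \<phi>2 (w - R2 x0) = 0"
      by (rule DERIV_const_on_open_eq_0[OF DERIV_add[OF Dw[OF \<phi>(1) d(1)] DERIV_minus[OF Dw[OF \<phi>(2) d(2)]]] open_ball w])
         (rule B[OF _ x])
    moreover have "- (r1 x0 * deriv \<phi>1 (w - R1 x0)) + - (- (r2 x0 * deriv \<phi>2 (w - R2 x0))) = 0"
      by (rule DERIV_const_on_open_eq_0[OF DERIV_add[OF Dx[OF \<phi>(1) d(1) R(1)[OF x]] DERIV_minus[OF Dx[OF \<phi>(2) d(2) R(2)[OF x]]]] open_ball x])
         (rule B[OF w])
    ultimately have "(r1 x0 - r2 x0) * deriv \<phi>1 (w - R1 x0) = 0" by algebra
    thus ?thesis using dist[OF x] R0 by simp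
  qed
  have sub: "ball (0::complex) \<rho> \<subseteq> ball 0 e"
  proof
    fix w :: complex assume "w \<in> ball 0 \<rho>"
    thus "w \<in> ball 0 e" using dom[of w x0] pos R0 by simp
  qed
  obtain b where b: "\<And>w. w \<in> ball 0 \<rho> \<Longrightarrow> \<phi>1 w = b"
  proof -
    have "(\<phi>1 has_field_derivative 0) (at w within ball 0 \<rho>)" if "w \<in> ball 0 \<rho>" for w
      using holomorphic_derivI[OF \<phi>(1) open_ball, of w] that sub C[OF that] has_field_derivative_at_within by fastforce
    thus ?thesis using has_field_derivative_zero_constant[of "ball 0 \<rho>" \<phi>1] that by auto
  qed
  have b2: "\<phi>2 w = b" if "w \<in> ball 0 \<rho>" for w using B[OF that, of x0] b[OF that] pos R0 by simp
  have cont: "isCont R1 x0" "isCont R2 x0" using R(1,2)[of x0] pos DERIV_isCont by auto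
  have "\<exists>\<sigma>>0. \<forall>x. dist x x0 < \<sigma> \<longrightarrow> dist (R1 x) (R1 x0) < \<rho>" "\<exists>\<sigma>>0. \<forall>x. dist x x0 < \<sigma> \<longrightarrow> dist (R2 x) (R2 x0) < \<rho>"
    using cont pos unfolding continuous_at_eps_delta by blast+
  then obtain s1 s2 where s: "s1 > 0" "\<And>x. dist x x0 < s1 \<Longrightarrow> dist (R1 x) (R1 x0) < \<rho>"
     "s2 > 0" "\<And>x. dist x x0 < s2 \<Longrightarrow> dist (R2 x) (R2 x0) < \<rho>" by blast
  define \<sigma> where "\<sigma> = min \<rho> (min s1 s2)"
  show ?thesis
  proof (intro exI[of _ \<sigma>] exI[of _ b] conjI ballI)
    show "\<sigma> > 0" "\<sigma> \<le> \<rho>" using s pos by (auto simp: \<sigma>_def)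
    fix x assume "x \<in> ball x0 \<sigma>"
    hence x: "x \<in> ball x0 \<rho>" and Rs: "- R1 x \<in> ball 0 \<rho>" "- R2 x \<in> ball 0 \<rho>"
      using s(2)[of x] s(4)[of x] R0 by (auto simp: \<sigma>_def dist_commute)
    have w: "(0::complex) \<in> ball 0 \<rho>" using pos by simp
    have d: "0 - R1 x \<in> ball 0 e" "0 - R2 x \<in> ball 0 e" using dom[OF w x] by auto
    have dd: "deriv (deriv f1) (0 - R1 x) = b * deriv f1 (0 - R1 x)" "deriv (deriv f2) (0 - R2 x) = b * deriv f2 (0 - R2 x)"
      using b[OF Rs(1)] b2[OF Rs(2)] nz d unfolding \<phi>1_def \<phi>2_def by (auto simp: field_simps)
    have rd: "(r1 has_field_derivative deriv r1 x) (at x)" "(r2 has_field_derivative deriv r2 x) (at x)" "(r3 has_field_derivative deriv r3 x) (at x)"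
      using r x holomorphic_derivI open_ball by blast+
    let ?g1 = "deriv f1 (0 - R1 x)" and ?g2 = "deriv f2 (0 - R2 x)"
    have "- (r1 x * deriv (deriv f1) (0 - R1 x)) * (r3 x - r1 x) + (deriv r3 x - deriv r1 x) * ?g1
        - (- (r2 x * deriv (deriv f2) (0 - R2 x)) * (r2 x - r3 x) + (deriv r2 x - deriv r3 x) * ?g2) = 0"
      by (rule DERIV_const_on_open_eq_0[OF DERIV_diff[OF
             DERIV_mult[OF Dx[OF f'(1) d(1) R(1)[OF x]] DERIV_diff[OF rd(3) rd(1)]]
             DERIV_mult[OF Dx[OF f'(2) d(2) R(2)[OF x]] DERIV_diff[OF rd(2) rd(3)]]] open_ball x])
         (use A[OF w] in simp)
    hence e5: "?g1 * (- b * r1 x * (r3 x - r1 x) + (deriv r3 x - deriv r1 x))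
        = ?g2 * (- b * r2 x * (r2 x - r3 x) + (deriv r2 x - deriv r3 x))"
      unfolding dd by (simp add: algebra_simps)
    have "?g1 * ((r2 x - r3 x) * (- b * r1 x * (r3 x - r1 x) + (deriv r3 x - deriv r1 x)))
        = ?g1 * ((r3 x - r1 x) * (- b * r2 x * (r2 x - r3 x) + (deriv r2 x - deriv r3 x)))"
      using e5 A[OF w x] by algebra
    hence "(r2 x - r3 x) * (- b * r1 x * (r3 x - r1 x) + (deriv r3 x - deriv r1 x))
        = (r3 x - r1 x) * (- b * r2 x * (r2 x - r3 x) + (deriv r2 x - deriv r3 x))" using nz d by simp
    thus "constant_curvature r1 r2 r3 b x" unfolding constant_curvature_def by algebra
  qed
qed

text \<open>
  The difference of the equations at \<open>x\<close> and \<open>x0\<close> is \<open>(r x - r x0) Q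
  x + h x - h x0 = 0\<close>. As \<open>Q x0\<close> is the derivative of the polynomial at its
  simple root, the difference quotient of \<open>r\<close> converges.
\<close>

lemma simple_root_holomorphic:
  assumes S: "open S" and r: "continuous_on S r" and a: "a2 holomorphic_on S" "a1 holomorphic_on S" "a0 holomorphic_on S"
    and root: "\<And>x. x \<in> S \<Longrightarrow> r x ^ 3 + a2 x * r x ^ 2 + a1 x * r x + a0 x = 0"
    and simple: "\<And>x. x \<in> S \<Longrightarrow> 3 * r x ^ 2 + 2 * a2 x * r x + a1 x \<noteq> 0"
  shows "r holomorphic_on S"
proof -
  have "r field_differentiable at x0" if x0: "x0 \<in> S" for x0
  proof -
    let ?h = "\<lambda>x. r x0 ^ 3 + a2 x * r x0 ^ 2 + a1 x * r x0 + a0 x"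
    let ?Q = "\<lambda>x. r x ^ 2 + r x * r x0 + r x0 ^ 2 + a2 x * (r x + r x0) + a1 x"
    have "?h holomorphic_on S" by (intro holomorphic_intros a)
    then obtain h' where "(?h has_field_derivative h') (at x0)" using S x0 holomorphic_derivI by blast
    hence h: "(\<lambda>x. (?h x - ?h x0) / (x - x0)) \<midarrow>x0\<rightarrow> h'" by (simp add: has_field_derivative_iff)
    have c: "isCont r x0" "isCont a2 x0" "isCont a1 x0"
      using r a(1,2) S x0 holomorphic_on_imp_continuous_on continuous_on_eq_continuous_at by metis+
    have "isCont ?Q x0" by (intro continuous_intros c)
    hence Q: "?Q \<midarrow>x0\<rightarrow> ?Q x0" by (simp add: isCont_def)
    have Q0: "?Q x0 \<noteq> 0" using simple[OF x0] by (simp add: algebra_simps power2_eq_square)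
    have "(\<lambda>x. - ((?h x - ?h x0) / (x - x0)) / ?Q x) \<midarrow>x0\<rightarrow> - h' / ?Q x0"
      by (intro tendsto_intros h Q Q0)
    moreover have "\<forall>\<^sub>F x in at x0. - ((?h x - ?h x0) / (x - x0)) / ?Q x = (r x - r x0) / (x - x0)"
    proof -
      have 1: "\<forall>\<^sub>F x in at x0. ?Q x \<noteq> 0" using Q Q0 by (rule tendsto_imp_eventually_ne)
      have 2: "\<forall>\<^sub>F x in at x0. x \<in> S" using eventually_at_in_open'[OF S x0] .
      have 3: "\<forall>\<^sub>F x in at x0. x \<noteq> x0" by (simp add: eventually_at_filter)
      show ?thesis using 1 2 3
      proof eventually_elim
        case (elim x)
        have "(r x - r x0) * ?Q x = - (?h x - ?h x0)" using root[OF elim(2)] root[OF x0] by algebra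
        hence "r x - r x0 = - (?h x - ?h x0) / ?Q x" using elim(1) by (simp add: field_simps)
        have "- ((H - H0) / d) / q = e / d" if "e = - (H - H0) / q" for H H0 d q e :: complex
          unfolding that divide_divide_eq_left minus_divide_left by (simp add: mult.commute)
        from this[OF \<open>r x - r x0 = _\<close>] show ?case .
      qed
    qed
    ultimately have "(\<lambda>x. (r x - r x0) / (x - x0)) \<midarrow>x0\<rightarrow> - h' / ?Q x0" by (rule Lim_transform_eventually)
    thus ?thesis by (auto simp: has_field_derivative_iff field_differentiable_def)
  qed
  thus ?thesis using S by (simp add: holomorphic_on_open field_differentiable_def)
qed

lemma finite_cubic_roots: "finite {z::complex. z^3 + a2 * z^2 + a1 * z + a0 = 0}"
proof -
  have "finite {z. poly [:a0, a1, a2, 1:] z = 0}" by (rule poly_roots_finite) simp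
  thus ?thesis by (simp add: algebra_simps power2_eq_square power3_eq_cube)
qed

text \<open>
  Off the line \<open>y = 0\<close>, the direction \<open>dy = r y dx\<close> belongs to the web if
  \<open>r^3 + a2 r^2 + a1 r + a0 = 0\<close>, an equation with coefficients depending on
  \<open>x\<close> alone.
\<close>

definition homogeneous_monic :: "cubic \<Rightarrow> point set \<Rightarrow> (complex \<Rightarrow> complex) \<Rightarrow> (complex \<Rightarrow> complex) \<Rightarrow> (complex \<Rightarrow> complex) \<Rightarrow> bool" where
  "homogeneous_monic K V a2 a1 a0 \<longleftrightarrow> (\<forall>x y. (x, y) \<in> V \<longrightarrow> cf3 K (x, y) \<noteq> 0 \<and> cf2 K (x, y) = cf3 K (x, y) * (a2 x * y) \<and>
        cf1 K (x, y) = cf3 K (x, y) * (a1 x * y^2) \<and> cf0 K (x, y) = cf3 K (x, y) * (a0 x * y^3))"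

lemma homogeneous_monicD:
  assumes "homogeneous_monic K V a2 a1 a0" "(x, y) \<in> V"
  shows "cf3 K (x, y) \<noteq> 0 \<and> cf2 K (x, y) = cf3 K (x, y) * (a2 x * y) \<and>
        cf1 K (x, y) = cf3 K (x, y) * (a1 x * y^2) \<and> cf0 K (x, y) = cf3 K (x, y) * (a0 x * y^3)"
  using assms unfolding homogeneous_monic_def by blast

text \<open>
  The foliation with first integral \<open>F\<close> is \<open>dy = r(x) y dx\<close>.
\<close>

definition slope_at where
  "slope_at F Fx Fy r x y \<longleftrightarrow> has_partials F (Fx (x, y)) (Fy (x, y)) (x, y) \<and> Fy (x, y) \<noteq> 0 \<and> Fx (x, y) = - (r x * y * Fy (x, y))"

text \<open>
  The quotient \<open>s = - F\<^sub>x / (y F\<^sub>y)\<close> is a root of a polynomial that depends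
  on \<open>x\<close> only. For fixed \<open>x\<close> it is a continuous function of
  \<open>y\<close> with finitely many values, hence constant.
\<close>

lemma leaf_slope:
  assumes form: "homogeneous_monic K V a2 a1 a0" and V_axis: "\<And>x y. (x, y) \<in> V \<Longrightarrow> y \<noteq> 0"
    and F: "first_integral_on K V F" and nz: "\<And>z a b. z \<in> V \<Longrightarrow> has_partials F a b z \<Longrightarrow> (a, b) \<noteq> (0, 0)"
    and X: "X \<times> ball y0 \<rho> \<subseteq> V" and \<rho>: "\<rho> > 0"
  shows "\<exists>r Fx Fy. continuous_on X r \<and>
    (\<forall>x\<in>X. r x ^ 3 + a2 x * r x ^ 2 + a1 x * r x + a0 x = 0) \<and>
    (\<forall>x\<in>X. \<forall>y\<in>ball y0 \<rho>.
       slope_at F Fx Fy r x y)"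
proof -
  have h: "holo2_on F V" using F by (auto simp: first_integral_on_def)
  obtain Fx Fy where p: "\<And>z. z \<in> V \<Longrightarrow> has_partials F (Fx z) (Fy z) z" "continuous_on V Fx" "continuous_on V Fy"
    using holo2_on_partials_continuous[OF h] by metis
  define s where "s z = - Fx z / (snd z * Fy z)" for z
  have key: "Fy (x, y) \<noteq> 0 \<and> s (x, y) ^ 3 + a2 x * s (x, y) ^ 2 + a1 x * s (x, y) + a0 x = 0" if xy: "(x, y) \<in> V" for x y
  proof -
    note f = homogeneous_monicD[OF form xy] V_axis[OF xy]
    let ?a = "Fx (x, y)" and ?b = "Fy (x, y)"
    have "cubic_form K (x, y) ?b (- ?a) = 0" by (rule first_integral_root[OF F xy p(1)[OF xy] nz[OF xy p(1)[OF xy]]])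
    moreover have "cubic_form K (x, y) ?b (- ?a) = cf3 K (x, y) * (- (?a^3) + a2 x * y * ?a^2 * ?b - a1 x * y^2 * ?a * ?b^2 + a0 x * y^3 * ?b^3)"
      unfolding cubic_form_def using f by (simp add: algebra_simps power2_eq_square power3_eq_cube)
    ultimately have e: "- (?a^3) + a2 x * y * ?a^2 * ?b - a1 x * y^2 * ?a * ?b^2 + a0 x * y^3 * ?b^3 = 0" using f by simp
    have b: "?b \<noteq> 0"
    proof
      assume "?b = 0"
      moreover from this e have "?a = 0" by simp
      ultimately show False using nz[OF xy p(1)[OF xy]] by simp
    qed
    have "?a = - (s (x, y) * y * ?b)" unfolding s_def using b f by simp
    hence "(y * ?b)^3 * (s (x, y) ^ 3 + a2 x * s (x, y) ^ 2 + a1 x * s (x, y) + a0 x) = 0" using e by algebra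
    thus ?thesis using b f by simp
  qed
  have s: "continuous_on V s" unfolding s_def using p(2,3) key V_axis
    by (intro continuous_intros) auto
  define r where "r x = s (x, y0)" for x
  have in_V: "(x, y) \<in> V" if "x \<in> X" "y \<in> ball y0 \<rho>" for x y using X that by auto
  have y0: "y0 \<in> ball y0 \<rho>" using \<rho> by simp
  have const: "s (x, y) = r x" if x: "x \<in> X" and y: "y \<in> ball y0 \<rho>" for x y
  proof -
    have "(\<lambda>y. s (x, y)) constant_on ball y0 \<rho>"
    proof (rule continuous_finite_range_constant)
      show "continuous_on (ball y0 \<rho>) (\<lambda>y. s (x, y))"
        by (rule continuous_on_compose2[OF s]) (use in_V[OF x] in \<open>auto intro!: continuous_intros\<close>)
      show "finite ((\<lambda>y. s (x, y)) ` ball y0 \<rho>)"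
        by (rule finite_subset[OF _ finite_cubic_roots[of "a2 x" "a1 x" "a0 x"]]) (use key in_V[OF x] in auto)
    qed simp
    thus ?thesis using y y0 unfolding constant_on_def r_def by metis
  qed
  have 1: "continuous_on X r" unfolding r_def
    by (rule continuous_on_compose2[OF s]) (use in_V[OF _ y0] in \<open>auto intro!: continuous_intros\<close>)
  have 2: "r x ^ 3 + a2 x * r x ^ 2 + a1 x * r x + a0 x = 0" if "x \<in> X" for x
    using key[OF in_V[OF that y0]] unfolding r_def by blast
  have 3: "slope_at F Fx Fy r x y"
    if xy: "x \<in> X" "y \<in> ball y0 \<rho>" for x y
  proof -
    note v = in_V[OF xy]
    have "Fx (x, y) = - (s (x, y) * y * Fy (x, y))" unfolding s_def using key[OF v] V_axis[OF v] by simp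
    thus ?thesis using key[OF v] p(1)[OF v] const[OF xy] by (simp add: slope_at_def)
  qed
  show ?thesis using 1 2 3 by blast
qed

text \<open>
  The curve \<open>t \<mapsto> (t, y0 exp (w - R x + R t))\<close> is the leaf through \<open>(x, y0
  exp w)\<close>, and \<open>R x0 = 0\<close>.
\<close>

lemma leaf_one_variable:
  assumes p: "\<And>x y. x \<in> X \<Longrightarrow> y \<in> B \<Longrightarrow>
       slope_at F Fx Fy r x y"
    and R: "\<And>x. x \<in> X \<Longrightarrow> (R has_field_derivative r x) (at x)" "R x0 = 0"
    and X: "convex X" "x0 \<in> X" "x \<in> X"
    and B: "\<And>t. t \<in> X \<Longrightarrow> y0 * exp (w - R x + R t) \<in> B"
  shows "F (x, y0 * exp w) = F (x0, y0 * exp (w - R x))"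
proof -
  let ?G = "\<lambda>t. F (t, y0 * exp (w - R x + R t))"
  have "(?G has_field_derivative 0) (at t within X)" if t: "t \<in> X" for t
  proof -
    let ?y = "y0 * exp (w - R x + R t)"
    note q = p[OF t B[OF t], unfolded slope_at_def]
    have "((\<lambda>t. y0 * exp (w - R x + R t)) has_field_derivative ?y * r t) (at t)"
      using R(1)[OF t] by (auto intro!: derivative_eq_intros)
    hence "(?G has_field_derivative Fx (t, ?y) * 1 + Fy (t, ?y) * (?y * r t)) (at t)"
      by (intro has_partials_compose_curve) (use q in auto)
    also have "Fx (t, ?y) * 1 + Fy (t, ?y) * (?y * r t) = 0" using q by (simp add: mult_ac)
    finally show ?thesis by (rule has_field_derivative_at_within)
  qed
  then obtain c where "\<forall>t\<in>X. ?G t = c" using has_field_derivative_zero_constant[OF X(1), of ?G] by blast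
  hence "?G x = ?G x0" using X by metis
  thus ?thesis using R(2) by simp
qed

lemma vieta_cubic:
  fixes r1 r2 r3 :: complex
  assumes "r1 ^ 3 + a2 * r1 ^ 2 + a1 * r1 + a0 = 0" "r2 ^ 3 + a2 * r2 ^ 2 + a1 * r2 + a0 = 0"
    "r3 ^ 3 + a2 * r3 ^ 2 + a1 * r3 + a0 = 0" and d: "r1 \<noteq> r2" "r1 \<noteq> r3" "r2 \<noteq> r3"
  shows "a2 = - (r1 + r2 + r3)" "a1 = r1 * r2 + r1 * r3 + r2 * r3" "a0 = - (r1 * r2 * r3)"
proof -
  have "(r1 - r2) * (r1^2 + r1 * r2 + r2^2 + a2 * (r1 + r2) + a1) = 0"
       "(r1 - r3) * (r1^2 + r1 * r3 + r3^2 + a2 * (r1 + r3) + a1) = 0" using assms(1-3) by algebra+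
  hence e: "r1^2 + r1 * r2 + r2^2 + a2 * (r1 + r2) + a1 = 0" "r1^2 + r1 * r3 + r3^2 + a2 * (r1 + r3) + a1 = 0" using d by auto
  hence "(r2 - r3) * (r1 + r2 + r3 + a2) = 0" by algebra
  hence "r1 + r2 + r3 + a2 = 0" using d by simp
  thus a2: "a2 = - (r1 + r2 + r3)" by algebra
  show a1: "a1 = r1 * r2 + r1 * r3 + r2 * r3" using e(1) unfolding a2 by algebra
  show "a0 = - (r1 * r2 * r3)" using assms(1) unfolding a1 a2 by algebra
qed

definition constant_curvature_slopes where
  "constant_curvature_slopes a2 a1 a0 S r1 r2 r3 b \<longleftrightarrow>
     r1 holomorphic_on S \<and> r2 holomorphic_on S \<and> r3 holomorphic_on S \<and>
     (\<forall>x\<in>S. a2 x = - (r1 x + r2 x + r3 x) \<and> a1 x = r1 x * r2 x + r1 x * r3 x + r2 x * r3 x \<and>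
             a0 x = - (r1 x * r2 x * r3 x) \<and> constant_curvature r1 r2 r3 b x)"

text \<open>
  In the coordinate \<open>w\<close> with \<open>y = y0 exp w\<close>, each first integral is a
  function of one variable evaluated at \<open>w - R\<^sub>i x\<close>, where
  \<open>R\<^sub>i\<close> is a primitive of the slope. So the abelian relation takes the form
  required by \<open>abelian_equation\<close>.
\<close>

lemma curvature_local:
  assumes form: "homogeneous_monic K V a2 a1 a0" and V_axis: "\<And>x y. (x, y) \<in> V \<Longrightarrow> y \<noteq> 0"
    and a: "a2 holomorphic_on S" "a1 holomorphic_on S" "a0 holomorphic_on S" "\<And>x y. (x, y) \<in> V \<Longrightarrow> x \<in> S"
    and ab: "abelian_relation_on K V F1 F2 F3"
    and z: "(x0, y0) \<in> V"
  shows "\<exists>\<rho>>0. \<exists>r1 r2 r3 b. constant_curvature_slopes a2 a1 a0 (ball x0 \<rho>) r1 r2 r3 b"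
proof -
  have F: "first_integral_on K V F1" "first_integral_on K V F2" "first_integral_on K V F3"
     "transverse_on V F1 F2" "transverse_on V F1 F3" "transverse_on V F2 F3" and Fsum: "\<And>z. z \<in> V \<Longrightarrow> F1 z + F2 z + F3 z = 0"
    using ab by (auto simp: abelian_relation_on_def)
  have h: "holo2_on F1 V" "holo2_on F2 V" "holo2_on F3 V" using F(1-3) by (auto simp: first_integral_on_def)
  have V: "open V" using h by (auto simp: holo2_on_def)
  have nz: "(a, b) \<noteq> (0, 0)" if zV: "z \<in> V" and or: "has_partials F1 a b z \<or> has_partials F2 a b z \<or> has_partials F3 a b z" for z a b
  proof -
    obtain c1 d1 c2 d2 c3 d3 where q: "has_partials F1 c1 d1 z" "has_partials F2 c2 d2 z" "has_partials F3 c3 d3 z"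
      using h zV unfolding holo2_on_altdef by meson
    have "c1 * d2 - d1 * c2 \<noteq> 0" "c1 * d3 - d1 * c3 \<noteq> 0"
      using F(4,5) q zV unfolding transverse_on_def by meson+
    moreover have "(a = c1 \<and> b = d1) \<or> (a = c2 \<and> b = d2) \<or> (a = c3 \<and> b = d3)"
      using or q has_partials_unique by meson
    ultimately show ?thesis by auto
  qed
  have nz1: "\<forall>z\<in>V. \<forall>a b. has_partials F1 a b z \<longrightarrow> (a, b) \<noteq> (0, 0)"
   and nz2: "\<forall>z\<in>V. \<forall>a b. has_partials F2 a b z \<longrightarrow> (a, b) \<noteq> (0, 0)"
   and nz3: "\<forall>z\<in>V. \<forall>a b. has_partials F3 a b z \<longrightarrow> (a, b) \<noteq> (0, 0)" using nz by blast+
  obtain A B where AB: "open A" "open B" "(x0, y0) \<in> A \<times> B" "A \<times> B \<subseteq> V" using open_prod_elim[OF V z] by metis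
  obtain \<rho>1 where \<rho>1: "\<rho>1 > 0" "ball x0 \<rho>1 \<subseteq> A" using AB(1,3) openE by (metis mem_Sigma_iff)
  obtain \<rho>2 where \<rho>2: "\<rho>2 > 0" "ball y0 \<rho>2 \<subseteq> B" using AB(2,3) openE by (metis mem_Sigma_iff)
  let ?X = "ball x0 \<rho>1" and ?B = "ball y0 \<rho>2"
  have box: "?X \<times> ?B \<subseteq> V" using \<rho>1 \<rho>2 AB(4) by blast
  have boxD: "(x, y) \<in> V" if "x \<in> ?X" "y \<in> ?B" for x y using box that by auto
  have y0: "y0 \<noteq> 0" "y0 \<in> ?B" using V_axis z \<rho>2(1) by auto
  have x0: "x0 \<in> ?X" using \<rho>1 by simp
  have "?X \<subseteq> S" using a(4)[OF boxD[OF _ y0(2)]] by blast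
  hence aX: "a2 holomorphic_on ?X" "a1 holomorphic_on ?X" "a0 holomorphic_on ?X"
    using a(1-3) by (auto elim!: holomorphic_on_subset)
  have leaf: "\<exists>r Fx Fy. continuous_on ?X r \<and> (\<forall>x\<in>?X. r x ^ 3 + a2 x * r x ^ 2 + a1 x * r x + a0 x = 0) \<and>
      (\<forall>x\<in>?X. \<forall>y\<in>?B. slope_at F Fx Fy r x y)"
    if FI: "first_integral_on K V F" and nzF: "\<forall>z\<in>V. \<forall>a b. has_partials F a b z \<longrightarrow> (a, b) \<noteq> (0, 0)" for F
  proof (rule leaf_slope[OF form V_axis FI _ box \<rho>2(1)])
    show "(a, b) \<noteq> (0, 0)" if "z \<in> V" "has_partials F a b z" for z a b
      using nzF that by metis
  qed
  from leaf[OF F(1) nz1] obtain r1 F1x F1y where "continuous_on ?X r1 \<and> (\<forall>x\<in>?X. r1 x ^ 3 + a2 x * r1 x ^ 2 + a1 x * r1 x + a0 x = 0) \<and>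
      (\<forall>x\<in>?X. \<forall>y\<in>?B. slope_at F1 F1x F1y r1 x y)" by (elim exE)
  hence 1: "continuous_on ?X r1" "\<And>x. x \<in> ?X \<Longrightarrow> r1 x ^ 3 + a2 x * r1 x ^ 2 + a1 x * r1 x + a0 x = 0"
    "\<And>x y. x \<in> ?X \<Longrightarrow> y \<in> ?B \<Longrightarrow> slope_at F1 F1x F1y r1 x y"
    by blast+
  from leaf[OF F(2) nz2] obtain r2 F2x F2y where "continuous_on ?X r2 \<and> (\<forall>x\<in>?X. r2 x ^ 3 + a2 x * r2 x ^ 2 + a1 x * r2 x + a0 x = 0) \<and>
      (\<forall>x\<in>?X. \<forall>y\<in>?B. slope_at F2 F2x F2y r2 x y)" by (elim exE)
  hence 2: "continuous_on ?X r2" "\<And>x. x \<in> ?X \<Longrightarrow> r2 x ^ 3 + a2 x * r2 x ^ 2 + a1 x * r2 x + a0 x = 0"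
    "\<And>x y. x \<in> ?X \<Longrightarrow> y \<in> ?B \<Longrightarrow> slope_at F2 F2x F2y r2 x y"
    by blast+
  from leaf[OF F(3) nz3] obtain r3 F3x F3y where "continuous_on ?X r3 \<and> (\<forall>x\<in>?X. r3 x ^ 3 + a2 x * r3 x ^ 2 + a1 x * r3 x + a0 x = 0) \<and>
      (\<forall>x\<in>?X. \<forall>y\<in>?B. slope_at F3 F3x F3y r3 x y)" by (elim exE)
  hence 3: "continuous_on ?X r3" "\<And>x. x \<in> ?X \<Longrightarrow> r3 x ^ 3 + a2 x * r3 x ^ 2 + a1 x * r3 x + a0 x = 0"
    "\<And>x y. x \<in> ?X \<Longrightarrow> y \<in> ?B \<Longrightarrow> slope_at F3 F3x F3y r3 x y"
    by blast+
  have dist: "r1 x \<noteq> r2 x" "r1 x \<noteq> r3 x" "r2 x \<noteq> r3 x" if x: "x \<in> ?X" for x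
  proof -
    note v = boxD[OF x y0(2)] and q = 1(3)[OF x y0(2), unfolded slope_at_def] 2(3)[OF x y0(2), unfolded slope_at_def]
      3(3)[OF x y0(2), unfolded slope_at_def]
    have "F1x (x, y0) * F2y (x, y0) - F1y (x, y0) * F2x (x, y0) \<noteq> 0"
         "F1x (x, y0) * F3y (x, y0) - F1y (x, y0) * F3x (x, y0) \<noteq> 0"
         "F2x (x, y0) * F3y (x, y0) - F2y (x, y0) * F3x (x, y0) \<noteq> 0"
      using F(4-6) q v unfolding transverse_on_def by meson+
    thus "r1 x \<noteq> r2 x" "r1 x \<noteq> r3 x" "r2 x \<noteq> r3 x" using q by (auto simp: mult_ac)
  qed
  have vieta: "a2 x = - (r1 x + r2 x + r3 x)" "a1 x = r1 x * r2 x + r1 x * r3 x + r2 x * r3 x" "a0 x = - (r1 x * r2 x * r3 x)"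
    if x: "x \<in> ?X" for x using vieta_cubic[OF 1(2)[OF x] 2(2)[OF x] 3(2)[OF x] dist[OF x]] by auto
  have r: "r1 holomorphic_on ?X" "r2 holomorphic_on ?X" "r3 holomorphic_on ?X"
  proof -
    have simple: "3 * s^2 + 2 * a2 x * s + a1 x \<noteq> 0" if x: "x \<in> ?X" and s: "s = r1 x \<or> s = r2 x \<or> s = r3 x" for x s
    proof -
      have "3 * s^2 + 2 * a2 x * s + a1 x = (s - r1 x) * (s - r2 x) + (s - r1 x) * (s - r3 x) + (s - r2 x) * (s - r3 x)"
        unfolding vieta[OF x] by algebra
      thus ?thesis using s dist[OF x] by auto
    qed
    show "r1 holomorphic_on ?X" by (rule simple_root_holomorphic[OF open_ball 1(1) aX 1(2)]) (use simple in auto)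
    show "r2 holomorphic_on ?X" by (rule simple_root_holomorphic[OF open_ball 2(1) aX 2(2)]) (use simple in auto)
    show "r3 holomorphic_on ?X" by (rule simple_root_holomorphic[OF open_ball 3(1) aX 3(2)]) (use simple in auto)
  qed
  have primitive: "\<exists>R. (\<forall>x\<in>?X. (R has_field_derivative g x) (at x)) \<and> R x0 = 0" if "g holomorphic_on ?X" for g
  proof -
    obtain G where G: "\<And>x. x \<in> ?X \<Longrightarrow> (G has_field_derivative g x) (at x within ?X)"
      using holomorphic_convex_primitive'[OF convex_ball open_ball \<open>g holomorphic_on ?X\<close>] by metis
    have "((\<lambda>x. G x - G x0) has_field_derivative g x) (at x)" if "x \<in> ?X" for x
      using G[OF that] that by (auto simp: at_within_open[OF that open_ball] intro!: derivative_eq_intros)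
    thus ?thesis by (intro exI[of _ "\<lambda>x. G x - G x0"]) auto
  qed
  obtain R1 R2 R3 where R: "\<And>x. x \<in> ?X \<Longrightarrow> (R1 has_field_derivative r1 x) (at x)" "R1 x0 = 0"
    "\<And>x. x \<in> ?X \<Longrightarrow> (R2 has_field_derivative r2 x) (at x)" "R2 x0 = 0"
    "\<And>x. x \<in> ?X \<Longrightarrow> (R3 has_field_derivative r3 x) (at x)" "R3 x0 = 0"
    using primitive[OF r(1)] primitive[OF r(2)] primitive[OF r(3)] by metis
  have "isCont (\<lambda>w. y0 * exp w) 0" by (intro continuous_intros)
  then obtain e where e: "e > 0" "\<And>w. w \<in> ball 0 e \<Longrightarrow> y0 * exp w \<in> ?B"
    using \<rho>2(1) unfolding continuous_at_eps_delta by (force simp: dist_commute)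
  have small: "\<exists>\<sigma>>0. \<forall>x\<in>ball x0 \<sigma>. norm (R x) < e / 3" if "(R has_field_derivative g) (at x0)" "R x0 = 0" for R g
  proof -
    have "isCont R x0" using that(1) by (rule DERIV_isCont)
    hence "\<exists>\<sigma>>0. \<forall>x. dist x x0 < \<sigma> \<longrightarrow> dist (R x) (R x0) < e / 3"
    proof -
      have "e / 3 > 0" using e(1) by simp
      thus ?thesis using \<open>isCont R x0\<close> unfolding continuous_at_eps_delta by blast
    qed
    thus ?thesis using that(2) by (auto simp: dist_commute)
  qed
  obtain \<sigma>1 \<sigma>2 \<sigma>3 where \<sigma>: "\<sigma>1 > 0" "\<forall>x\<in>ball x0 \<sigma>1. norm (R1 x) < e / 3" "\<sigma>2 > 0" "\<forall>x\<in>ball x0 \<sigma>2. norm (R2 x) < e / 3"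
     "\<sigma>3 > 0" "\<forall>x\<in>ball x0 \<sigma>3. norm (R3 x) < e / 3"
    using small[OF R(1)[OF x0] R(2)] small[OF R(3)[OF x0] R(4)] small[OF R(5)[OF x0] R(6)] by metis
  \<comment> \<open>The arguments below are sums of three terms; each is kept below \<open>e / 3\<close>.\<close>
  define \<rho> where "\<rho> = Min {\<rho>1, \<sigma>1, \<sigma>2, \<sigma>3, e / 3}"
  have \<rho>: "\<rho> > 0" "\<rho> \<le> \<rho>1" "\<rho> \<le> \<sigma>1" "\<rho> \<le> \<sigma>2" "\<rho> \<le> \<sigma>3" "\<rho> \<le> e / 3"
    unfolding \<rho>_def using \<rho>1(1) \<sigma> e(1) by auto
  let ?Y = "ball x0 \<rho>"
  have YX: "?Y \<subseteq> ?X" using \<rho> by auto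
  have Rsmall: "norm (R1 x) < e / 3" "norm (R2 x) < e / 3" "norm (R3 x) < e / 3" if "x \<in> ?Y" for x
    using that \<sigma> \<rho> by auto
  have sm: "norm (w - u + v) < e" if "norm w < \<rho>" "norm u < e / 3" "norm v < e / 3" for w u v :: complex
    using that \<rho>(6) norm_triangle_ineq[of "w - u" v] norm_triangle_ineq4[of w u] by linarith
  have reduce: "F (x, y0 * exp w) = F (x0, y0 * exp (w - R x))"
    if pF: "\<And>x y. x \<in> ?X \<Longrightarrow> y \<in> ?B \<Longrightarrow> slope_at F Fx Fy s x y"
      and dR: "\<And>x. x \<in> ?X \<Longrightarrow> (R has_field_derivative s x) (at x)" "R x0 = 0"
      and bR: "\<And>x. x \<in> ?Y \<Longrightarrow> norm (R x) < e / 3" and w: "w \<in> ball 0 \<rho>" and x: "x \<in> ?Y" for F Fx Fy R s w x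
  proof (rule leaf_one_variable[of ?Y ?B F Fx Fy s R])
    show "y0 * exp (w - R x + R t) \<in> ?B" if t: "t \<in> ?Y" for t
      by (rule e(2)) (use sm[OF _ bR[OF x] bR[OF t], of w] w in simp)
    show "slope_at F Fx Fy s u y"
      if "u \<in> ?Y" "y \<in> ?B" for u y by (rule pF[OF subsetD[OF YX that(1)] that(2)])
    show "(R has_field_derivative s u) (at u)" if "u \<in> ?Y" for u by (rule dR(1)[OF subsetD[OF YX that]])
  qed (use dR(2) x \<rho>(1) in simp_all)
  define f where "f F w = F (x0, y0 * exp w)" for F :: "point \<Rightarrow> complex" and w
  have f: "f F holomorphic_on ball 0 e" if "holo2_on F V" for F
    unfolding f_def by (rule holo2_on_compose_curve[OF that]) (use e boxD[OF x0] in \<open>auto intro!: holomorphic_intros\<close>)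
  have f': "deriv (f F) w \<noteq> 0" if "w \<in> ball 0 e"
      "\<And>x y. x \<in> ?X \<Longrightarrow> y \<in> ?B \<Longrightarrow> slope_at F Fx Fy s x y"
    for F Fx Fy s w
  proof -
    note q = that(2)[OF x0 e(2)[OF that(1)], unfolded slope_at_def]
    have "(f F has_field_derivative Fx (x0, y0 * exp w) * 0 + Fy (x0, y0 * exp w) * (y0 * exp w)) (at w)"
      unfolding f_def[abs_def]
      by (rule has_partials_compose_curve[of F _ _ "\<lambda>_. x0" w "\<lambda>w. y0 * exp w"]) (use q in \<open>auto intro!: derivative_eq_intros\<close>)
    hence "deriv (f F) w = Fy (x0, y0 * exp w) * (y0 * exp w)" by (simp add: DERIV_imp_deriv)
    thus ?thesis using q y0 by simp
  qed
  have dom: "w - R1 x \<in> ball 0 e \<and> w - R2 x \<in> ball 0 e \<and> w - R3 x \<in> ball 0 e" if "w \<in> ball 0 \<rho>" "x \<in> ?Y" for w x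
    using sm[of w _ 0] Rsmall[OF that(2)] that(1) e(1) by simp
  have sum0: "f F1 (w - R1 x) + f F2 (w - R2 x) + f F3 (w - R3 x) = 0" if w: "w \<in> ball 0 \<rho>" and x: "x \<in> ?Y" for w x
  proof -
    have "f F1 (w - R1 x) = F1 (x, y0 * exp w)" unfolding f_def using reduce[OF 1(3) R(1,2) Rsmall(1) w x] by simp
    moreover have "f F2 (w - R2 x) = F2 (x, y0 * exp w)" unfolding f_def using reduce[OF 2(3) R(3,4) Rsmall(2) w x] by simp
    moreover have "f F3 (w - R3 x) = F3 (x, y0 * exp w)" unfolding f_def using reduce[OF 3(3) R(5,6) Rsmall(3) w x] by simp
    moreover have "w \<in> ball 0 e" using w \<rho>(6) e(1) by auto
    ultimately show ?thesis using Fsum[OF boxD[OF subsetD[OF YX x] e(2)]] by simp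
  qed
  have rY: "r1 holomorphic_on ?Y" "r2 holomorphic_on ?Y" "r3 holomorphic_on ?Y"
    using r YX by (auto elim!: holomorphic_on_subset)
  have distY: "r1 x \<noteq> r2 x \<and> r1 x \<noteq> r3 x \<and> r2 x \<noteq> r3 x" if "x \<in> ?Y" for x using dist[of x] that YX by blast
  have "\<exists>\<sigma> b. \<sigma> > 0 \<and> \<sigma> \<le> \<rho> \<and> (\<forall>x\<in>ball x0 \<sigma>.
     constant_curvature r1 r2 r3 b x)"
  proof (rule abelian_equation[of \<rho> "f F1" e "f F2" "f F3" x0 R1 r1 R2 r2 R3 r3])
    show "deriv (f F1) w \<noteq> 0 \<and> deriv (f F2) w \<noteq> 0" if "w \<in> ball 0 e" for w
      using f'[OF that, of F1 F1x F1y r1] f'[OF that, of F2 F2x F2y r2] 1(3) 2(3) by blast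
  qed (use \<rho>(1) f h R rY subsetD[OF YX] dom sum0 distY in \<open>blast+\<close>)
  then obtain \<sigma> b where sb: "\<sigma> > 0" "\<sigma> \<le> \<rho>" "\<And>x. x \<in> ball x0 \<sigma> \<Longrightarrow>
     constant_curvature r1 r2 r3 b x" by blast
  have s: "ball x0 \<sigma> \<subseteq> ?X" using sb(2) \<rho>(2) by auto
  have "r1 holomorphic_on ball x0 \<sigma>" "r2 holomorphic_on ball x0 \<sigma>" "r3 holomorphic_on ball x0 \<sigma>"
    using r s by (auto elim!: holomorphic_on_subset)
  hence "constant_curvature_slopes a2 a1 a0 (ball x0 \<sigma>) r1 r2 r3 b"
    unfolding constant_curvature_slopes_def using sb(3) vieta[OF subsetD[OF s]] by (intro conjI ballI)
  thus ?thesis using sb(1) by blast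
qed

section \<open>The differential equation of flatness\<close>

text \<open>
  These express \<open>constant_curvature\<close> and the discriminant through the coefficients of
  the cubic whose quadratic term has been removed; \<open>d\<^sub>i\<close> stands for the
  derivative of the root \<open>r\<^sub>i\<close>. In the proof powers of \<open>3\<close> clear the
  denominators.
\<close>

lemma curvature_identities:
  fixes r1 r2 r3 d1 d2 d3 :: complex
  defines "a2 \<equiv> - (r1 + r2 + r3)" and "a1 \<equiv> r1 * r2 + r1 * r3 + r2 * r3" and "a0 \<equiv> - (r1 * r2 * r3)"
    and "e2 \<equiv> - (d1 + d2 + d3)" and "e1 \<equiv> (d1 * r2 + r1 * d2) + (d1 * r3 + r1 * d3) + (d2 * r3 + r2 * d3)"
    and "e0 \<equiv> - (d1 * r2 * r3 + r1 * d2 * r3 + r1 * r2 * d3)"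
  defines "q \<equiv> a1 - a2^2 / 3" and "k \<equiv> a0 - a1 * a2 / 3 + 2 * a2^3 / 27"
    and "q' \<equiv> e1 - 2 * a2 * e2 / 3" and "k' \<equiv> e0 - (e1 * a2 + a1 * e2) / 3 + 2 * a2^2 * e2 / 9"
  shows "3 * (2 * q * k' - 3 * k * q') =
     - (((d2 - d3) * (r3 - r1) - (r2 - r3) * (d3 - d1)) * ((r2 - r3) * (r3 - r1) * (r1 - r2)))" (is ?A)
    and "4 * q^3 + 27 * k^2 = - (((r2 - r3) * (r3 - r1) * (r1 - r2))^2)" (is ?B)
proof -
  have q: "3 * q = 3 * a1 - a2^2" and k: "27 * k = 27 * a0 - 9 * a1 * a2 + 2 * a2^3"
   and q': "3 * q' = 3 * e1 - 2 * a2 * e2" and k': "9 * k' = 9 * e0 - 3 * (e1 * a2 + a1 * e2) + 2 * a2^2 * e2"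
    by (simp_all add: q_def k_def q'_def k'_def field_simps)
  have c27: "u = v" if "27 * u = 27 * v" for u v :: complex using that by simp
  have "27 * (3 * (2 * q * k' - 3 * k * q')) = 6 * (3 * q) * (9 * k') - 3 * (27 * k) * (3 * q')" by algebra
  also have "\<dots> = 27 * - (((d2 - d3) * (r3 - r1) - (r2 - r3) * (d3 - d1)) * ((r2 - r3) * (r3 - r1) * (r1 - r2)))"
    unfolding q k q' k' a2_def a1_def a0_def e2_def e1_def e0_def by algebra
  finally show ?A by (rule c27)
  have "27 * (4 * q^3 + 27 * k^2) = 4 * (3 * q)^3 + (27 * k)^2" by algebra
  also have "\<dots> = 27 * - (((r2 - r3) * (r3 - r1) * (r1 - r2))^2)"
    unfolding q k a2_def a1_def a0_def by algebra
  finally show ?B by (rule c27)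
qed

definition depressed_q where "depressed_q a2 a1 = (\<lambda>x::complex. a1 x - a2 x ^ 2 / (3::complex))"
definition depressed_k where "depressed_k a2 a1 a0 = (\<lambda>x::complex. a0 x - a1 x * a2 x / 3 + 2 * a2 x ^ 3 / (27::complex))"

lemma depressed_deriv:
  assumes "(a2 has_field_derivative e2) (at x)" "(a1 has_field_derivative e1) (at x)" "(a0 has_field_derivative e0) (at x)"
  shows "(depressed_q a2 a1 has_field_derivative e1 - 2 * a2 x * e2 / 3) (at x)"
    "(depressed_k a2 a1 a0 has_field_derivative e0 - (e1 * a2 x + a1 x * e2) / 3 + 2 * a2 x^2 * e2 / 9) (at x)"
proof -
  show "(depressed_q a2 a1 has_field_derivative e1 - 2 * a2 x * e2 / 3) (at x)"
    unfolding depressed_q_def using assms by (auto intro!: derivative_eq_intros)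
  show "(depressed_k a2 a1 a0 has_field_derivative e0 - (e1 * a2 x + a1 x * e2) / 3 + 2 * a2 x^2 * e2 / 9) (at x)"
    unfolding depressed_k_def using assms by (auto intro!: derivative_eq_intros simp: field_simps)
qed

lemma discr_depressed:
  assumes "cf2 K z = cf3 K z * (a2 x * y)" "cf1 K z = cf3 K z * (a1 x * y^2)" "cf0 K z = cf3 K z * (a0 x * y^3)"
  shows "discr K z = - (cf3 K z ^ 4 * y^6 * (4 * depressed_q a2 a1 x ^ 3 + 27 * depressed_k a2 a1 a0 x ^ 2))"
proof -
  let ?q = "depressed_q a2 a1 x" and ?k = "depressed_k a2 a1 a0 x"
  have q: "3 * ?q = 3 * a1 x - a2 x^2" and k: "27 * ?k = 27 * a0 x - 9 * a1 x * a2 x + 2 * a2 x^3"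
    by (simp_all add: depressed_q_def depressed_k_def)
  have "27 * discr K z = - (cf3 K z ^ 4 * y^6 * (4 * (3 * ?q)^3 + (27 * ?k)^2))"
    unfolding discr_def Let_def assms q k by algebra
  also have "\<dots> = 27 * (- (cf3 K z ^ 4 * y^6 * (4 * ?q ^ 3 + 27 * ?k ^ 2)))" by algebra
  finally show ?thesis by simp
qed

text \<open>
  Near every point off the origin the quotient \<open>h\<close> of the two sides is a constant,
  \<open>- b / 3\<close>. The punctured disc is connected, so the constant is the same everywhere.
\<close>

lemma flat_ode:
  fixes a2 a1 a0 :: "complex \<Rightarrow> complex"
  defines "q \<equiv> depressed_q a2 a1" and "k \<equiv> depressed_k a2 a1 a0"
  assumes K: "cubic_equation K" and r: "r > 0"
    and a: "a2 holomorphic_on ball 0 r" "a1 holomorphic_on ball 0 r" "a0 holomorphic_on ball 0 r"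
    and form: "homogeneous_monic K (bidisc r) a2 a1 a0"
    and ab: "locally_abelian_on K (bidisc r)"
  shows "\<exists>\<rho> C. \<rho> > 0 \<and> \<rho> \<le> r \<and> (\<forall>x\<in>ball 0 \<rho> - {0}. 4 * q x ^ 3 + 27 * k x ^ 2 \<noteq> 0 \<and>
      2 * q x * deriv k x - 3 * k x * deriv q x = C * (4 * q x ^ 3 + 27 * k x ^ 2))"
proof -
  define E where "E x = 4 * q x ^ 3 + 27 * k x ^ 2" for x
  have discr: "discr K (x, y) = - (cf3 K (x, y) ^ 4 * y^6 * E x)" if "(x, y) \<in> bidisc r" for x y
    unfolding E_def q_def k_def using homogeneous_monicD[OF form that] by (intro discr_depressed) auto
  have hol: "q holomorphic_on ball 0 r" "k holomorphic_on ball 0 r"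
    unfolding q_def k_def depressed_q_def depressed_k_def using a by (auto intro!: holomorphic_intros)
  have hE: "E holomorphic_on ball 0 r" unfolding E_def using hol by (auto intro!: holomorphic_intros)
  obtain z where z: "z \<in> bidisc r" "discr K z \<noteq> 0" by (rule cubic_equation_nonzero_discr[OF K r])
  hence z1: "fst z \<in> ball 0 r" "E (fst z) \<noteq> 0" using discr[of "fst z" "snd z"] by (cases z; auto)+
  obtain \<rho> where \<rho>: "\<rho> > 0" "ball (0::complex) \<rho> \<subseteq> ball 0 r" "\<And>x. x \<in> ball 0 \<rho> - {0} \<Longrightarrow> E x \<noteq> 0"
  proof (cases "E 0 = 0")
    case True
    have "0 \<in> ball (0::complex) r" using r by simp
    note iz = isolated_zeros[OF hE open_ball connected_ball this True z1]
    show ?thesis by (rule iz, rule that)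
  next
    case False
    have "continuous_on (ball 0 r) E" using hE by (rule holomorphic_on_imp_continuous_on)
    hence "open (E -` (- {0}) \<inter> ball 0 r)" by (subst Int_commute, intro continuous_open_preimage) auto
    moreover have "0 \<in> E -` (- {0}) \<inter> ball 0 r" using False r by simp
    ultimately obtain \<rho> where "\<rho> > 0" "ball 0 \<rho> \<subseteq> E -` (- {0}) \<inter> ball 0 r" using openE by blast
    thus ?thesis by (intro that[of \<rho>]) auto
  qed
  let ?S = "ball 0 \<rho> - {0 :: complex}"
  have \<rho>r: "\<rho> \<le> r" using \<rho>(1,2) by (simp add: ball_subset_ball_iff)
  define h where "h x = (2 * q x * deriv k x - 3 * k x * deriv q x) / E x" for x
  have hh: "h holomorphic_on ?S" unfolding h_def using hol hE \<rho>
    by (intro holomorphic_intros holomorphic_deriv) (auto elim!: holomorphic_on_subset)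
  have oS: "open ?S" by (auto intro: open_delete)
  have der: "(h has_field_derivative 0) (at x0)" if x0: "x0 \<in> ?S" for x0
  proof -
    define y0 :: complex where "y0 = of_real (r / 2)"
    have y0: "y0 \<in> ball 0 r" "y0 \<noteq> 0" using r by (auto simp: y0_def)
    have z0: "(x0, y0) \<in> bidisc r" using y0 x0 \<rho>(2) by auto
    have "discr K (x0, y0) \<noteq> 0" using discr[OF z0] homogeneous_monicD[OF form z0] y0(2) \<rho>(3)[OF x0] by simp
    hence "(x0, y0) \<in> bidisc r - discr_curve K" using z0 by (simp add: discr_curve_def)
    from ab this obtain V F1 F2 F3 where V: "(x0, y0) \<in> V" "V \<subseteq> bidisc r - discr_curve K" "abelian_relation_on K V F1 F2 F3"
      by (rule locally_abelian_onE)
    have VE: "y \<noteq> 0" if "(x, y) \<in> V" for x y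
    proof -
      have v: "(x, y) \<in> bidisc r" "discr K (x, y) \<noteq> 0" using that V(2) by (auto simp: discr_curve_def)
      thus ?thesis using discr[OF v(1)] by auto
    qed
    have fV: "homogeneous_monic K V a2 a1 a0"
      using form V(2) unfolding homogeneous_monic_def by blast
    have "\<exists>\<sigma>>0. \<exists>r1 r2 r3 b. constant_curvature_slopes a2 a1 a0 (ball x0 \<sigma>) r1 r2 r3 b"
    proof (rule curvature_local[of K V a2 a1 a0 "ball 0 r"])
      show "x \<in> ball 0 r" if "(x, y) \<in> V" for x y using subsetD[OF V(2) that] by simp
    qed (use VE fV a V in auto)
    then obtain \<sigma> r1 r2 r3 b where "\<sigma> > 0" "constant_curvature_slopes a2 a1 a0 (ball x0 \<sigma>) r1 r2 r3 b"
      by blast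
    hence s: "\<sigma> > 0" "r1 holomorphic_on ball x0 \<sigma>" "r2 holomorphic_on ball x0 \<sigma>" "r3 holomorphic_on ball x0 \<sigma>"
      and v: "\<And>x. x \<in> ball x0 \<sigma> \<Longrightarrow>
       a2 x = - (r1 x + r2 x + r3 x) \<and> a1 x = r1 x * r2 x + r1 x * r3 x + r2 x * r3 x \<and> a0 x = - (r1 x * r2 x * r3 x)"
      and W: "\<And>x. x \<in> ball x0 \<sigma> \<Longrightarrow> constant_curvature r1 r2 r3 b x"
      unfolding constant_curvature_slopes_def by blast+
    have "h x = - b / 3" if x: "x \<in> ball x0 \<sigma> \<inter> ?S" for x
    proof -
      have xs: "x \<in> ball x0 \<sigma>" using x by simp
      let ?d1 = "deriv r1 x" and ?d2 = "deriv r2 x" and ?d3 = "deriv r3 x"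
      have d: "(r1 has_field_derivative ?d1) (at x)" "(r2 has_field_derivative ?d2) (at x)" "(r3 has_field_derivative ?d3) (at x)"
        using s xs holomorphic_derivI open_ball by blast+
      let ?e2 = "- (?d1 + ?d2 + ?d3)"
      let ?e1 = "(?d1 * r2 x + r1 x * ?d2) + (?d1 * r3 x + r1 x * ?d3) + (?d2 * r3 x + r2 x * ?d3)"
      let ?e0 = "- (?d1 * r2 x * r3 x + r1 x * ?d2 * r3 x + r1 x * r2 x * ?d3)"
      have d2: "(a2 has_field_derivative ?e2) (at x)"
        by (rule has_field_derivative_transform_within_open[of "\<lambda>x. - (r1 x + r2 x + r3 x)", OF _ open_ball xs])
           (use d v in \<open>auto intro!: derivative_eq_intros\<close>)
      have d1: "(a1 has_field_derivative ?e1) (at x)"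
        by (rule has_field_derivative_transform_within_open[of "\<lambda>x. r1 x * r2 x + r1 x * r3 x + r2 x * r3 x", OF _ open_ball xs])
           (use d v in \<open>auto intro!: derivative_eq_intros\<close>)
      have d0: "(a0 has_field_derivative ?e0) (at x)"
        by (rule has_field_derivative_transform_within_open[of "\<lambda>x. - (r1 x * r2 x * r3 x)", OF _ open_ball xs])
           (use d v in \<open>auto intro!: derivative_eq_intros simp: algebra_simps\<close>)
      have "(q has_field_derivative ?e1 - 2 * a2 x * ?e2 / 3) (at x)"
        unfolding q_def by (rule depressed_deriv(1)[OF d2 d1 d0])
      hence dq: "deriv q x = ?e1 - 2 * a2 x * ?e2 / 3" by (rule DERIV_imp_deriv)
      have "(k has_field_derivative ?e0 - (?e1 * a2 x + a1 x * ?e2) / 3 + 2 * a2 x^2 * ?e2 / 9) (at x)"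
        unfolding k_def by (rule depressed_deriv(2)[OF d2 d1 d0])
      hence dk: "deriv k x = ?e0 - (?e1 * a2 x + a1 x * ?e2) / 3 + 2 * a2 x^2 * ?e2 / 9" by (rule DERIV_imp_deriv)
      have vq: "q x = a1 x - a2 x^2 / 3" and vk: "k x = a0 x - a1 x * a2 x / 3 + 2 * a2 x^3 / 27"
        unfolding q_def depressed_q_def k_def depressed_k_def by auto
      let ?P = "(r2 x - r3 x) * (r3 x - r1 x) * (r1 x - r2 x)"
      have 1: "3 * (2 * q x * deriv k x - 3 * k x * deriv q x) = - ((- b * ?P) * ?P)"
        unfolding W[OF xs, unfolded constant_curvature_def, symmetric] vq vk dq dk using v[OF xs] by (simp only: curvature_identities(1))
      have 2: "E x = - (?P^2)"
        unfolding E_def vq vk using v[OF xs] by (simp only: curvature_identities(2))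
      have "E x \<noteq> 0" using x \<rho>(3) by blast
      have "3 * (2 * q x * deriv k x - 3 * k x * deriv q x) = - b * E x" unfolding 1 2 by (simp add: power2_eq_square)
      thus ?thesis unfolding h_def using \<open>E x \<noteq> 0\<close> by (simp add: field_simps)
    qed
    hence hc: "\<And>x. x \<in> ball x0 \<sigma> \<inter> ?S \<Longrightarrow> - b / 3 = h x" by simp
    have o: "open (ball x0 \<sigma> \<inter> ?S)" "x0 \<in> ball x0 \<sigma> \<inter> ?S" using oS x0 s(1) by auto
    show ?thesis by (rule has_field_derivative_transform_within_open[OF DERIV_const[of "- b / 3"] o hc])
  qed
  have conn: "connected ?S" by (intro connected_open_delete) auto
  obtain C where C: "\<And>x. x \<in> ?S \<Longrightarrow> h x = C"
    using DERIV_zero_connected_constant[OF conn oS finite.emptyI holomorphic_on_imp_continuous_on[OF hh]] der by auto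
  have "E x \<noteq> 0 \<and> 2 * q x * deriv k x - 3 * k x * deriv q x = C * E x" if "x \<in> ?S" for x
    using C[OF that] \<rho>(3)[OF that] unfolding h_def by (auto simp: field_simps)
  thus ?thesis using \<rho>(1) \<rho>r unfolding E_def by blast
qed

section \<open>Normalization of the independent variable\<close>

text \<open>
  The power series of a solution has the coefficients of \<open>w\<close> divided by \<open>n +
  c\<close>. As \<open>c \<ge> 1\<close>, these divisors have absolute value at least
  \<open>1\<close> and the radius of convergence does not decrease.
\<close>

lemma singular_linear_ode:
  assumes w: "w analytic_on {0}" and c: "c \<ge> (1::real)"
  shows "\<exists>H. H analytic_on {0} \<and> (\<forall>\<^sub>F x in nhds 0. x * deriv H x + of_real c * H x = (w x :: complex))"
proof -
  define W where "W = fps_expansion w 0"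
  have W: "w has_fps_expansion W" unfolding W_def by (rule analytic_at_imp_has_fps_expansion_0[OF w])
  define F where "F = Abs_fps (\<lambda>n. fps_nth W n / (of_nat n + of_real c))"
  have nz: "norm (of_nat n + complex_of_real c) \<ge> 1" for n
  proof -
    have "of_nat n + complex_of_real c = of_real (real n + c)" by simp
    hence "norm (of_nat n + complex_of_real c) = real n + c" using c by (simp only: norm_of_real)
    thus ?thesis using c by simp
  qed
  hence nz0: "of_nat n + complex_of_real c \<noteq> 0" for n by (metis norm_zero not_one_le_zero)
  have rad: "fps_conv_radius F \<ge> fps_conv_radius W" unfolding fps_conv_radius_def
  proof (rule conv_radius_geI_ex)
    fix r :: real assume r: "r > 0" "ereal r < conv_radius (fps_nth W)"
    have "summable (\<lambda>n. norm (fps_nth W n * of_real r ^ n))"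
      by (rule abs_summable_in_conv_radius) (use r in auto)
    hence "summable (\<lambda>n. fps_nth F n * of_real r ^ n)"
    proof (rule summable_comparison_test'[where N = 0])
      fix n
      show "norm (fps_nth F n * of_real r ^ n) \<le> norm (fps_nth W n * of_real r ^ n)"
        using mult_left_mono[OF nz[of n], of "norm (fps_nth W n) * norm (complex_of_real r ^ n)"] nz0[of n]
        by (simp add: F_def norm_mult norm_divide divide_le_eq)
    qed
    thus "\<exists>z. norm z = r \<and> summable (\<lambda>n. fps_nth F n * z ^ n)" using r(1) by (intro exI[of _ "of_real r"]) auto
  qed
  have "fps_conv_radius W > 0" using W by (simp add: has_fps_expansion_def)
  hence "fps_conv_radius F > 0" using rad by (rule less_le_trans)
  hence H: "eval_fps F has_fps_expansion F" by (simp add: has_fps_expansion_def)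
  have "(\<lambda>x. x * deriv (eval_fps F) x + of_real c * eval_fps F x) has_fps_expansion (fps_X * fps_deriv F + fps_const (of_real c) * F)"
    by (intro fps_expansion_intros H)
  also have "fps_X * fps_deriv F + fps_const (of_real c) * F = W"
  proof (rule fps_ext)
    fix n
    have "fps_nth (fps_X * fps_deriv F + fps_const (of_real c) * F) n = (of_nat n + of_real c) * fps_nth F n"
      by (cases n) (simp_all add: algebra_simps)
    thus "fps_nth (fps_X * fps_deriv F + fps_const (of_real c) * F) n = fps_nth W n"
      using nz0[of n] by (simp add: F_def)
  qed
  finally have "\<forall>\<^sub>F x in nhds 0. eval_fps W x = x * deriv (eval_fps F) x + of_real c * eval_fps F x"
    by (simp add: has_fps_expansion_def)
  moreover have "\<forall>\<^sub>F x in nhds 0. eval_fps W x = w x" using W by (simp add: has_fps_expansion_def)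
  ultimately have "\<forall>\<^sub>F x in nhds 0. x * deriv (eval_fps F) x + of_real c * eval_fps F x = w x"
    by eventually_elim simp
  thus ?thesis using has_fps_expansion_imp_analytic_0[OF H] by blast
qed

lemma zero_order_factorization:
  assumes h: "h holomorphic_on ball 0 r" "r > 0" and nz: "x1 \<in> ball 0 r" "h x1 \<noteq> (0::complex)"
  shows "\<exists>N u s. s > 0 \<and> s \<le> r \<and> u holomorphic_on ball 0 s \<and> (\<forall>x\<in>ball 0 s. h x = x^N * u x \<and> u x \<noteq> 0)"
proof (cases "h 0 = 0")
  case True
  have "\<not> h constant_on ball 0 r" using True nz h(2) by (force simp: constant_on_def)
  moreover have "0 \<in> ball (0::complex) r" using h(2) by simp
  ultimately obtain g s n where "0 < n" "0 < s" "ball (0::complex) s \<subseteq> ball 0 r"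
            "g holomorphic_on ball 0 s"
            "\<And>w. w \<in> ball 0 s \<Longrightarrow> h w = (w - 0)^n * g w"
            "\<And>w. w \<in> ball 0 s \<Longrightarrow> g w \<noteq> 0"
    using holomorphic_factor_zero_nonconstant[OF h(1) open_ball connected_ball _ True] by metis
  thus ?thesis by (intro exI[of _ n] exI[of _ g] exI[of _ s]) (auto simp: ball_subset_ball_iff)
next
  case False
  have "continuous_on (ball 0 r) h" using h(1) by (rule holomorphic_on_imp_continuous_on)
  hence "open (ball 0 r \<inter> h -` (- {0}))" by (intro continuous_open_preimage) auto
  moreover have "0 \<in> ball 0 r \<inter> h -` (- {0})" using False h(2) by simp
  ultimately obtain s where s: "s > 0" "ball 0 s \<subseteq> ball 0 r \<inter> h -` (- {0})" using openE by blast
  have "ball (0::complex) s \<subseteq> ball 0 r" using s(2) by blast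
  hence "s \<le> r" using s(1) by (simp add: ball_subset_ball_iff)
  thus ?thesis using s h(1) by (intro exI[of _ 0] exI[of _ h] exI[of _ s]) (auto elim!: holomorphic_on_subset)
qed

lemma eventually_nhds_ball:
  assumes "\<forall>\<^sub>F x in nhds (0::complex). P x"
  obtains s where "s > 0" "\<And>x. x \<in> ball 0 s \<Longrightarrow> P x"
proof -
  obtain S where S: "open S" "0 \<in> S" "\<forall>x\<in>S. P x" using assms by (auto simp: eventually_nhds)
  then obtain s where "s > 0" "ball 0 s \<subseteq> S" using openE by blast
  thus ?thesis using S(3) that[of s] by blast
qed

text \<open>
  With \<open>h = x^N w^m\<close> the equation is \<open>f^(N/m) f' = x^(N/m) w\<close>, up to roots
  of unity. For \<open>c = N/m + 1\<close> and \<open>f = x (c H)^(1/c)\<close>, integrating it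
  amounts to \<open>x H' + c H = w\<close>, where no fractional power of \<open>x\<close> occurs and
  \<open>singular_linear_ode\<close> applies.
\<close>

lemma normalizing_coordinate:
  assumes h: "h holomorphic_on ball 0 r" "r > 0" and nz: "x1 \<in> ball 0 r" "h x1 \<noteq> (0::complex)" and m: "m > (0::nat)"
  shows "\<exists>N f s. s > 0 \<and> s \<le> r \<and> f holomorphic_on ball 0 s \<and> inj_on f (ball 0 s) \<and> f 0 = 0 \<and>
    (\<forall>x\<in>ball 0 s. deriv f x \<noteq> 0 \<and> f x ^ N * deriv f x ^ m = h x)"
proof -
  obtain N u r1 where u: "r1 > 0" "r1 \<le> r" "u holomorphic_on ball 0 r1" "\<And>x. x \<in> ball 0 r1 \<Longrightarrow> h x = x^N * u x \<and> u x \<noteq> 0"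
    using zero_order_factorization[OF h nz] by blast
  obtain l where l: "l holomorphic_on ball 0 r1" "\<And>x. x \<in> ball 0 r1 \<Longrightarrow> exp (l x) = u x"
    using holomorphic_logarithm_exists[OF convex_ball open_ball u(3), of 0] u(1,4) by (metis centre_in_ball)
  define w where "w x = exp (l x / of_nat m)" for x
  have wm: "w x ^ m = u x" if "x \<in> ball 0 r1" for x
    using l(2)[OF that] m unfolding w_def by (simp flip: exp_of_nat_mult)
  have w: "w holomorphic_on ball 0 r1" unfolding w_def using l(1) m by (intro holomorphic_intros) auto
  have wan: "w analytic_on {0}" using w u(1) by (auto simp: analytic_at intro!: exI[of _ "ball 0 r1"])
  define c where "c = real N / real m + 1"
  have c: "c \<ge> 1" by (simp add: c_def)
  obtain H where H: "H analytic_on {0}" "\<forall>\<^sub>F x in nhds 0. x * deriv H x + of_real c * H x = w x"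
    using singular_linear_ode[OF wan c] by blast
  obtain S where S: "open S" "0 \<in> S" "H holomorphic_on S" using H(1) by (auto simp: analytic_at)
  obtain r2 where r2: "r2 > 0" "\<And>x. x \<in> ball 0 r2 \<Longrightarrow> x * deriv H x + of_real c * H x = w x"
    using eventually_nhds_ball[OF H(2)] by blast
  have "H 0 \<noteq> 0" using r2(2)[of 0] r2(1) by (auto simp: w_def)
  have "continuous_on S H" using S(3) by (rule holomorphic_on_imp_continuous_on)
  hence "open (S \<inter> H -` (- {0}))" using S(1) by (intro continuous_open_preimage) auto
  moreover have "0 \<in> S \<inter> H -` (- {0})" using S(2) \<open>H 0 \<noteq> 0\<close> by simp
  ultimately obtain r3 where r3: "r3 > 0" "ball 0 r3 \<subseteq> S \<inter> H -` (- {0})" using openE by blast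
  define s where "s = min r1 (min r2 r3)"
  have s: "s > 0" "s \<le> r1" "s \<le> r2" "s \<le> r3" using u(1) r2(1) r3(1) by (auto simp: s_def)
  let ?B = "ball (0::complex) s"
  have B: "x \<in> ball 0 r1" "x \<in> ball 0 r2" "x \<in> S" "H x \<noteq> 0" if "x \<in> ?B" for x
    using that s subsetD[OF r3(2), of x] by auto
  have HB: "H holomorphic_on ?B" using S(3) B(3) by (auto elim!: holomorphic_on_subset)
  obtain v where v: "v holomorphic_on ?B" "\<And>x. x \<in> ?B \<Longrightarrow> exp (v x) = of_real c * H x"
  proof (rule holomorphic_logarithm_exists[of ?B "\<lambda>x. of_real c * H x" 0])
    show "of_real c * H x \<noteq> 0" if "x \<in> ?B" for x using B(4)[OF that] c by simp
  qed (use HB s(1) in \<open>auto intro!: holomorphic_intros\<close>)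
  define f where "f x = x * exp (v x / of_real c)" for x
  have fhol: "f holomorphic_on ?B" unfolding f_def using v(1) c by (intro holomorphic_intros) auto
  have df: "deriv f x = exp (v x / of_real c) * (1 + x * deriv v x / of_real c)" if x: "x \<in> ?B" for x
  proof (rule DERIV_imp_deriv)
    have "(v has_field_derivative deriv v x) (at x)" using v(1) x holomorphic_derivI open_ball by blast
    thus "(f has_field_derivative exp (v x / of_real c) * (1 + x * deriv v x / of_real c)) (at x)"
      unfolding f_def using c by (auto intro!: derivative_eq_intros simp: field_simps)
  qed
  have key: "f x ^ N * deriv f x ^ m = h x" if x: "x \<in> ?B" for x
  proof -
    have dv: "(v has_field_derivative deriv v x) (at x)" using v(1) x holomorphic_derivI open_ball by blast
    have dH: "(H has_field_derivative deriv H x) (at x)" using HB x holomorphic_derivI open_ball by blast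
    have "((\<lambda>x. exp (v x) - of_real c * H x) has_field_derivative exp (v x) * deriv v x - of_real c * deriv H x) (at x)"
      using dv dH by (auto intro!: derivative_eq_intros)
    hence "exp (v x) * deriv v x - of_real c * deriv H x = 0"
      by (rule DERIV_const_on_open_eq_0[OF _ open_ball x, of _ _ 0]) (use v(2) in simp)
    hence e1: "exp (v x) * deriv v x = of_real c * deriv H x" by simp
    have c0: "complex_of_real c \<noteq> 0" using c by simp
    have "exp (v x) * (1 + x * deriv v x / of_real c) = exp (v x) + x * (exp (v x) * deriv v x) / of_real c" by (simp add: algebra_simps)
    also have "\<dots> = of_real c * H x + x * deriv H x" using c by (simp only: e1) (simp add: v(2)[OF x])
    also have "\<dots> = w x" using r2(2)[OF B(2)[OF x]] by (simp add: add.commute)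
    finally have e2: "exp (v x) * (1 + x * deriv v x / of_real c) = w x" .
    have "of_nat N + of_nat m = of_nat m * complex_of_real c" using m by (simp add: c_def field_simps)
    hence "(of_nat N + of_nat m) * (v x / of_real c) = of_nat m * v x" using c0 by (simp add: field_simps)
    hence e3: "exp (v x / of_real c) ^ (N + m) = exp (v x) ^ m"
      by (simp flip: exp_of_nat_mult)
    have "f x ^ N * deriv f x ^ m = x^N * exp (v x / of_real c) ^ (N + m) * (1 + x * deriv v x / of_real c)^m"
      unfolding df[OF x] f_def by (simp add: power_mult_distrib power_add)
    also have "\<dots> = x^N * (exp (v x) * (1 + x * deriv v x / of_real c))^m" unfolding e3 by (simp add: power_mult_distrib)
    also have "\<dots> = h x" unfolding e2 using wm[OF B(1)[OF x]] u(4)[OF B(1)[OF x]] by simp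
    finally show ?thesis .
  qed
  have z: "0 \<in> ?B" using s(1) by simp
  have "deriv f 0 \<noteq> 0" using df[OF z] by simp
  then obtain t where t: "t > 0" "ball 0 t \<subseteq> ?B" "inj_on f (ball 0 t)"
    using has_complex_derivative_locally_injective[OF fhol z open_ball] by metis
  have tf: "f holomorphic_on ball 0 t" using fhol t(2) by (rule holomorphic_on_subset)
  have "deriv f x \<noteq> 0" if "x \<in> ball 0 t" for x
    by (rule holomorphic_injective_imp_regular[OF tf open_ball t(3) that])
  moreover have "t \<le> r" using t(1,2) s(2) u(2) by (simp add: ball_subset_ball_iff)
  ultimately show ?thesis using t tf key by (intro exI[of _ N] exI[of _ f] exI[of _ t]) (auto simp: f_def)
qed

section \<open>Integration by the tangent\<close>

text \<open>
  Substituting \<open>q = f^N f'^2\<close> and \<open>k = \<kappa>(f) f'^3\<close>, the terms with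
  \<open>f''\<close> cancel and both sides acquire the factor \<open>f'^6\<close>.
\<close>

lemma ode_change_of_coordinate:
  assumes q: "(q has_field_derivative q') (at x)" "(k has_field_derivative k') (at x)"
    and f: "(f has_field_derivative f1) (at x)" "(f1' has_field_derivative f2) (at x)" "f1' x = f1" "f1 \<noteq> 0"
    and g: "(\<kappa> has_field_derivative \<kappa>') (at (f x))"
    and S: "open S" "x \<in> S"
    and eq: "\<And>x. x \<in> S \<Longrightarrow> q x = f x ^ N * f1' x ^ 2" "\<And>x. x \<in> S \<Longrightarrow> k x = \<kappa> (f x) * f1' x ^ 3"
    and ode: "2 * q x * k' - 3 * k x * q' = C * (4 * q x ^ 3 + 27 * k x ^ 2)" "4 * q x ^ 3 + 27 * k x ^ 2 \<noteq> (0 :: complex)"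
  shows "2 * f x ^ N * \<kappa>' - 3 * of_nat N * f x ^ (N - 1) * \<kappa> (f x) = C * (4 * f x ^ (3 * N) + 27 * \<kappa> (f x) ^ 2)"
    "4 * f x ^ (3 * N) + 27 * \<kappa> (f x) ^ 2 \<noteq> 0"
proof -
  have dk: "k' = \<kappa>' * f1 * f1^3 + \<kappa> (f x) * (3 * f1^2 * f2)"
  proof -
    have "((\<lambda>x. \<kappa> (f x)) has_field_derivative \<kappa>' * f1) (at x)" by (rule DERIV_chain2[OF g f(1)])
    hence "((\<lambda>x. \<kappa> (f x) * f1' x ^ 3 - k x) has_field_derivative \<kappa>' * f1 * f1^3 + \<kappa> (f x) * (3 * f1^2 * f2) - k') (at x)"
      using f(2) q(2) f(3) by (auto intro!: derivative_eq_intros)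
    hence "\<kappa>' * f1 * f1^3 + \<kappa> (f x) * (3 * f1^2 * f2) - k' = 0"
      by (rule DERIV_const_on_open_eq_0[OF _ S, of _ _ 0]) (use eq(2) in simp)
    thus ?thesis by simp
  qed
  have dq: "q' = of_nat N * f x ^ (N - 1) * f1 * f1^2 + f x ^ N * (2 * f1 * f2)"
  proof -
    have "((\<lambda>x. f x ^ N * f1' x ^ 2 - q x) has_field_derivative of_nat N * f x ^ (N - 1) * f1 * f1^2 + f x ^ N * (2 * f1 * f2) - q') (at x)"
      using f(1,2) q(1) f(3) by (auto intro!: derivative_eq_intros)
    hence "of_nat N * f x ^ (N - 1) * f1 * f1^2 + f x ^ N * (2 * f1 * f2) - q' = 0"
      by (rule DERIV_const_on_open_eq_0[OF _ S, of _ _ 0]) (use eq(1) in simp)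
    thus ?thesis by simp
  qed
  have qx: "q x = f x ^ N * f1^2" "k x = \<kappa> (f x) * f1^3" using eq[OF S(2)] f(3) by auto
  have p: "f x ^ (3 * N) = (f x ^ N)^3" by (simp add: mult.commute flip: power_mult)
  have E: "4 * q x ^ 3 + 27 * k x ^ 2 = f1^6 * (4 * f x ^ (3 * N) + 27 * \<kappa> (f x) ^ 2)"
    unfolding qx p by algebra
  show "4 * f x ^ (3 * N) + 27 * \<kappa> (f x) ^ 2 \<noteq> 0" using ode(2) unfolding E by auto
  have "2 * q x * k' - 3 * k x * q' = f1^6 * (2 * f x ^ N * \<kappa>' - 3 * of_nat N * f x ^ (N - 1) * \<kappa> (f x))"
    unfolding dk dq qx by algebra
  hence "f1^6 * (2 * f x ^ N * \<kappa>' - 3 * of_nat N * f x ^ (N - 1) * \<kappa> (f x)) = f1^6 * (C * (4 * f x ^ (3 * N) + 27 * \<kappa> (f x) ^ 2))"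
    using ode(1) unfolding E by (simp add: mult_ac)
  thus "2 * f x ^ N * \<kappa>' - 3 * of_nat N * f x ^ (N - 1) * \<kappa> (f x) = C * (4 * f x ^ (3 * N) + 27 * \<kappa> (f x) ^ 2)"
    using f(4) by simp
qed

definition tan_coefficient :: "nat \<Rightarrow> complex \<Rightarrow> complex \<Rightarrow> (complex \<Rightarrow> complex) \<Rightarrow> bool" where
  "tan_coefficient N L0 L1 k \<longleftrightarrow> (\<forall>\<^sub>F s in at 0. k (s^2) =
        2 / complex_of_real (sqrt 27) * s^(3 * N) * tan (L0 * s^(N + 2) + L1))"

definition cot_coefficient :: "nat \<Rightarrow> complex \<Rightarrow> (complex \<Rightarrow> complex) \<Rightarrow> bool" where
  "cot_coefficient N L0 k \<longleftrightarrow> (\<forall>\<^sub>F s in at 0. k (s^2) =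
        2 * s^(3 * N) / (complex_of_real (sqrt 27) * tan (L0 * s^(N + 2))))"

text \<open>
  Put \<open>T = - a \<kappa>(s^2) / s^(3N)\<close>. The equation says \<open>T' = c s^(N+1) (1 +
  T^2)\<close>, and \<open>1 + T^2\<close> has no zero off the origin. The Cayley transform of
  \<open>T\<close> is \<open>A / B\<close> below. It satisfies a linear equation, whose solution is
  an exponential whether or not \<open>T\<close> has a pole at the origin.
\<close>

lemma cayley_solution:
  assumes r: "r > 0" and \<kappa>: "\<kappa> holomorphic_on ball 0 r" and a: "a^2 = (27/4 :: complex)"
    and ode: "\<And>X. X \<in> ball 0 r - {0} \<Longrightarrow> 2 * X^N * deriv \<kappa> X - 3 * of_nat N * X^(N - 1) * \<kappa> X = C * (4 * X^(3*N) + 27 * \<kappa> X^2)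
          \<and> 4 * X^(3*N) + 27 * \<kappa> X^2 \<noteq> 0"
  shows "\<exists>L m d. m \<noteq> 0 \<and> d > 0 \<and> d \<le> r \<and> d \<le> 1 \<and> (\<forall>s\<in>ball 0 d - {0}.
     s^(3*N) + \<i> * a * \<kappa> (s^2) \<noteq> 0 \<and>
     s^(3*N) - \<i> * a * \<kappa> (s^2) = m * exp (2 * \<i> * L * s^(N+2)) * (s^(3*N) + \<i> * a * \<kappa> (s^2)))"
proof -
  define d where "d = min 1 r"
  have d: "d > 0" "d \<le> r" "d \<le> 1" using r by (auto simp: d_def)
  let ?S = "ball 0 d - {0 :: complex}"
  have sq: "s^2 \<in> ball 0 r - {0}" if "s \<in> ?S" for s
  proof -
    have "norm s < 1" "norm s < r" using that d by auto
    hence "norm s * norm s \<le> norm s" by (intro mult_left_le) auto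
    hence "norm (s^2) < r" using \<open>norm s < r\<close> by (simp add: power2_eq_square norm_mult)
    thus ?thesis using that by simp
  qed
  define L where "L = - 4 * a * C / of_nat (N + 2)"
  define A B where "A s = s^(3*N) - \<i> * a * \<kappa> (s^2)" and "B s = s^(3*N) + \<i> * a * \<kappa> (s^2)" for s
  have AB: "4 * (A s * B s) = 4 * (s^2)^(3*N) + 27 * \<kappa> (s^2)^2" for s
  proof -
    have "4 * (A s * B s) = 4 * (s^(3*N))^2 - 4 * \<i>^2 * a^2 * \<kappa> (s^2)^2" unfolding A_def B_def by algebra
    thus ?thesis unfolding a by (simp flip: power_mult add: mult.commute)
  qed
  have AB0: "A s \<noteq> 0" "B s \<noteq> 0" if "s \<in> ?S" for s using AB[of s] ode[OF sq[OF that]] by auto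
  define G where "G s = A s * exp (- (2 * \<i> * L * s^(N+2))) / B s" for s
  have der: "(G has_field_derivative 0) (at s)" if s: "s \<in> ?S" for s
  proof -
    let ?k' = "deriv \<kappa> (s^2)"
    have "(\<kappa> has_field_derivative ?k') (at (s^2))" using \<kappa> sq[OF s] holomorphic_derivI open_ball by blast
    hence k: "((\<lambda>s. \<kappa> (s^2)) has_field_derivative ?k' * (2 * s)) (at s)"
      by (rule DERIV_chain2) (auto intro!: derivative_eq_intros)
    let ?S' = "of_nat (3*N) * s^(3*N - 1)"
    let ?A' = "?S' - \<i> * a * (?k' * (2 * s))" and ?B' = "?S' + \<i> * a * (?k' * (2 * s))"
    have dS: "((\<lambda>s. s^(3*N)) has_field_derivative ?S') (at s)" by (auto intro!: derivative_eq_intros)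
    have dA: "(A has_field_derivative ?A') (at s)" and dB: "(B has_field_derivative ?B') (at s)"
      unfolding A_def[abs_def] B_def[abs_def]
      by (rule DERIV_diff[OF dS DERIV_cmult[OF k]], rule DERIV_add[OF dS DERIV_cmult[OF k]])
    have "((\<lambda>s. s^(N+2)) has_field_derivative of_nat (N+2) * s^(N+1)) (at s)"
      by (rule DERIV_power[OF DERIV_ident, THEN DERIV_cong]) simp
    note dE = DERIV_fun_exp[OF DERIV_minus[OF DERIV_cmult[OF this, of "2 * \<i> * L"]]]
    have p1: "s^(N+1) * (2 * (s^2)^N * ?k') = s^(3*N) * (2 * s * ?k')"
    proof -
      have e: "s^(N+1) * (s^2)^N = s^(3*N) * s" by (simp flip: power_mult power_add add: mult.commute)
      have "s^(N+1) * (2 * (s^2)^N * ?k') = (s^(N+1) * (s^2)^N) * (2 * ?k')" by (simp only: mult_ac)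
      also have "\<dots> = s^(3*N) * (2 * s * ?k')" unfolding e by (simp only: mult_ac)
      finally show ?thesis .
    qed
    have p2: "s^(N+1) * (3 * of_nat N * (s^2)^(N - 1)) = ?S'"
    proof (cases N)
      case (Suc n)
      have "s^(N+1) * (s^2)^(N - 1) = s^(3*N - 1)" unfolding Suc by (simp flip: power_mult power_add)
      thus ?thesis by (simp add: mult_ac)
    qed simp
    have o: "2 * (s^2)^N * ?k' - 3 * of_nat N * (s^2)^(N - 1) * \<kappa> (s^2) = C * (4 * (A s * B s))"
      unfolding AB using ode[OF sq[OF s]] by blast
    have "?A' * B s - A s * ?B' = 2 * \<i> * a * (?S' * \<kappa> (s^2) - s^(3*N) * (2 * s * ?k'))"
      unfolding A_def B_def by algebra
    also have "\<dots> = - 2 * \<i> * a * s^(N+1) * (2 * (s^2)^N * ?k' - 3 * of_nat N * (s^2)^(N - 1) * \<kappa> (s^2))"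
      unfolding p1[symmetric] p2[symmetric] by algebra
    also have "\<dots> = (2 * \<i> * (- 4 * a * C)) * s^(N+1) * (A s * B s)" unfolding o by algebra
    also have "- 4 * a * C = L * of_nat (N+2)" unfolding L_def by (simp del: of_nat_add of_nat_Suc)
    finally have e: "?A' * B s - A s * ?B' = 2 * \<i> * (L * of_nat (N+2)) * s^(N+1) * (A s * B s)" .
    let ?e = "exp (- (2 * \<i> * L * s^(N+2)))"
    have "(G has_field_derivative ((?A' * ?e + (?e * - (2 * \<i> * L * (of_nat (N+2) * s^(N+1)))) * A s) * B s - A s * ?e * ?B') / (B s * B s)) (at s)"
      unfolding G_def[abs_def] by (intro DERIV_divide DERIV_mult dA dB dE AB0[OF s])
    also have "(?A' * ?e + (?e * - (2 * \<i> * L * (of_nat (N+2) * s^(N+1)))) * A s) * B s - A s * ?e * ?B'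
       = ?e * ((?A' * B s - A s * ?B') - 2 * \<i> * (L * of_nat (N+2)) * s^(N+1) * (A s * B s))"
      by algebra
    also have "\<dots> = 0" unfolding e by simp
    finally show ?thesis by simp
  qed
  have oS: "open ?S" by (auto intro: open_delete)
  have conn: "connected ?S" by (intro connected_open_delete) auto
  have cont: "continuous_on ?S G" using der by (intro continuous_at_imp_continuous_on ballI) (blast intro: DERIV_isCont)
  obtain m where m: "\<And>s. s \<in> ?S \<Longrightarrow> G s = m"
    using DERIV_zero_connected_constant[OF conn oS finite.emptyI cont] der by auto
  have eq: "A s = m * exp (2 * \<i> * L * s^(N+2)) * B s" if "s \<in> ?S" for s
    using m[OF that] AB0[OF that] unfolding G_def by (simp add: exp_minus field_simps)
  have "of_real (d / 2) \<in> ?S" using d by auto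
  hence "m \<noteq> 0" using eq[of "of_real (d / 2)"] AB0(1)[of "of_real (d / 2)"] by auto
  thus ?thesis using d eq AB0 unfolding A_def B_def by blast
qed

lemma tan_cayley:
  fixes S e a B t :: complex
  assumes "S + \<i> * a * e \<noteq> 0" "S - \<i> * a * e = exp (2 * \<i> * t) * (S + \<i> * a * e)" "S \<noteq> 0" "a \<noteq> 0"
  shows "cos t \<noteq> 0" "- e = 1 / a * S * tan t"
proof -
  let ?E = "exp (\<i> * t)"
  have E2: "exp (2 * \<i> * t) = ?E^2" by (simp flip: exp_of_nat_mult add: mult_ac)
  have c: "2 * ?E * cos t = ?E^2 + 1" and s: "2 * \<i> * ?E * sin t = ?E^2 - 1"
    by (simp_all add: cos_exp_eq sin_exp_eq field_simps power2_eq_square exp_minus)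
  have E0: "?E \<noteq> 0" by simp
  have 1: "2 * ?E * cos t * (S + \<i> * a * e) = 2 * S" unfolding c using assms(2) unfolding E2 by algebra
  have 2: "2 * \<i> * ?E * sin t * (S + \<i> * a * e) = - 2 * \<i> * a * e" unfolding s using assms(2) unfolding E2 by algebra
  show c0: "cos t \<noteq> 0" using 1 assms(3) by auto
  have "?E * (S + \<i> * a * e) * (S * sin t) = ?E * (S + \<i> * a * e) * (- a * e * cos t)"
  proof -
    have 1: "?E * cos t * (S + \<i> * a * e) = S" using 1 by (simp add: mult.assoc)
    have "\<i> * (?E * sin t * (S + \<i> * a * e)) = \<i> * (- (a * e))" using 2 by (simp add: mult_ac)
    hence 2: "?E * sin t * (S + \<i> * a * e) = - (a * e)" by (simp only: mult_cancel_left) simp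
    have "?E * (S + \<i> * a * e) * (S * sin t) = S * (?E * sin t * (S + \<i> * a * e))" by (simp only: mult_ac)
    also have "\<dots> = - (a * e) * (?E * cos t * (S + \<i> * a * e))" unfolding 1 2 by simp
    also have "\<dots> = ?E * (S + \<i> * a * e) * (- a * e * cos t)" by (simp add: mult_ac)
    finally show ?thesis .
  qed
  moreover have "?E * (S + \<i> * a * e) \<noteq> 0" using E0 assms(1) by simp
  ultimately have "S * sin t = - a * e * cos t" using mult_left_cancel by blast
  thus "- e = 1 / a * S * tan t" unfolding tan_def using c0 assms(4) by (simp add: field_simps)
qed

lemma tan_add_pi_half: "cos (t::complex) \<noteq> 0 \<or> sin t \<noteq> 0 \<Longrightarrow> tan (t + of_real pi / 2) = - (1 / tan t)"
  by (simp add: tan_def sin_add cos_add)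

text \<open>
  Writing \<open>m = exp (2 \<i> L1)\<close> turns the Cayley transform into a tangent. The value
  \<open>m = -1\<close> corresponds to \<open>L1 = \<pi>/2\<close>, that is, to a cotangent; it has
  a pole at \<open>0\<close> which only a factor \<open>s^(3N)\<close> with \<open>N > 0\<close> can
  cancel. For odd \<open>N\<close> the substitution \<open>s \<mapsto> -s\<close> exchanges
  \<open>A\<close> and \<open>-B\<close>, hence \<open>m^2 = 1\<close>.
\<close>

lemma normalized_ode_solution:
  assumes r: "r > 0" and \<kappa>: "\<kappa> holomorphic_on ball 0 r"
    and ode: "\<And>X. X \<in> ball 0 r - {0} \<Longrightarrow> 2 * X^N * deriv \<kappa> X - 3 * of_nat N * X^(N - 1) * \<kappa> X = C * (4 * X^(3*N) + 27 * \<kappa> X^2)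
          \<and> 4 * X^(3*N) + 27 * \<kappa> X^2 \<noteq> 0"
  shows "(\<exists>L0 L1. cos L1 \<noteq> 0 \<and> (odd N \<longrightarrow> L1 = 0) \<and> tan_coefficient N L0 L1 (\<lambda>X. - \<kappa> X)) \<or>
         (\<exists>L0. N > 0 \<and> L0 \<noteq> 0 \<and> cot_coefficient N L0 \<kappa>)"
proof -
  define a where "a = complex_of_real (sqrt 27) / 2"
  have a2: "a^2 = 27/4" unfolding a_def by (simp add: power_divide flip: of_real_power)
  have a0: "a \<noteq> 0" by (simp add: a_def)
  have inva: "2 / complex_of_real (sqrt 27) = 1 / a" by (simp add: a_def)
  obtain L m d where m: "m \<noteq> 0" and d: "d > 0" "d \<le> r" "d \<le> 1" and
    sol: "\<And>s. s \<in> ball 0 d - {0} \<Longrightarrow> s^(3*N) + \<i> * a * \<kappa> (s^2) \<noteq> 0 \<and>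
     s^(3*N) - \<i> * a * \<kappa> (s^2) = m * exp (2 * \<i> * L * s^(N+2)) * (s^(3*N) + \<i> * a * \<kappa> (s^2))"
    using cayley_solution[OF r \<kappa> a2 ode] by metis
  have ev: "\<forall>\<^sub>F s in at 0. s \<in> ball 0 d - {0 :: complex}"
    using eventually_at_in_open[of "ball 0 d" "0::complex"] d(1) by simp
  have tan_sol: "\<kappa> (s^2) = - (1 / a * s^(3*N) * tan (L * s^(N+2) + L1)) \<and> cos (L * s^(N+2) + L1) \<noteq> 0"
    if L1: "exp (2 * \<i> * L1) = m" and s: "s \<in> ball 0 d - {0}" for s L1
  proof -
    have "exp (2 * \<i> * (L * s^(N+2) + L1)) = m * exp (2 * \<i> * L * s^(N+2))"
      using L1 by (simp add: ring_distribs exp_add mult.assoc)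
    hence "s^(3*N) - \<i> * a * \<kappa> (s^2) = exp (2 * \<i> * (L * s^(N+2) + L1)) * (s^(3*N) + \<i> * a * \<kappa> (s^2))"
      using sol[OF s] by simp
    from tan_cayley[OF _ this _ a0] sol[OF s] s
    have "- \<kappa> (s^2) = 1 / a * s^(3*N) * tan (L * s^(N+2) + L1)" "cos (L * s^(N+2) + L1) \<noteq> 0" by simp_all
    thus ?thesis by (metis minus_minus)
  qed
  show ?thesis
  proof (cases "m = - 1")
    case True
    have L1: "exp (2 * \<i> * (of_real pi / 2)) = m" unfolding True using exp_pi_i by (simp add: mult.commute)
    have eq: "\<kappa> (s^2) = 1 / a * s^(3*N) * (1 / tan (L * s^(N+2)))" "sin (L * s^(N+2)) \<noteq> 0" if s: "s \<in> ball 0 d - {0}" for s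
    proof -
      have "cos (L * s^(N+2) + of_real pi / 2) \<noteq> 0" using tan_sol[OF L1 s] by blast
      thus sn: "sin (L * s^(N+2)) \<noteq> 0" by (simp add: cos_add)
      show "\<kappa> (s^2) = 1 / a * s^(3*N) * (1 / tan (L * s^(N+2)))"
        using tan_sol[OF L1 s] tan_add_pi_half[of "L * s^(N+2)"] sn by simp
    qed
    have "of_real (d / 2) \<in> ball 0 d - {0 :: complex}" using d by auto
    from eq(2)[OF this] have L0: "L \<noteq> 0" by auto
    have "N > 0"
    proof (rule ccontr)
      assume "\<not> N > 0"
      hence N: "N = 0" by simp
      have "isCont (\<lambda>s. \<kappa> (s^2) * sin (L * s^2)) 0"
      proof -
        have "isCont \<kappa> 0" using holomorphic_on_imp_continuous_on[OF \<kappa>] r by (simp add: continuous_on_eq_continuous_at)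
        moreover have "isCont (\<lambda>s::complex. s^2) 0" by (intro continuous_intros)
        ultimately have "isCont (\<lambda>s::complex. \<kappa> (s^2)) 0" using isCont_o2[of 0 "\<lambda>s::complex. s^2" \<kappa>] by simp
        moreover have "isCont (\<lambda>s::complex. sin (L * s^2)) 0" by (intro continuous_intros)
        ultimately show ?thesis by (rule continuous_mult)
      qed
      hence "(\<lambda>s. \<kappa> (s^2) * sin (L * s^2)) \<midarrow>0\<rightarrow> 0" by (simp add: isCont_def)
      moreover have "\<forall>\<^sub>F s in at 0. \<kappa> (s^2) * sin (L * s^2) = 1 / a * cos (L * s^2)"
        using ev
      proof eventually_elim
        case (elim s)
        show ?case using eq[OF elim] N by (simp add: tan_def power2_eq_square)
      qed
      ultimately have "(\<lambda>s. 1 / a * cos (L * s^2)) \<midarrow>0\<rightarrow> 0" by (rule Lim_transform_eventually)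
      moreover have "isCont (\<lambda>s. 1 / a * cos (L * s^2)) 0" by (intro continuous_intros)
      hence "(\<lambda>s. 1 / a * cos (L * s^2)) \<midarrow>0\<rightarrow> 1 / a" by (simp add: isCont_def)
      ultimately have "1 / a = 0" using LIM_unique by blast
      thus False using a0 by simp
    qed
    moreover have "cot_coefficient N L \<kappa>" unfolding cot_coefficient_def using ev
    proof eventually_elim
      case (elim s)
      show ?case unfolding eq(1)[OF elim] inva[symmetric] by simp
    qed
    ultimately show ?thesis using L0 by blast
  next
    case False
    have fin: "\<exists>L0 L1. cos L1 \<noteq> 0 \<and> (odd N \<longrightarrow> L1 = 0) \<and> tan_coefficient N L0 L1 (\<lambda>X. - \<kappa> X)"
      if L1: "exp (2 * \<i> * L1) = m" and o: "odd N \<longrightarrow> L1 = 0" for L1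
    proof (intro exI conjI)
      show "cos L1 \<noteq> 0"
      proof
        assume "cos L1 = 0"
        hence "exp (\<i> * L1) + exp (- (\<i> * L1)) = 0" by (simp add: cos_exp_eq)
        hence "exp (\<i> * L1) * exp (\<i> * L1) = - 1" by (simp add: exp_minus field_simps add_eq_0_iff)
        moreover have "exp (2 * \<i> * L1) = exp (\<i> * L1) * exp (\<i> * L1)" by (simp flip: exp_add add: mult.assoc)
        ultimately show False using L1 False by simp
      qed
      show "tan_coefficient N L L1 (\<lambda>X. - \<kappa> X)" unfolding tan_coefficient_def inva using ev
      proof eventually_elim
        case (elim s)
        show ?case using tan_sol[OF L1 elim] by simp
      qed
    qed (rule o)
    have "\<exists>L1. exp (2 * \<i> * L1) = m \<and> (odd N \<longrightarrow> L1 = 0)"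
    proof (cases "odd N")
      case True
      define s where "s = complex_of_real (d / 2)"
      have s: "s \<in> ball 0 d - {0}" "- s \<in> ball 0 d - {0}" using d by (auto simp: s_def)
      let ?e = "exp (2 * \<i> * L * s^(N+2))" and ?B = "s^(3*N) + \<i> * a * \<kappa> (s^2)" and ?A = "s^(3*N) - \<i> * a * \<kappa> (s^2)"
      have p: "(- s)^(3*N) = - (s^(3*N))" "(- s)^(N+2) = - (s^(N+2))" using True by (auto simp: power_minus_odd)
      have 1: "?A = m * ?e * ?B" "?B \<noteq> 0" using sol[OF s(1)] by auto
      have "- (s^(3*N)) - \<i> * a * \<kappa> (s^2) = m * exp (- (2 * \<i> * L * s^(N+2))) * (- (s^(3*N)) + \<i> * a * \<kappa> (s^2))"
        using sol[OF s(2)] unfolding p by simp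
      moreover have "(S + e) * f = m * (g * f) * (S - e)" if "- S - e = m * g * (- S + e)" for S e f g :: complex
        using that by algebra
      ultimately have "?B * ?e = m * (exp (- (2 * \<i> * L * s^(N+2))) * ?e) * ?A" by blast
      also have "exp (- (2 * \<i> * L * s^(N+2))) * ?e = 1" by (simp flip: exp_add)
      finally have "?B * ?e = m * ?A" by simp
      moreover have "f * B * (m * m - 1) = 0" if "A = m * f * B" "B * f = m * A" for A B f :: complex
        using that by algebra
      ultimately have "?e * ?B * (m * m - 1) = 0" using 1(1) by blast
      hence "m * m = 1" using 1(2) by simp
      hence "m = 1" using False by (metis mult_cancel_right1 square_eq_1_iff)
      thus ?thesis by (intro exI[of _ 0]) simp
    next
      case False
      thus ?thesis using m by (intro exI[of _ "Ln m / (2 * \<i>)"]) simp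
    qed
    thus ?thesis using fin by blast
  qed
qed

text \<open>
  With \<open>\<eta>^(N+2) = -1\<close> the rotation of \<open>s\<close> by \<open>\<eta>\<close>
  changes the sign of \<open>s^(N+2)\<close>. It rotates \<open>x = s^2\<close> by \<open>\<omega> =
  \<eta>^2\<close>, and \<open>\<omega>^(N+2) = 1\<close> means that \<open>q = x^N\<close> is
  preserved. Since the tangent is odd, the net effect is a change of sign of \<open>L1\<close>.
\<close>

lemma tan_coefficient_flip:
  assumes "tan_coefficient N L0 L1 (\<lambda>X. - \<kappa> X)"
  obtains \<omega> where "\<omega> \<noteq> 0" "\<omega>^(N + 2) = 1" "tan_coefficient N L0 (- L1) (\<lambda>X. - (\<kappa> (X / \<omega>) / \<omega>^3))"
proof -
  define \<eta> where "\<eta> = exp (\<i> * of_real pi / of_nat (N + 2))"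
  have \<eta>: "\<eta>^(N + 2) = - 1"
  proof -
    have "of_nat (N + 2) \<noteq> (0 :: complex)" by (simp only: of_nat_eq_0_iff)
    hence "of_nat (N + 2) * (\<i> * of_real pi / of_nat (N + 2)) = \<i> * of_real pi" by (simp del: of_nat_add of_nat_Suc)
    thus ?thesis unfolding \<eta>_def using exp_pi_i by (simp only: exp_of_nat_mult[symmetric] mult.commute[of \<i>])
  qed
  have \<eta>0: "\<eta> \<noteq> 0" by (simp add: \<eta>_def)
  have e3: "\<eta>^(3 * N) * (\<eta>^2)^3 = - 1"
  proof -
    have "\<eta>^(3 * N) * (\<eta>^2)^3 = (\<eta>^(N + 2))^3" by (simp flip: power_mult power_add add: algebra_simps)
    thus ?thesis unfolding \<eta> by simp
  qed
  have "filterlim (\<lambda>s. s / \<eta>) (at 0) (at 0)"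
    unfolding filterlim_at using \<eta>0 by (auto intro!: tendsto_eq_intros simp: eventually_at_filter)
  hence "\<forall>\<^sub>F s in at 0. - \<kappa> ((s / \<eta>)^2) = 2 / complex_of_real (sqrt 27) * (s / \<eta>)^(3 * N) * tan (L0 * (s / \<eta>)^(N + 2) + L1)"
    using assms unfolding tan_coefficient_def filterlim_iff by blast
  hence "\<forall>\<^sub>F s in at 0. - (\<kappa> (s^2 / \<eta>^2) / (\<eta>^2)^3) = 2 / complex_of_real (sqrt 27) * s^(3 * N) * tan (L0 * s^(N + 2) + - L1)"
  proof eventually_elim
    case (elim s)
    let ?c = "2 / complex_of_real (sqrt 27)"
    have p: "(s / \<eta>)^(N + 2) = - (s^(N+2))" unfolding power_divide \<eta> by simp
    have t: "tan (L0 * (s / \<eta>)^(N + 2) + L1) = - tan (L0 * s^(N + 2) + - L1)"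
      unfolding p tan_minus[symmetric] by simp
    have "- (\<kappa> (s^2 / \<eta>^2) / (\<eta>^2)^3) = ?c * (s / \<eta>)^(3 * N) * - tan (L0 * s^(N + 2) + - L1) / (\<eta>^2)^3"
      using elim unfolding t by (simp add: power_divide)
    also have "\<dots> = ?c * s^(3*N) * - tan (L0 * s^(N + 2) + - L1) / (\<eta>^(3 * N) * (\<eta>^2)^3)" by (simp add: power_divide)
    also have "\<dots> = ?c * s^(3*N) * tan (L0 * s^(N + 2) + - L1)" unfolding e3 by simp
    finally show ?case .
  qed
  moreover have "(\<eta>^2)^(N + 2) = 1"
  proof -
    have "(\<eta>^2)^(N + 2) = (\<eta>^(N + 2))^2" by (simp only: power_mult[symmetric] mult.commute)
    thus ?thesis unfolding \<eta> by simp
  qed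
  ultimately show ?thesis using \<eta>0 by (intro that[of "\<eta>^2"]) (auto simp: tan_coefficient_def)
qed

lemma Arg_in_half_plane:
  assumes "L \<noteq> 0" "\<not> (0 \<le> Arg L \<and> Arg L < pi)"
  shows "0 \<le> Arg (- L) \<and> Arg (- L) < pi"
  using assms Arg_minus[of L] mpi_less_Arg[of L] Arg_le_pi[of L] by (auto split: if_splits)

section \<open>Equivalence with a normal form\<close>

text \<open>
  The discriminant of a binary cubic is an invariant of weight \<open>6\<close>; here the
  substitution has the triangular matrix with diagonal entries \<open>\<alpha>\<close> and
  \<open>\<beta>\<close>.
\<close>

lemma discr_substitution:
  assumes "c * cf3 K z = A3 * \<beta>^3" "c * cf2 K z = \<beta>^2 * (3 * A3 * \<gamma> + A2 * \<alpha>)"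
    "c * cf1 K z = \<beta> * (3 * A3 * \<gamma>^2 + 2 * A2 * \<alpha> * \<gamma> + A1 * \<alpha>^2)"
    "c * cf0 K z = A3 * \<gamma>^3 + A2 * \<gamma>^2 * \<alpha> + A1 * \<gamma> * \<alpha>^2 + A0 * \<alpha>^3"
  shows "c^4 * discr K z = (\<alpha> * \<beta>)^6 * (A2^2 * A1^2 - 4 * A3 * A1^3 - 4 * A2^3 * A0 - 27 * A3^2 * A0^2 + 18 * A3 * A2 * A1 * A0)"
proof -
  let ?a = "c * cf3 K z" and ?b = "c * cf2 K z" and ?c = "c * cf1 K z" and ?d = "c * cf0 K z"
  have "c^4 * discr K z = ?b^2 * ?c^2 - 4 * ?a * ?c^3 - 4 * ?b^3 * ?d - 27 * ?a^2 * ?d^2 + 18 * ?a * ?b * ?c * ?d"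
    unfolding discr_def Let_def by algebra
  also have "\<dots> = (\<alpha> * \<beta>)^6 * (A2^2 * A1^2 - 4 * A3 * A1^3 - 4 * A2^3 * A0 - 27 * A3^2 * A0^2 + 18 * A3 * A2 * A1 * A0)"
    unfolding assms by algebra
  finally show ?thesis .
qed

lemma biholo_on_triangular:
  assumes s: "s > 0" and f: "f holomorphic_on ball 0 s" "inj_on f (ball 0 s)"
    and h: "h holomorphic_on ball 0 s" "\<And>x. x \<in> ball 0 s \<Longrightarrow> h x \<noteq> 0"
  shows "biholo_on (\<lambda>z. (f (fst z), snd z * h (fst z))) (bidisc s)"
proof -
  let ?B = "ball (0::complex) s" and ?\<phi> = "\<lambda>z. (f (fst z), snd z * h (fst z))"
  obtain g where g: "g holomorphic_on f ` ?B" "\<And>x. x \<in> ?B \<Longrightarrow> g (f x) = x"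
    using holomorphic_has_inverse[OF f(1) open_ball f(2)] by metis
  have o: "open (f ` ?B)" by (rule open_mapping_thm3[OF f(1) open_ball f(2)])
  define W0 where "W0 = f ` ?B \<times> (UNIV :: complex set)"
  have W0: "open W0" unfolding W0_def using o by (intro open_Times) auto
  have gB: "g X \<in> ?B" if "X \<in> f ` ?B" for X using that g(2) by auto
  have hg: "(\<lambda>X. 1 / h (g X)) holomorphic_on f ` ?B"
    using g(1) gB h by (intro holomorphic_on_divide holomorphic_on_compose_gen[OF g(1) h(1), unfolded o_def]) auto
  have Y: "holo2_on (\<lambda>z. snd z * (1 / h (g (fst z)))) W0"
    by (intro holo2_on_mult holo2_on_snd W0 holo2_on_compose_field[OF hg o holo2_on_fst[OF W0]]) (auto simp: W0_def)
  have X: "holo2_on (\<lambda>z. g (fst z)) W0"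
    by (rule holo2_on_compose_field[OF g(1) o holo2_on_fst[OF W0]]) (auto simp: W0_def)
  define W where "W = (\<lambda>z. snd z * (1 / h (g (fst z)))) -` ?B \<inter> W0"
  have W: "open W" unfolding W_def
    using holo2_on_imp_continuous_on[OF Y] continuous_on_open_vimage[OF W0] open_ball by metis
  have im: "?\<phi> ` bidisc s = W"
  proof (intro equalityI subsetI)
    fix w assume "w \<in> ?\<phi> ` bidisc s"
    then obtain z where z: "z \<in> bidisc s" "w = ?\<phi> z" by (rule imageE)
    obtain x y where "z = (x, y)" by (cases z)
    with z have "(x, y) \<in> bidisc s" "w = (f x, y * h x)" by auto
    hence x: "x \<in> ?B" and y: "y \<in> ?B" and w: "w = (f x, y * h x)" by auto
    have "snd w * (1 / h (g (fst w))) = y" unfolding w fst_conv snd_conv g(2)[OF x] using h(2)[OF x] by simp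
    moreover have "f x \<in> f ` ?B" using x by (rule imageI)
    ultimately show "w \<in> W" unfolding W_def W0_def using w y by simp
  next
    fix w assume w: "w \<in> W"
    obtain X Y where XY: "w = (X, Y)" by (cases w)
    then obtain x where x: "x \<in> ?B" "X = f x" using w by (auto simp: W_def W0_def)
    have "Y / h x \<in> ?B" using w g(2)[OF x(1)] unfolding W_def XY x(2) by simp
    hence "(x, Y / h x) \<in> bidisc s" using x(1) by simp
    moreover have "?\<phi> (x, Y / h x) = w" unfolding XY using x(2) h(2)[OF x(1)] by simp
    ultimately show "w \<in> ?\<phi> ` bidisc s" by (intro image_eqI[of _ _ "(x, Y / h x)"]) simp_all
  qed
  show ?thesis
  proof (rule biholo_onI[OF _ _ im])
    show "holo_map_on ?\<phi> (bidisc s)" unfolding holo_map_on_def fst_conv snd_conv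
      by (intro conjI holo2_on_mult holo2_on_snd holo2_on_compose_field[OF f(1) open_ball holo2_on_fst]
          holo2_on_compose_field[OF h(1) open_ball holo2_on_fst]) (auto simp: bidisc_def open_Times)
    show "holo_map_on (\<lambda>z. (g (fst z), snd z * (1 / h (g (fst z))))) W" unfolding holo_map_on_def fst_conv snd_conv
      using X Y W by (auto intro: holo2_on_subset simp: W_def)
    show "(g (fst (?\<phi> z)), snd (?\<phi> z) * (1 / h (g (fst (?\<phi> z))))) = z" if "z \<in> bidisc s" for z
      using that g(2)[of "fst z"] h(2)[of "fst z"] by (cases z) auto
  qed
qed

text \<open>
  The differentials of \<open>f x\<close> and \<open>y h x\<close> are \<open>f' dx\<close> and
  \<open>h dy + y h' dx\<close>. Substituting them into the form with coefficients \<open>A3,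
  \<dots>, A0\<close> has to give a nonzero multiple of the form of \<open>K\<close>.
\<close>

definition forms_correspond :: "cubic \<Rightarrow> cubic \<Rightarrow> (complex \<Rightarrow> complex) \<Rightarrow> (complex \<Rightarrow> complex) \<Rightarrow> complex \<Rightarrow> complex \<Rightarrow> bool" where
  "forms_correspond K K' f h x y \<longleftrightarrow> (\<exists>c A3 A2 A1 A0. c \<noteq> 0 \<and>
     cf3 K' (f x, y * h x) = A3 \<and> cf2 K' (f x, y * h x) = A2 \<and> cf1 K' (f x, y * h x) = A1 \<and> cf0 K' (f x, y * h x) = A0 \<and>
     c * cf3 K (x, y) = A3 * h x^3 \<and> c * cf2 K (x, y) = h x^2 * (3 * A3 * (y * deriv h x) + A2 * deriv f x) \<and>
     c * cf1 K (x, y) = h x * (3 * A3 * (y * deriv h x)^2 + 2 * A2 * deriv f x * (y * deriv h x) + A1 * deriv f x^2) \<and>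
     c * cf0 K (x, y) = A3 * (y * deriv h x)^3 + A2 * (y * deriv h x)^2 * deriv f x + A1 * (y * deriv h x) * deriv f x^2 + A0 * deriv f x^3)"

text \<open>
  The forms correspond under the Jacobian matrix, so \<open>solutions_image\<close> applies; the
  discriminants correspond by \<open>discr_substitution\<close>.
\<close>

lemma triangular_equivalence:
  assumes K: "cubic_equation K" and s: "s > 0" and f: "f holomorphic_on ball 0 s" "inj_on f (ball 0 s)" "f 0 = 0"
    and h: "h holomorphic_on ball 0 s" "\<And>x. x \<in> ball 0 s \<Longrightarrow> h x \<noteq> 0"
    and K': "(0, 0) \<in> U'" "holo2_on (cf3 K') U'" "holo2_on (cf2 K') U'" "holo2_on (cf1 K') U'" "holo2_on (cf0 K') U'"
      "cf3 K' (0, 0) \<noteq> 0 \<or> cf2 K' (0, 0) \<noteq> 0 \<or> cf1 K' (0, 0) \<noteq> 0 \<or> cf0 K' (0, 0) \<noteq> 0"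
    and rel: "\<And>x y. (x, y) \<in> bidisc s \<Longrightarrow> forms_correspond K K' f h x y"
  shows "maps_web (\<lambda>z. (f (fst z), snd z * h (fst z))) K K'" "cubic_equation K'"
proof -
  let ?\<phi> = "\<lambda>z. (f (fst z), snd z * h (fst z))"
  have bi: "biholo_on ?\<phi> (bidisc s)" by (rule biholo_on_triangular[OF s f(1,2) h])
  have df: "deriv f x \<noteq> 0" if "x \<in> ball 0 s" for x by (rule holomorphic_injective_imp_regular[OF f(1) open_ball f(2) that])
  have disc: "discr K z = 0 \<longleftrightarrow> discr K' (?\<phi> z) = 0" if z: "z \<in> bidisc s" for z
  proof -
    obtain x y where xy: "z = (x, y)" by (cases z)
    obtain c A3 A2 A1 A0 where c: "c \<noteq> 0" and A: "cf3 K' (f x, y * h x) = A3" "cf2 K' (f x, y * h x) = A2"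
        "cf1 K' (f x, y * h x) = A1" "cf0 K' (f x, y * h x) = A0" and
      e: "c * cf3 K (x, y) = A3 * h x^3" "c * cf2 K (x, y) = h x^2 * (3 * A3 * (y * deriv h x) + A2 * deriv f x)"
       "c * cf1 K (x, y) = h x * (3 * A3 * (y * deriv h x)^2 + 2 * A2 * deriv f x * (y * deriv h x) + A1 * deriv f x^2)"
       "c * cf0 K (x, y) = A3 * (y * deriv h x)^3 + A2 * (y * deriv h x)^2 * deriv f x + A1 * (y * deriv h x) * deriv f x^2 + A0 * deriv f x^3"
      using rel[of x y] z xy unfolding forms_correspond_def by metis
    have "c^4 * discr K (x, y) = (deriv f x * h x)^6 * discr K' (f x, y * h x)"
      using discr_substitution[OF e] unfolding discr_def[of K'] Let_def A .
    thus ?thesis using c df[of x] h(2)[of x] z unfolding xy by auto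
  qed
  have form: "cubic_form K z u v = 0 \<longleftrightarrow> cubic_form K' (?\<phi> z) (a * u + b * v) (p * u + q * v) = 0"
    if z: "z \<in> bidisc s" and P: "has_partials (\<lambda>z. fst (?\<phi> z)) a b z" "has_partials (\<lambda>z. snd (?\<phi> z)) p q z"
    for z a b p q u v
  proof -
    obtain x y where xy: "z = (x, y)" by (cases z)
    have x: "x \<in> ball 0 s" using z xy by simp
    have d: "(f has_field_derivative deriv f x) (at (fst z))" "(h has_field_derivative deriv h x) (at (fst z))"
      using f(1) h(1) x holomorphic_derivI open_ball unfolding xy fst_conv by blast+
    have "has_partials (\<lambda>z. fst (?\<phi> z)) (deriv f x * 1) (deriv f x * 0) z"
      unfolding fst_conv by (rule has_partials_compose_field[OF d(1) has_partials_fst])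
    from has_partials_unique[OF P(1) this] have ab: "a = deriv f x" "b = 0" by auto
    have "has_partials (\<lambda>z. snd (?\<phi> z)) (0 * h (fst z) + snd z * (deriv h x * 1)) (1 * h (fst z) + snd z * (deriv h x * 0)) z"
      unfolding snd_conv by (rule has_partials_mult[OF has_partials_snd has_partials_compose_field[OF d(2) has_partials_fst]])
    from has_partials_unique[OF P(2) this] have pq: "p = y * deriv h x" "q = h x" unfolding xy by auto
    obtain c A3 A2 A1 A0 where c: "c \<noteq> 0" and A: "cf3 K' (f x, y * h x) = A3" "cf2 K' (f x, y * h x) = A2"
        "cf1 K' (f x, y * h x) = A1" "cf0 K' (f x, y * h x) = A0" and
      e: "c * cf3 K (x, y) = A3 * h x^3" "c * cf2 K (x, y) = h x^2 * (3 * A3 * (y * deriv h x) + A2 * deriv f x)"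
       "c * cf1 K (x, y) = h x * (3 * A3 * (y * deriv h x)^2 + 2 * A2 * deriv f x * (y * deriv h x) + A1 * deriv f x^2)"
       "c * cf0 K (x, y) = A3 * (y * deriv h x)^3 + A2 * (y * deriv h x)^2 * deriv f x + A1 * (y * deriv h x) * deriv f x^2 + A0 * deriv f x^3"
      using rel[of x y] z xy unfolding forms_correspond_def by metis
    have "c * cubic_form K (x, y) u v = (c * cf3 K (x, y)) * v^3 + (c * cf2 K (x, y)) * v^2 * u + (c * cf1 K (x, y)) * v * u^2 + (c * cf0 K (x, y)) * u^3"
      unfolding cubic_form_def by algebra
    also have "\<dots> = A3 * (y * deriv h x * u + h x * v)^3 + A2 * (y * deriv h x * u + h x * v)^2 * (deriv f x * u)
        + A1 * (y * deriv h x * u + h x * v) * (deriv f x * u)^2 + A0 * (deriv f x * u)^3"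
      unfolding e by algebra
    also have "\<dots> = cubic_form K' (?\<phi> z) (a * u + b * v) (p * u + q * v)"
      unfolding cubic_form_def xy fst_conv snd_conv A ab pq by simp
    finally show ?thesis using c unfolding xy by auto
  qed
  have "(\<lambda>C. ?\<phi> ` C) ` solutions K (bidisc s - discr_curve K) = solutions K' (?\<phi> ` (bidisc s - discr_curve K))"
  proof (rule solutions_image[OF bi])
    show "bidisc s - discr_curve K \<subseteq> bidisc s" by blast
    fix z a b p q u v
    assume "z \<in> bidisc s - discr_curve K" "has_partials (\<lambda>z. fst (?\<phi> z)) a b z" "has_partials (\<lambda>z. snd (?\<phi> z)) p q z"
    thus "(cubic_form K z u v = 0) = (cubic_form K' (?\<phi> z) (a * u + b * v) (p * u + q * v) = 0)" by (intro form) blast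
  qed
  also have "?\<phi> ` (bidisc s - discr_curve K) = ?\<phi> ` bidisc s - discr_curve K'"
  proof (intro equalityI subsetI)
    fix w assume "w \<in> ?\<phi> ` (bidisc s - discr_curve K)"
    then obtain z where "z \<in> bidisc s" "discr K z \<noteq> 0" "w = ?\<phi> z" by (auto simp: discr_curve_def)
    thus "w \<in> ?\<phi> ` bidisc s - discr_curve K'" using disc[of z] unfolding discr_curve_def by blast
  next
    fix w assume "w \<in> ?\<phi> ` bidisc s - discr_curve K'"
    then obtain z where "z \<in> bidisc s" "w = ?\<phi> z" "discr K' (?\<phi> z) \<noteq> 0" unfolding discr_curve_def by blast
    thus "w \<in> ?\<phi> ` (bidisc s - discr_curve K)" using disc[of z] unfolding discr_curve_def by blast
  qed
  finally have sol: "(\<lambda>C. ?\<phi> ` C) ` solutions K (bidisc s - discr_curve K) = solutions K' (?\<phi> ` bidisc s - discr_curve K')" .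
  have z0: "(0, 0) \<in> bidisc s" "?\<phi> (0, 0) = (0, 0)" using s f(3) by auto
  show "maps_web ?\<phi> K K'" unfolding maps_web_def using z0 bi sol by blast
  have "\<not> (\<forall>\<^sub>F z in nhds (0, 0). discr K' z = 0)"
  proof
    assume "\<forall>\<^sub>F z in nhds (0, 0). discr K' z = 0"
    then obtain T where T: "open T" "(0, 0) \<in> T" "\<And>z. z \<in> T \<Longrightarrow> discr K' z = 0" by (auto simp: eventually_nhds)
    have "continuous_on (bidisc s) ?\<phi>" using bi unfolding biholo_on_def by (intro holo_map_on_imp_continuous_on) blast
    hence "open (bidisc s \<inter> ?\<phi> -` T)" using T(1) by (intro continuous_open_preimage) auto
    moreover have "(0, 0) \<in> bidisc s \<inter> ?\<phi> -` T" using z0 T(2) by auto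
    moreover have "discr K z = 0" if "z \<in> bidisc s \<inter> ?\<phi> -` T" for z
      using that T(3)[of "?\<phi> z"] disc[of z] by blast
    ultimately have "\<forall>\<^sub>F z in nhds (0, 0). discr K z = 0" unfolding eventually_nhds by blast
    thus False using K by (auto simp: cubic_equation_def)
  qed
  thus "cubic_equation K'" unfolding cubic_equation_def using K' by blast
qed

lemma analytic_coefficient_holo2:
  assumes "k analytic_on {0}" "l analytic_on {0}"
  obtains U where "(0, 0) \<in> U" "open U" "\<And>m. holo2_on (\<lambda>(x, y). k x * y^m) U" "\<And>m. holo2_on (\<lambda>(x, y). l x * y^m) U"
proof -
  obtain S T where S: "open S" "0 \<in> S" "k holomorphic_on S" and T: "open T" "0 \<in> T" "l holomorphic_on T"
    using assms by (auto simp: analytic_at)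
  define U where "U = (S \<inter> T) \<times> (UNIV :: complex set)"
  have U: "open U" unfolding U_def using S T by (intro open_Times) auto
  have kU: "holo2_on (\<lambda>z. k (fst z) * snd z ^ m) U" "holo2_on (\<lambda>z. l (fst z) * snd z ^ m) U" for m
    by (intro holo2_on_mult holo2_on_power holo2_on_snd U holo2_on_compose_field[OF S(3,1) holo2_on_fst[OF U]]
      holo2_on_compose_field[OF T(3,1) holo2_on_fst[OF U]]; auto simp: U_def)+
  thus ?thesis using that[of U] U S(2) T(2) by (simp add: U_def case_prod_unfold)
qed

lemma exponential_primitive:
  assumes "a holomorphic_on ball 0 (s::real)" "s > 0"
  obtains h where "h holomorphic_on ball 0 s" "\<And>x. x \<in> ball 0 s \<Longrightarrow> h x \<noteq> 0" "\<And>x. x \<in> ball 0 s \<Longrightarrow> deriv h x = a x * h x"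
proof -
  obtain g where g: "\<And>x. x \<in> ball 0 s \<Longrightarrow> (g has_field_derivative a x) (at x within ball 0 s)"
    using holomorphic_convex_primitive'[OF convex_ball open_ball assms(1)] by metis
  have d: "((\<lambda>x. exp (g x)) has_field_derivative exp (g x) * a x) (at x)" if "x \<in> ball 0 s" for x
    using g[OF that] that by (auto simp: at_within_open[OF that open_ball] intro!: derivative_eq_intros)
  show ?thesis
  proof (rule that[of "\<lambda>x. exp (g x)"])
    show "(\<lambda>x. exp (g x)) holomorphic_on ball 0 s" using d by (subst holomorphic_on_open) (simp, blast)
    show "deriv (\<lambda>x. exp (g x)) x = a x * exp (g x)" if "x \<in> ball 0 s" for x
      using DERIV_imp_deriv[OF d[OF that]] by (simp add: mult.commute)
  qed simp
qed

text \<open>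
  Multiplying \<open>y\<close> by \<open>h\<close> with \<open>h' = (a2 / 3) h\<close> adds
  \<open>a2 / 3\<close> to the slopes, which removes the quadratic term; the coordinate
  \<open>f\<close> divides the slopes by \<open>f'\<close>.
\<close>

lemma depressed_equivalence:
  assumes K: "cubic_equation K" and s: "s > 0" "s \<le> r"
    and a: "a2 holomorphic_on ball 0 r"
    and form: "homogeneous_monic K (bidisc r) a2 a1 a0"
    and f: "f holomorphic_on ball 0 s" "inj_on f (ball 0 s)" "f 0 = 0"
    and Q: "Q analytic_on {0}" "\<kappa> analytic_on {0}"
    and eq: "\<And>x. x \<in> ball 0 s \<Longrightarrow> Q (f x) * deriv f x^2 = depressed_q a2 a1 x \<and> \<kappa> (f x) * deriv f x^3 = depressed_k a2 a1 a0 x"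
    and K': "K' = Cubic (\<lambda>_. 1) (\<lambda>_. 0) (\<lambda>(x, y). Q x * y^2) (\<lambda>(x, y). \<kappa> x * y^3)"
  shows "cubic_equation K' \<and> equivalent_cubics K K'"
proof -
  have "(\<lambda>x. a2 x / 3) holomorphic_on ball 0 s" using a s by (auto intro!: holomorphic_intros elim!: holomorphic_on_subset)
  then obtain h where h: "h holomorphic_on ball 0 s" "\<And>x. x \<in> ball 0 s \<Longrightarrow> h x \<noteq> 0" "\<And>x. x \<in> ball 0 s \<Longrightarrow> deriv h x = a2 x / 3 * h x"
    using exponential_primitive[of "\<lambda>x. a2 x / 3" s] s(1) by metis
  obtain U where U: "(0, 0) \<in> U" "open U" "\<And>m. holo2_on (\<lambda>(x, y). Q x * y^m) U" "\<And>m. holo2_on (\<lambda>(x, y). \<kappa> x * y^m) U"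
    using analytic_coefficient_holo2[OF Q] by metis
  have rel: "forms_correspond K K' f h x y"
    if xy: "(x, y) \<in> bidisc s" for x y
  proof -
    have x: "x \<in> ball 0 s" using xy by simp
    note F = homogeneous_monicD[OF form subsetD[OF bidisc_mono[OF s(2)] xy]]
    let ?H = "h x" and ?a = "a2 x / 3" and ?f = "deriv f x"
    have a1: "a1 x = Q (f x) * ?f^2 + 3 * ?a^2" using eq[OF x] by (simp add: depressed_q_def power2_eq_square)
    have a0: "a0 x = \<kappa> (f x) * ?f^3 + Q (f x) * ?f^2 * ?a + ?a^3"
    proof -
      have e1: "27 * (\<kappa> (f x) * ?f^3) = 27 * a0 x - 9 * a1 x * a2 x + 2 * a2 x^3"
        using conjunct2[OF eq[OF x]] by (simp add: depressed_k_def)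
      have e2: "3 * (Q (f x) * ?f^2) = 3 * a1 x - a2 x^2" using conjunct1[OF eq[OF x]] by (simp add: depressed_q_def)
      have "27 * A0 = 27 * (k + q * t + t^3)"
        if "27 * k = 27 * A0 - 9 * A1 * b + 2 * b^3" "3 * q = 3 * A1 - b^2" "b = 3 * t" for A0 A1 b k q t :: complex
        using that by algebra
      from this[OF e1 e2, of ?a] have "27 * a0 x = 27 * (\<kappa> (f x) * ?f^3 + Q (f x) * ?f^2 * ?a + ?a^3)" by simp
      moreover have "u = v" if "27 * u = 27 * v" for u v :: complex using that by simp
      ultimately show ?thesis by blast
    qed
    have cf: "cf2 K (x, y) = cf3 K (x, y) * (3 * ?a * y)" "cf1 K (x, y) = cf3 K (x, y) * (a1 x * y^2)" "cf0 K (x, y) = cf3 K (x, y) * (a0 x * y^3)"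
      using F by auto
    let ?c = "?H^3 / cf3 K (x, y)"
    have c: "?c * (cf3 K (x, y) * t) = ?H^3 * t" for t using F by simp
    have "?c * cf3 K (x, y) = 1 * ?H^3" using c[of 1] by simp
    moreover have "?c * cf2 K (x, y) = ?H^2 * (3 * 1 * (y * (?a * ?H)) + 0 * ?f)"
    proof -
      have "H^3 * (3 * t * y) = H^2 * (3 * 1 * (y * (t * H)) + 0 * g)" for H t g :: complex by algebra
      thus ?thesis unfolding cf c .
    qed
    moreover have "?c * cf1 K (x, y) = ?H * (3 * 1 * (y * (?a * ?H))^2 + 2 * 0 * ?f * (y * (?a * ?H)) + Q (f x) * (y * ?H)^2 * ?f^2)"
    proof -
      have "H^3 * ((q * g^2 + 3 * t^2) * y^2) = H * (3 * 1 * (y * (t * H))^2 + 2 * 0 * g * (y * (t * H)) + q * (y * H)^2 * g^2)"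
        for H t g q :: complex by algebra
      thus ?thesis unfolding cf c a1 .
    qed
    moreover have "?c * cf0 K (x, y) = 1 * (y * (?a * ?H))^3 + 0 * (y * (?a * ?H))^2 * ?f + (Q (f x) * (y * ?H)^2) * (y * (?a * ?H)) * ?f^2
        + (\<kappa> (f x) * (y * ?H)^3) * ?f^3"
    proof -
      have "H^3 * ((k * g^3 + q * g^2 * t + t^3) * y^3) = 1 * (y * (t * H))^3 + 0 * (y * (t * H))^2 * g + (q * (y * H)^2) * (y * (t * H)) * g^2
        + (k * (y * H)^3) * g^3" for H t g q k :: complex by algebra
      thus ?thesis unfolding cf c a0 .
    qed
    moreover have "?c \<noteq> 0" using F h(2)[OF x] by simp
    ultimately show ?thesis unfolding forms_correspond_def K' h(3)[OF x] cubic.sel prod.case by metis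
  qed
  have "maps_web (\<lambda>z. (f (fst z), snd z * h (fst z))) K K' \<and> cubic_equation K'"
    by (intro conjI triangular_equivalence[OF K s(1) f h(1,2) U(1) _ _ _ _ _ rel])
       (use U K' in \<open>auto intro: holo2_on_const\<close>)
  thus ?thesis by (auto simp: equivalent_cubics_def)
qed

text \<open>
  The same for the two finite slopes alone: \<open>h' = (a1 / 2) h\<close> makes them opposite. The
  normal form has its coordinates exchanged.
\<close>

lemma vertical_equivalence:
  assumes K: "cubic_equation K" and s: "s > 0" "s \<le> r"
    and a: "a1 holomorphic_on ball 0 r"
    and form: "\<And>x y. (x, y) \<in> bidisc r \<Longrightarrow> cf2 K (x, y) \<noteq> 0 \<and> cf3 K (x, y) = 0 \<and>
        cf1 K (x, y) = cf2 K (x, y) * (a1 x * y) \<and> cf0 K (x, y) = cf2 K (x, y) * (a0 x * y^2)"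
    and f: "f holomorphic_on ball 0 s" "inj_on f (ball 0 s)" "f 0 = 0"
    and eq: "\<And>x. x \<in> ball 0 s \<Longrightarrow> f x^N * deriv f x^2 = a0 x - a1 x^2 / 4"
    and K': "K' = Cubic (\<lambda>_. 0) (\<lambda>_. 1) (\<lambda>_. 0) (\<lambda>(x, y). x^N * y^2)"
  shows "cubic_equation K' \<and> equivalent_cubics K (swap_cubic K')"
proof -
  have "(\<lambda>x. a1 x / 2) holomorphic_on ball 0 s" using a s by (auto intro!: holomorphic_intros elim!: holomorphic_on_subset)
  then obtain h where h: "h holomorphic_on ball 0 s" "\<And>x. x \<in> ball 0 s \<Longrightarrow> h x \<noteq> 0" "\<And>x. x \<in> ball 0 s \<Longrightarrow> deriv h x = a1 x / 2 * h x"
    using exponential_primitive[of "\<lambda>x. a1 x / 2" s] s(1) by metis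
  have pw: "(\<lambda>x::complex. x^N) analytic_on {0}" by (intro analytic_intros)
  obtain U where U: "(0, 0) \<in> U" "open U" "\<And>m. holo2_on (\<lambda>(x, y). x^N * y^m) U"
    using analytic_coefficient_holo2[OF pw pw] by metis
  have df: "deriv f x \<noteq> 0" if "x \<in> ball 0 s" for x by (rule holomorphic_injective_imp_regular[OF f(1) open_ball f(2) that])
  have rel: "forms_correspond K K' f h x y"
    if xy: "(x, y) \<in> bidisc s" for x y
  proof -
    have x: "x \<in> ball 0 s" using xy by simp
    note F = form[OF subsetD[OF bidisc_mono[OF s(2)] xy]]
    let ?H = "h x" and ?a = "a1 x / 2" and ?f = "deriv f x" and ?p = "f x^N"
    have a0: "a0 x = ?p * ?f^2 + ?a^2" using eq[OF x] by (simp add: power2_eq_square)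
    have cf: "cf3 K (x, y) = 0" "cf1 K (x, y) = cf2 K (x, y) * (2 * ?a * y)" "cf0 K (x, y) = cf2 K (x, y) * (a0 x * y^2)"
      using F by auto
    let ?c = "?H^2 * ?f / cf2 K (x, y)"
    have c: "?c * (cf2 K (x, y) * t) = ?H^2 * ?f * t" for t using F by simp
    have "?c * cf3 K (x, y) = 0 * ?H^3" unfolding cf by simp
    moreover have "?c * cf2 K (x, y) = ?H^2 * (3 * 0 * (y * (?a * ?H)) + 1 * ?f)" using c[of 1] by simp
    moreover have "?c * cf1 K (x, y) = ?H * (3 * 0 * (y * (?a * ?H))^2 + 2 * 1 * ?f * (y * (?a * ?H)) + 0 * ?f^2)"
    proof -
      have "H^2 * g * (2 * t * y) = H * (3 * 0 * (y * (t * H))^2 + 2 * 1 * g * (y * (t * H)) + 0 * g^2)"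
        for H t g :: complex by algebra
      thus ?thesis unfolding cf c .
    qed
    moreover have "?c * cf0 K (x, y) = 0 * (y * (?a * ?H))^3 + 1 * (y * (?a * ?H))^2 * ?f + 0 * (y * (?a * ?H)) * ?f^2
        + (?p * (y * ?H)^2) * ?f^3"
    proof -
      have "H^2 * g * ((p * g^2 + b^2) * y^2) = 0 * (y * (b * H))^3 + 1 * (y * (b * H))^2 * g + 0 * (y * (b * H)) * g^2
        + (p * (y * H)^2) * g^3" for H g p b :: complex by algebra
      thus ?thesis unfolding cf c a0 .
    qed
    moreover have "?c \<noteq> 0" using F h(2)[OF x] df[OF x] by simp
    ultimately show ?thesis unfolding forms_correspond_def K' h(3)[OF x] cubic.sel prod.case by metis
  qed
  have "maps_web (\<lambda>z. (f (fst z), snd z * h (fst z))) K K' \<and> cubic_equation K'"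
    by (intro conjI triangular_equivalence[OF K s(1) f h(1,2) U(1) _ _ _ _ _ rel])
       (use U K' in \<open>auto intro: holo2_on_const\<close>)
  thus ?thesis using maps_web_swap_post by (auto simp: equivalent_cubics_def)
qed

section \<open>Classification\<close>

text \<open>
  The coordinate \<open>f\<close> is chosen for \<open>q\<close>, and \<open>\<kappa>\<close> is
  what becomes of \<open>k\<close>. If the constant \<open>L1\<close> that results has the wrong
  argument, then \<open>f\<close> is multiplied by the root of unity of
  \<open>tan_coefficient_flip\<close>.
\<close>

lemma normal_coordinates:
  assumes \<rho>: "\<rho> > 0" and qk: "q holomorphic_on ball 0 \<rho>" "k holomorphic_on ball 0 \<rho>"
    and ode: "\<And>x. x \<in> ball 0 \<rho> - {0} \<Longrightarrow> 4 * q x ^ 3 + 27 * k x ^ 2 \<noteq> (0::complex) \<and>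
      2 * q x * deriv k x - 3 * k x * deriv q x = C * (4 * q x ^ 3 + 27 * k x ^ 2)"
    and nz: "x1 \<in> ball 0 \<rho>" "q x1 \<noteq> 0"
  shows "\<exists>N f s \<kappa>. s > 0 \<and> s \<le> \<rho> \<and> f holomorphic_on ball 0 s \<and> inj_on f (ball 0 s) \<and> f 0 = 0 \<and>
     (\<forall>x\<in>ball 0 s. f x ^ N * deriv f x ^ 2 = q x \<and> \<kappa> (f x) * deriv f x ^ 3 = k x) \<and> \<kappa> analytic_on {0} \<and>
     ((\<exists>L0 L1. admissible_L1 N L1 \<and> tan_coefficient N L0 L1 (\<lambda>X. - \<kappa> X)) \<or>
      (\<exists>L0. N > 0 \<and> L0 \<noteq> 0 \<and> cot_coefficient N L0 \<kappa>))"
proof -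
  have two: "(0::nat) < 2" by simp
  obtain N f s where s: "s > 0" "s \<le> \<rho>" and f: "f holomorphic_on ball 0 s" "inj_on f (ball 0 s)" "f 0 = 0"
    and fq: "\<And>x. x \<in> ball 0 s \<Longrightarrow> deriv f x \<noteq> 0 \<and> f x ^ N * deriv f x ^ 2 = q x"
    using normalizing_coordinate[OF qk(1) \<rho> nz two] by blast
  let ?B = "ball (0::complex) s"
  obtain g where g: "g holomorphic_on f ` ?B" "\<And>x. x \<in> ?B \<Longrightarrow> g (f x) = x"
    using holomorphic_has_inverse[OF f(1) open_ball f(2)] by metis
  have o: "open (f ` ?B)" by (rule open_mapping_thm3[OF f(1) open_ball f(2)])
  have sB: "?B \<subseteq> ball 0 \<rho>" using s by auto
  have z: "0 \<in> f ` ?B" using f(3) s(1) by (metis centre_in_ball imageI)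
  define \<kappa> where "\<kappa> X = k (g X) / deriv f (g X) ^ 3" for X
  have gB: "g X \<in> ?B" if "X \<in> f ` ?B" for X using that g(2) by auto
  have h\<kappa>: "\<kappa> holomorphic_on f ` ?B"
  proof -
    have "k holomorphic_on ?B" "deriv f holomorphic_on ?B" using qk(2) sB f(1) by (auto intro: holomorphic_deriv elim!: holomorphic_on_subset)
    hence "(\<lambda>X. k (g X)) holomorphic_on f ` ?B" "(\<lambda>X. deriv f (g X)) holomorphic_on f ` ?B"
      using gB by (auto intro!: holomorphic_on_compose_gen[OF g(1), unfolded o_def])
    thus ?thesis unfolding \<kappa>_def[abs_def] using gB fq by (intro holomorphic_intros) auto
  qed
  have \<kappa>f: "\<kappa> (f x) * deriv f x ^ 3 = k x" if "x \<in> ?B" for x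
    using g(2)[OF that] fq[OF that] by (simp add: \<kappa>_def)
  have ana: "\<kappa> analytic_on {0}" using h\<kappa> o z by (auto simp: analytic_at)
  obtain t where t: "t > 0" "ball 0 t \<subseteq> f ` ?B" using o z openE by blast
  have h\<kappa>t: "\<kappa> holomorphic_on ball 0 t" using h\<kappa> t(2) by (rule holomorphic_on_subset)
  have ode\<kappa>: "2 * X^N * deriv \<kappa> X - 3 * of_nat N * X^(N - 1) * \<kappa> X = C * (4 * X^(3*N) + 27 * \<kappa> X^2)
          \<and> 4 * X^(3*N) + 27 * \<kappa> X^2 \<noteq> 0" if X: "X \<in> ball 0 t - {0}" for X
  proof -
    obtain x where x: "x \<in> ?B" "X = f x" using X t(2) by auto
    have x0: "x \<in> ball 0 \<rho> - {0}" using x sB X f(3) by auto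
    have x\<rho>: "x \<in> ball 0 \<rho>" using x0 by blast
    have d: "(q has_field_derivative deriv q x) (at x)" "(k has_field_derivative deriv k x) (at x)"
      "(f has_field_derivative deriv f x) (at x)" "(deriv f has_field_derivative deriv (deriv f) x) (at x)"
      using holomorphic_derivI[OF qk(1) open_ball x\<rho>] holomorphic_derivI[OF qk(2) open_ball x\<rho>] holomorphic_derivI[OF f(1) open_ball x(1)]
        holomorphic_derivI[OF holomorphic_deriv[OF f(1) open_ball] open_ball x(1)] by auto
    have d\<kappa>: "(\<kappa> has_field_derivative deriv \<kappa> (f x)) (at (f x))"
      by (rule holomorphic_derivI[OF h\<kappa> o]) (use x in simp)
    have f0: "deriv f x \<noteq> 0" using fq[OF x(1)] by simp
    have e: "\<And>x. x \<in> ?B \<Longrightarrow> q x = f x ^ N * deriv f x ^ 2" "\<And>x. x \<in> ?B \<Longrightarrow> k x = \<kappa> (f x) * deriv f x ^ 3"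
      using fq \<kappa>f by auto
    note change = ode_change_of_coordinate[of q "deriv q x" x k "deriv k x" f "deriv f x" "deriv f" "deriv (deriv f) x" \<kappa> "deriv \<kappa> (f x)" ?B N C]
    have "2 * f x ^ N * deriv \<kappa> (f x) - 3 * of_nat N * f x ^ (N - 1) * \<kappa> (f x) = C * (4 * f x ^ (3 * N) + 27 * \<kappa> (f x) ^ 2)"
      by (rule change(1)) (fact d refl f0 d\<kappa> open_ball x(1) e conjunct2[OF ode[OF x0]] conjunct1[OF ode[OF x0]])+
    moreover have "4 * f x ^ (3 * N) + 27 * \<kappa> (f x) ^ 2 \<noteq> 0"
      by (rule change(2)) (fact d refl f0 d\<kappa> open_ball x(1) e conjunct2[OF ode[OF x0]] conjunct1[OF ode[OF x0]])+
    ultimately show ?thesis unfolding x(2) by blast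
  qed
  consider (tan) L0 L1 where "cos L1 \<noteq> 0" "odd N \<longrightarrow> L1 = 0" "tan_coefficient N L0 L1 (\<lambda>X. - \<kappa> X)"
    | (cot) L0 where "N > 0" "L0 \<noteq> 0" "cot_coefficient N L0 \<kappa>"
    using normalized_ode_solution[OF t(1) h\<kappa>t ode\<kappa>] by blast
  thus ?thesis
  proof cases
    case cot
    hence c: "\<exists>L0. N > 0 \<and> L0 \<noteq> 0 \<and> cot_coefficient N L0 \<kappa>" by blast
    show ?thesis
      by (intro exI[of _ N] exI[of _ f] exI[of _ s] exI[of _ \<kappa>] conjI ballI disjI2) (use s f fq \<kappa>f ana c in \<open>simp_all\<close>)
  next
    case tan
    show ?thesis
    proof (cases "L1 = 0 \<or> (0 \<le> Arg L1 \<and> Arg L1 < pi)")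
      case True
      hence "admissible_L1 N L1" using tan by (auto simp: admissible_L1_def)
      hence c: "\<exists>L0 L1. admissible_L1 N L1 \<and> tan_coefficient N L0 L1 (\<lambda>X. - \<kappa> X)" using tan by blast
      show ?thesis
        by (intro exI[of _ N] exI[of _ f] exI[of _ s] exI[of _ \<kappa>] conjI ballI disjI1) (use s f fq \<kappa>f ana c in \<open>simp_all\<close>)
    next
      case False
      hence A: "L1 \<noteq> 0" "0 \<le> Arg (- L1) \<and> Arg (- L1) < pi" using Arg_in_half_plane[of L1] by auto
      hence adm: "admissible_L1 N (- L1)" using tan by (auto simp: admissible_L1_def)
      obtain \<omega> where w: "\<omega> \<noteq> 0" "\<omega>^(N + 2) = 1" "tan_coefficient N L0 (- L1) (\<lambda>X. - (\<kappa> (X / \<omega>) / \<omega>^3))"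
        by (rule tan_coefficient_flip[OF tan(3)])
      define F where "F x = \<omega> * f x" for x
      have hF: "F holomorphic_on ?B" unfolding F_def using f(1) by (intro holomorphic_intros)
      have iF: "inj_on F ?B" using f(2) w(1) by (auto simp: F_def inj_on_def)
      have dF: "deriv F x = \<omega> * deriv f x" if "x \<in> ?B" for x
        unfolding F_def by (rule DERIV_imp_deriv[OF DERIV_cmult[OF holomorphic_derivI[OF f(1) open_ball that]]])
      have Fq: "F x ^ N * deriv F x ^ 2 = q x" if "x \<in> ?B" for x
      proof -
        have "F x ^ N * deriv F x ^ 2 = \<omega>^(N + 2) * (f x ^ N * deriv f x ^ 2)"
          unfolding dF[OF that] unfolding F_def by (simp add: power_mult_distrib power_add mult_ac power2_eq_square)
        thus ?thesis using w(2) fq[OF that] by simp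
      qed
      have Fk: "\<kappa> (F x / \<omega>) / \<omega>^3 * deriv F x ^ 3 = k x" if "x \<in> ?B" for x
        using \<kappa>f[OF that] w(1) unfolding dF[OF that] unfolding F_def by (simp add: power_mult_distrib)
      have Fa: "(\<lambda>X. \<kappa> (X / \<omega>) / \<omega>^3) analytic_on {0}"
      proof -
        have "(\<kappa> \<circ> (\<lambda>X. X / \<omega>)) analytic_on {0}"
          by (rule analytic_on_compose) (use ana w(1) in \<open>auto intro!: analytic_intros\<close>)
        thus ?thesis using w(1) by (intro analytic_intros) (auto simp: o_def)
      qed
      have F0: "F 0 = 0" using f(3) by (simp add: F_def)
      have c: "\<exists>L0 L1. admissible_L1 N L1 \<and> tan_coefficient N L0 L1 (\<lambda>X. - (\<kappa> (X / \<omega>) / \<omega>^3))" using adm w(3) by blast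
      show ?thesis
        by (intro exI[of _ N] exI[of _ F] exI[of _ s] exI[of _ "\<lambda>X. \<kappa> (X / \<omega>) / \<omega>^3"] conjI ballI disjI1)
           (fact s hF iF F0 Fa c | rule Fq Fk, assumption)+
    qed
  qed
qed

definition has_normal_form :: "cubic \<Rightarrow> bool" where
  "has_normal_form K \<longleftrightarrow> (\<exists>(N::nat) (L0::complex) (L1::complex) K'.
    cubic_equation K' \<and> equivalent_cubics K K' \<and>
    (normal_form_1 N K' \<or> (normal_form_2 N L0 L1 K' \<and> admissible_L1 N L1) \<or> normal_form_3 N L0 K' \<or> normal_form_4 N K'))"

lemma has_normal_form_graph_case:
  fixes a2 a1 a0 :: "complex \<Rightarrow> complex"
  assumes K: "cubic_equation K" and r: "r > 0"
    and a: "a2 holomorphic_on ball 0 r" "a1 holomorphic_on ball 0 r" "a0 holomorphic_on ball 0 r"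
    and form: "homogeneous_monic K (bidisc r) a2 a1 a0"
    and ab: "locally_abelian_on K (bidisc r)"
  shows "has_normal_form K"
proof -
  let ?q = "depressed_q a2 a1" and ?k = "depressed_k a2 a1 a0"
  obtain \<rho> C where \<rho>: "\<rho> > 0" "\<rho> \<le> r" and ode: "\<And>x. x \<in> ball 0 \<rho> - {0} \<Longrightarrow> 4 * ?q x ^ 3 + 27 * ?k x ^ 2 \<noteq> 0 \<and>
      2 * ?q x * deriv ?k x - 3 * ?k x * deriv ?q x = C * (4 * ?q x ^ 3 + 27 * ?k x ^ 2)"
    using flat_ode[OF K r a form ab] by blast
  have sub: "ball (0::complex) \<rho> \<subseteq> ball 0 r" using \<rho> by auto
  have hol: "?q holomorphic_on ball 0 \<rho>" "?k holomorphic_on ball 0 \<rho>"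
    unfolding depressed_q_def depressed_k_def using a sub by (auto intro!: holomorphic_intros elim!: holomorphic_on_subset)
  show ?thesis
  proof (cases "\<exists>x1\<in>ball 0 \<rho>. ?q x1 \<noteq> 0")
    case False
    define x1 :: complex where "x1 = of_real (\<rho> / 2)"
    have x1: "x1 \<in> ball 0 \<rho> - {0}" using \<rho>(1) by (auto simp: x1_def)
    have "- ?k x1 \<noteq> 0"
    proof
      assume "- ?k x1 = 0"
      moreover have "?q x1 = 0" using False x1 by blast
      ultimately show False using conjunct1[OF ode[OF x1]] by simp
    qed
    moreover have "(\<lambda>x. - ?k x) holomorphic_on ball 0 \<rho>" using hol(2) by (intro holomorphic_intros)
    moreover have "x1 \<in> ball 0 \<rho>" "(0::nat) < 3" using x1 by auto
    ultimately obtain N f s where s: "s > 0" "s \<le> \<rho>" and f: "f holomorphic_on ball 0 s" "inj_on f (ball 0 s)" "f 0 = 0"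
      and fk: "\<And>x. x \<in> ball 0 s \<Longrightarrow> f x ^ N * deriv f x ^ 3 = - ?k x"
      using normalizing_coordinate[of "\<lambda>x. - ?k x" \<rho> x1 3] \<rho>(1) by metis
    define K' where "K' = Cubic (\<lambda>_. 1) (\<lambda>_. 0) (\<lambda>(x, y). 0 * y^2) (\<lambda>(x, y). - (x^N) * y^3)"
    have "cubic_equation K' \<and> equivalent_cubics K K'"
    proof (rule depressed_equivalence[OF K s(1) order_trans[OF s(2) \<rho>(2)] a(1) form f, where Q = "\<lambda>_. 0" and \<kappa> = "\<lambda>x. - (x^N)"])
      show "0 * (deriv f x)^2 = ?q x \<and> - (f x ^ N) * deriv f x ^ 3 = ?k x" if "x \<in> ball 0 s" for x
      proof -
        have "x \<in> ball 0 \<rho>" using that s by auto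
        thus ?thesis using False fk[OF that] by (auto simp: minus_equation_iff)
      qed
    qed (auto intro!: analytic_intros simp: K'_def)
    moreover have "normal_form_1 N K'" by (simp add: normal_form_1_def K'_def fun_eq_iff)
    ultimately show ?thesis unfolding has_normal_form_def by blast
  next
    case True
    then obtain x1 where x1: "x1 \<in> ball 0 \<rho>" "?q x1 \<noteq> 0" by blast
    obtain N f s \<kappa> where s: "s > 0" "s \<le> \<rho>" and f: "f holomorphic_on ball 0 s" "inj_on f (ball 0 s)" "f 0 = 0"
      and eq: "\<And>x. x \<in> ball 0 s \<Longrightarrow> f x ^ N * deriv f x ^ 2 = ?q x \<and> \<kappa> (f x) * deriv f x ^ 3 = ?k x" and ana: "\<kappa> analytic_on {0}"
      and cases: "(\<exists>L0 L1. admissible_L1 N L1 \<and> tan_coefficient N L0 L1 (\<lambda>X. - \<kappa> X)) \<or>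
        (\<exists>L0. N > 0 \<and> L0 \<noteq> 0 \<and> cot_coefficient N L0 \<kappa>)"
      using normal_coordinates[OF \<rho>(1) hol ode x1] by blast
    define K' where "K' = Cubic (\<lambda>_. 1) (\<lambda>_. 0) (\<lambda>(x, y). x^N * y^2) (\<lambda>(x, y). \<kappa> x * y^3)"
    have E: "cubic_equation K' \<and> equivalent_cubics K K'"
      by (rule depressed_equivalence[OF K s(1) order_trans[OF s(2) \<rho>(2)] a(1) form f, where Q = "\<lambda>x. x^N" and \<kappa> = \<kappa>])
         (use eq ana in \<open>auto intro!: analytic_intros simp: K'_def\<close>)
    from cases show ?thesis
    proof (elim disjE exE conjE)
      fix L0 L1 assume "admissible_L1 N L1" and t: "tan_coefficient N L0 L1 (\<lambda>X. - \<kappa> X)"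
      moreover have "normal_form_2 N L0 L1 K'" unfolding normal_form_2_def
        using t ana by (intro exI[of _ "\<lambda>X. - \<kappa> X"]) (auto simp: tan_coefficient_def K'_def fun_eq_iff intro!: analytic_intros)
      ultimately show ?thesis using E unfolding has_normal_form_def by blast
    next
      fix L0 assume N: "N > 0" "L0 \<noteq> 0" and c: "cot_coefficient N L0 \<kappa>"
      obtain M where M: "N = M + 1" using N(1) by (metis Suc_eq_plus1 gr0_conv_Suc)
      have e: "M + 1 + 2 = M + 3" by simp
      have c': "\<forall>\<^sub>F s in at 0. \<kappa> (s^2) = 2 * s^(3 * (M + 1)) / (complex_of_real (sqrt 27) * tan (L0 * s^(M + 3)))"
        using c unfolding cot_coefficient_def M e .
      have "normal_form_3 M L0 K'" unfolding normal_form_3_def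
        by (intro conjI exI[of _ \<kappa>] N(2) ana c') (simp add: K'_def M)
      thus ?thesis using E unfolding has_normal_form_def by blast
    qed
  qed
qed

text \<open>
  Here \<open>dx = 0\<close> is one of the foliations, and the discriminant is a multiple of
  \<open>q\<close>, which therefore is not identically zero.
\<close>

lemma has_normal_form_vertical_case:
  assumes K: "cubic_equation K" and r: "r > 0"
    and a: "a1 holomorphic_on ball 0 r" "a0 holomorphic_on ball 0 r"
    and form: "\<And>x y. (x, y) \<in> bidisc r \<Longrightarrow> cf2 K (x, y) \<noteq> 0 \<and> cf3 K (x, y) = 0 \<and>
        cf1 K (x, y) = cf2 K (x, y) * (a1 x * y) \<and> cf0 K (x, y) = cf2 K (x, y) * (a0 x * y^2)"
  shows "has_normal_form K"
proof -
  define q where "q x = a0 x - a1 x^2 / 4" for x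
  have hol: "q holomorphic_on ball 0 r" unfolding q_def using a by (auto intro!: holomorphic_intros)
  obtain z where z: "z \<in> bidisc r" "discr K z \<noteq> 0" by (rule cubic_equation_nonzero_discr[OF K r])
  obtain x y where xy: "z = (x, y)" by (cases z)
  have "discr K z = cf2 K z^4 * y^2 * (a1 x^2 - 4 * a0 x)"
    using form[of x y] z unfolding xy discr_def Let_def by (simp add: algebra_simps eval_nat_numeral)
  moreover have "a1 x^2 - 4 * a0 x = - 4 * q x" by (simp add: q_def)
  ultimately have nz: "x \<in> ball 0 r" "q x \<noteq> 0" using z unfolding xy by auto
  have two: "(0::nat) < 2" by simp
  obtain N f s where s: "s > 0" "s \<le> r" and f: "f holomorphic_on ball 0 s" "inj_on f (ball 0 s)" "f 0 = 0"
    and fq: "\<And>x. x \<in> ball 0 s \<Longrightarrow> f x ^ N * deriv f x ^ 2 = q x"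
    using normalizing_coordinate[OF hol r nz two] by blast
  define K' where "K' = Cubic (\<lambda>_. 0) (\<lambda>_. 1) (\<lambda>_. 0) (\<lambda>(x, y). x^N * y^2)"
  have "cubic_equation K' \<and> equivalent_cubics K (swap_cubic K')"
    by (rule vertical_equivalence[OF K s a(1) form f _ K'_def]) (use fq q_def in auto)
  moreover have "normal_form_4 N (swap_cubic K')"
    by (auto simp: normal_form_4_def swap_cubic_def K'_def fun_eq_iff)
  ultimately show ?thesis unfolding has_normal_form_def using cubic_equation_swap by blast
qed

lemma has_normal_form_homogeneous:
  assumes K: "cubic_equation K" and hom: "weighted_homogeneous K 0 wy" and flat: "flat_web K"
  shows "has_normal_form K"
proof -
  obtain r j a where r: "r > 0" and j: "j = 2 \<or> j = 3" and a: "\<And>i. i \<le> 3 \<Longrightarrow> a i holomorphic_on ball 0 r"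
    and nz: "\<And>z. z \<in> bidisc r \<Longrightarrow> coeff_at K z j \<noteq> 0"
    and form: "\<And>i x y. i \<le> 3 \<Longrightarrow> (x, y) \<in> bidisc r \<Longrightarrow>
        coeff_at K (x, y) i = coeff_at K (x, y) j * (if i \<le> j then a i x * y^(j - i) else 0)"
    and ab: "locally_abelian_on K (bidisc r)"
    by (rule homogeneous_coefficients[OF assms]) blast
  from j show ?thesis
  proof
    assume j: "j = 3"
    show ?thesis
    proof (rule has_normal_form_graph_case[OF K r a[of 2] a[of 1] a[of 0] _ ab])
      show "homogeneous_monic K (bidisc r) (a 2) (a 1) (a 0)" unfolding homogeneous_monic_def
      proof (intro allI impI)
        fix x y assume xy: "(x, y) \<in> bidisc r"
        show "cf3 K (x, y) \<noteq> 0 \<and> cf2 K (x, y) = cf3 K (x, y) * (a 2 x * y) \<and>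
          cf1 K (x, y) = cf3 K (x, y) * (a 1 x * y^2) \<and> cf0 K (x, y) = cf3 K (x, y) * (a 0 x * y^3)"
          using nz[OF xy] form[OF _ xy, of 2] form[OF _ xy, of 1] form[OF _ xy, of 0] unfolding j by simp
      qed
    qed auto
  next
    assume j: "j = 2"
    show ?thesis
    proof (rule has_normal_form_vertical_case[OF K r a[of 1] a[of 0]])
      show "cf2 K (x, y) \<noteq> 0 \<and> cf3 K (x, y) = 0 \<and>
        cf1 K (x, y) = cf2 K (x, y) * (a 1 x * y) \<and> cf0 K (x, y) = cf2 K (x, y) * (a 0 x * y^2)" if "(x, y) \<in> bidisc r" for x y
        using nz[OF that] form[OF _ that, of 3] form[OF _ that, of 1] form[OF _ that, of 0] unfolding j by simp
    qed auto
  qed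
qed

theorem theorem5:
  fixes K :: cubic and wx wy :: complex
  assumes "cubic_equation K"
    and "weighted_homogeneous K wx wy"
    and "wx = 0 \<or> wy = 0"
    and "flat_web K"
  shows "\<exists>(N::nat) (L0::complex) (L1::complex) K'.
    cubic_equation K' \<and> equivalent_cubics K K' \<and>
    (normal_form_1 N K' \<or>
     (normal_form_2 N L0 L1 K' \<and> admissible_L1 N L1) \<or>
     normal_form_3 N L0 K' \<or>
     normal_form_4 N K')"
proof -
  have "has_normal_form K"
  proof (cases "wx = 0")
    case True
    thus ?thesis using has_normal_form_homogeneous assms by blast
  next
    case False
    hence "weighted_homogeneous (swap_cubic K) 0 wx" using weighted_homogeneous_swap[OF assms(2)] assms(3) by simp
    hence "has_normal_form (swap_cubic K)"
      using has_normal_form_homogeneous cubic_equation_swap[OF assms(1)] flat_web_swap[OF assms(4)] by blast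
    moreover have "equivalent_cubics K K'" if "equivalent_cubics (swap_cubic K) K'" for K'
      using that maps_web_swap_pre unfolding equivalent_cubics_def by blast
    ultimately show ?thesis unfolding has_normal_form_def by blast
  qed
  thus ?thesis unfolding has_normal_form_def .
qed

end
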